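(* Let $\mathcal C$ be a small category that satisfies the right Ore conditions and let $F=(\mathcal G_x,\mathcal X_g,\mu_{g,h})$ be a $\mathcal C$-shaped diagram of groupoid correspondences. Then the canonical $F$-action on the space $\Omega=\bigsqcup_{x\in\mathcal C^0}\Omega_x$, where $\Omega_x=\varprojlim_{\mathcal D_x}(\mathcal X_g/\mathcal G_{s(g)},\pi_{g,h})$, is universal.
   Context: Groupoids. All groupoids are topological groupoids $\mathcal G$ (object space $\mathcal G^0\subseteq\mathcal G$, continuous range, source, multiplication, inversion; $gh$ is defined iff $s(g)=r(h)$) that are étale: $r,s$ are local homeomorphisms. No Hausdorff or local compactness assumption is made. A right $\mathcal G$-space is a space $\mathcal X$ with a continuous anchor map $s\colon\mathcal X\to\mathcal G^0$ and a continuous map $\{(x,g): s(x)=r(g)\}\to\mathcal X$, $(x,g)\mapsto xg$, with $s(xg)=s(g)$, $(xg_1)g_2=x(g_1g_2)$, $x\,s(x)=x$; left $\mathcal G$-spaces are analogous with anchor map $r$. $\mathcal X/\mathcal G$ is the orbit space with the quotient topology. A right $\mathcal G$-space is basic if $\{(x,g):s(x)=r(g)\}\to\mathcal X\times\mathcal X$, $(x,g)\mapsto(xg,x)$, is a homeomorphism onto its image. A groupoid correspondence $\mathcal X\colon\mathcal H\leftarrow\mathcal G$ is a space with commuting actions of $\mathcal H$ on the left (anchor $r$) and $\mathcal G$ on the right (anchor $s$) such that $s\colon\mathcal X\to\mathcal G^0$ is a local homeomorphism and the right action is basic. (Commuting: $s(hx)=s(x)$, $r(xg)=r(x)$, $(hx)g=h(xg)$.)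 For a right $\mathcal G$-space $\mathcal X$ and a left $\mathcal G$-space $\mathcal Y$, $\mathcal X\circ_{\mathcal G}\mathcal Y$ is the orbit space of $\{(x,y):s(x)=r(y)\}$ under $g\cdot(x,y)=(xg^{-1},gy)$; the class of $(x,y)$ is $[x,y]$. For correspondences this is the composite correspondence, with the induced outer actions. Isomorphisms of correspondences are biequivariant homeomorphisms. Diagrams. $\mathcal C$ also denotes the set of arrows, objects $\mathcal C^0$ are identified with identity arrows, $g\colon x\leftarrow y$ means $r(g)=x$, $s(g)=y$. A $\mathcal C$-shaped diagram $F=(\mathcal G_x,\mathcal X_g,\mu_{g,h})$ consists of groupoids $\mathcal G_x$ ($x\in\mathcal C^0$), correspondences $\mathcal X_g\colon\mathcal G_{r(g)}\leftarrow\mathcal G_{s(g)}$ ($g\in\mathcal C$) and isomorphisms of correspondences $\mu_{g,h}\colon\mathcal X_g\circ_{\mathcal G_{s(g)}}\mathcal X_h\to\mathcal X_{gh}$ for composable $g,h$, written $\gamma\cdot\eta=\mu_{g,h}[\gamma,\eta]$, such that $\mathcal X_x=\mathcal G_x$ with left and right multiplication for identity arrows $x$, $\mu_{r(g),g}$ and $\mu_{g,s(g)}$ are given by the left and right actions, and the product $\cdot$ is associative. $F$-actions. An $F$-action on a space $Y$ consists of a partition $Y=\bigsqcup_{x\in\mathcal C^0}Y_x$ into clopen subsets, continuous maps $r\colon Y_x\to\mathcal G_x^0$, and open, continuous, surjective maps $\{(\gamma,y)\in\mathcal X_g\times Y_{s(g)}: s(\gamma)=r(y)\}\to Y_{r(g)}$,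 $(\gamma,y)\mapsto\gamma\cdot y$, for all $g\in\mathcal C$, such that (i) $r(\gamma_2\cdot y)=r(\gamma_2)$ and $\gamma_1\cdot(\gamma_2\cdot y)=(\gamma_1\cdot\gamma_2)\cdot y$ for composable $g_1,g_2$, $\gamma_i\in\mathcal X_{g_i}$, $y\in Y_{s(g_2)}$ with $s(\gamma_1)=r(\gamma_2)$, $s(\gamma_2)=r(y)$; (ii) if $\gamma\cdot y=\gamma'\cdot y'$ with $\gamma,\gamma'\in\mathcal X_g$, $y,y'\in Y_{s(g)}$, then there is $\eta\in\mathcal G_{s(g)}$ with $\gamma'=\gamma\eta$ and $y=\eta y'$. A continuous map $\varphi\colon Y\to Y'$ between $F$-actions is $F$-equivariant if $\varphi(Y_x)\subseteq Y'_x$, $r(\varphi(y))=r(y)$ and $\varphi(\gamma\cdot y)=\gamma\cdot\varphi(y)$ whenever defined. An $F$-action $\Omega$ is universal if every $F$-action $Y$ admits a unique $F$-equivariant continuous map $Y\to\Omega$. Right Ore conditions on $\mathcal C$: (O1) if $g_1,g_2\in\mathcal C$ satisfy $r(g_1)=r(g_2)$, then there are $h_1,h_2\in\mathcal C$ with $s(g_i)=r(h_i)$ and $g_1h_1=g_2h_2$; (O2) if $g,h_1,h_2\in\mathcal C$ satisfy $s(g)=r(h_1)=r(h_2)$ and $gh_1=gh_2$, then there is $k\in\mathcal C$ with $r(k)=s(h_1)=s(h_2)$ and $h_1k=h_2k$. The space $\Omega$ and its $F$-action. For composable $g,h$, let $\pi_{g,h}\colon\mathcal X_{gh}/\mathcal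 G_{s(h)}\to\mathcal X_g/\mathcal G_{s(g)}$, $[\gamma_1\cdot\gamma_2]\mapsto[\gamma_1]$ for $\gamma_1\in\mathcal X_g$, $\gamma_2\in\mathcal X_h$. For $x\in\mathcal C^0$, $\mathcal D_x$ is the category with objects $\mathcal C^x=\{g\in\mathcal C:r(g)=x\}$, arrows $g_1\to g_2$ the $h\in\mathcal C$ with $g_1=g_2h$, composed as in $\mathcal C$. Then $\Omega_x$ is the space of families $(\omega_g)_{g\in\mathcal C^x}$, $\omega_g\in\mathcal X_g/\mathcal G_{s(g)}$, with $\pi_{g,h}(\omega_{gh})=\omega_g$ for all $g\in\mathcal C^x$ and $h$ with $r(h)=s(g)$, with the subspace topology of the product. The map $r\colon\Omega_x\to\mathcal G_x^0$ is $\omega\mapsto\omega_x\in\mathcal X_x/\mathcal G_x\cong\mathcal G_x^0$. For $\gamma\in\mathcal X_g$, $\omega\in\Omega_{s(g)}$ with $s(\gamma)=r(\omega)$, $\gamma\cdot\omega$ is the unique element of $\Omega_{r(g)}$ with $(\gamma\cdot\omega)_{gh}=[\gamma\cdot\gamma_h]$ for all $h\in\mathcal C^{s(g)}$, where $\gamma_h\in\mathcal X_h$ represents $\omega_h$ (under the right Ore conditions these formulas determine $\gamma\cdot\omega$ and define an $F$-action on $\Omega$). *)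

theory Defs
  imports "HOL-Analysis.Analysis"
begin

section \<open>Topological preliminaries\<close>

definition local_homeomorphism :: "'a topology \<Rightarrow> 'b topology \<Rightarrow> ('a \<Rightarrow> 'b) \<Rightarrow> bool" where
  "local_homeomorphism X Y f \<longleftrightarrow>
     continuous_map X Y f \<and>
     (\<forall>x \<in> topspace X. \<exists>U. openin X U \<and> x \<in> U \<and> openin Y (f ` U) \<and>
        homeomorphic_map (subtopology X U) (subtopology Y (f ` U)) f)"

definition fibre_product ::
    "'a topology \<Rightarrow> ('a \<Rightarrow> 'c) \<Rightarrow> 'b topology \<Rightarrow> ('b \<Rightarrow> 'c) \<Rightarrow> ('a \<times> 'b) topology" where
  "fibre_product X f Y g = subtopology (prod_topology X Y) {(x, y). f x = g y}"

definition quotient_topology :: "'a topology \<Rightarrow> ('a \<Rightarrow> 'b) \<Rightarrow> 'b topology" where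
  "quotient_topology X q =
     topology (\<lambda>U. U \<subseteq> q ` topspace X \<and> openin X {x \<in> topspace X. q x \<in> U})"

lemma openin_quotient_topology:
  "openin (quotient_topology X q) U \<longleftrightarrow>
     U \<subseteq> q ` topspace X \<and> openin X {x \<in> topspace X. q x \<in> U}"
proof -
  let ?L = "\<lambda>U. U \<subseteq> q ` topspace X \<and> openin X {x \<in> topspace X. q x \<in> U}"
  have "istopology ?L"
    unfolding istopology_def
  proof (intro conjI allI impI)
    fix S T assume S: "?L S" and T: "?L T"
    then show "S \<inter> T \<subseteq> q ` topspace X" by blast
    have "{x \<in> topspace X. q x \<in> S \<inter> T} =
        {x \<in> topspace X. q x \<in> S} \<inter> {x \<in> topspace X. q x \<in> T}" by blast
    then show "openin X {x \<in> topspace X. q x \<in> S \<inter> T}"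
      using openin_Int[OF conjunct2[OF S] conjunct2[OF T]] by (simp only:)
  next
    fix K assume K: "\<forall>S\<in>K. ?L S"
    then show "\<Union>K \<subseteq> q ` topspace X" by blast
    have "{x \<in> topspace X. q x \<in> \<Union>K} = \<Union>((\<lambda>S. {x \<in> topspace X. q x \<in> S}) ` K)"
      by blast
    moreover have "openin X (\<Union>((\<lambda>S. {x \<in> topspace X. q x \<in> S}) ` K))"
      by (rule openin_Union) (use K in blast)
    ultimately show "openin X {x \<in> topspace X. q x \<in> \<Union>K}" by (simp only:)
  qed
  then have "openin (topology ?L) = ?L" by (rule topology_inverse')
  then show ?thesis unfolding quotient_topology_def by (simp only:)
qed

lemma topspace_quotient_topology [simp]: "topspace (quotient_topology X q) = q ` topspace X"
proof
  show "topspace (quotient_topology X q) \<subseteq> q ` topspace X"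
    using openin_topspace[of "quotient_topology X q"] by (simp only: openin_quotient_topology)
  have "{x \<in> topspace X. q x \<in> q ` topspace X} = topspace X" by blast
  then have "openin (quotient_topology X q) (q ` topspace X)"
    by (simp only: openin_quotient_topology openin_topspace order_refl simp_thms)
  then show "q ` topspace X \<subseteq> topspace (quotient_topology X q)"
    by (rule openin_subset)
qed

lemma quotient_map_quotient_topology: "quotient_map X (quotient_topology X q) q"
  unfolding quotient_map_def topspace_quotient_topology openin_quotient_topology by blast


section \<open>Categories and the right Ore conditions\<close>

text \<open>Objects are identified with their identity arrows; an arrow \<open>g\<close> goes from \<open>Src C g\<close> to
  \<open>Rng C g\<close>, and \<open>Comp C g h\<close> is meaningful only if \<open>Src C g = Rng C h\<close>.\<close>

record 'c category =
  Arr :: "'c set"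
  Obj :: "'c set"
  Rng :: "'c \<Rightarrow> 'c"
  Src :: "'c \<Rightarrow> 'c"
  Comp :: "'c \<Rightarrow> 'c \<Rightarrow> 'c"

locale small_category =
  fixes C :: "('c, 'm) category_scheme"
  assumes Obj_subset: "Obj C \<subseteq> Arr C"
    and Rng_Obj: "g \<in> Arr C \<Longrightarrow> Rng C g \<in> Obj C"
    and Src_Obj: "g \<in> Arr C \<Longrightarrow> Src C g \<in> Obj C"
    and Rng_ident: "x \<in> Obj C \<Longrightarrow> Rng C x = x"
    and Src_ident: "x \<in> Obj C \<Longrightarrow> Src C x = x"
    and Comp_Arr: "\<lbrakk>g \<in> Arr C; h \<in> Arr C; Src C g = Rng C h\<rbrakk> \<Longrightarrow> Comp C g h \<in> Arr C"
    and Rng_Comp: "\<lbrakk>g \<in> Arr C; h \<in> Arr C; Src C g = Rng C h\<rbrakk> \<Longrightarrow> Rng C (Comp C g h) = Rng C g"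
    and Src_Comp: "\<lbrakk>g \<in> Arr C; h \<in> Arr C; Src C g = Rng C h\<rbrakk> \<Longrightarrow> Src C (Comp C g h) = Src C h"
    and Comp_assoc: "\<lbrakk>g \<in> Arr C; h \<in> Arr C; k \<in> Arr C; Src C g = Rng C h; Src C h = Rng C k\<rbrakk>
      \<Longrightarrow> Comp C (Comp C g h) k = Comp C g (Comp C h k)"
    and Comp_ident_left: "g \<in> Arr C \<Longrightarrow> Comp C (Rng C g) g = g"
    and Comp_ident_right: "g \<in> Arr C \<Longrightarrow> Comp C g (Src C g) = g"

definition right_Ore :: "'c category \<Rightarrow> bool" where
  "right_Ore C \<longleftrightarrow>
     (\<forall>g1 \<in> Arr C. \<forall>g2 \<in> Arr C. Rng C g1 = Rng C g2 \<longrightarrow>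
        (\<exists>h1 \<in> Arr C. \<exists>h2 \<in> Arr C.
           Src C g1 = Rng C h1 \<and> Src C g2 = Rng C h2 \<and> Comp C g1 h1 = Comp C g2 h2)) \<and>
     (\<forall>g \<in> Arr C. \<forall>h1 \<in> Arr C. \<forall>h2 \<in> Arr C.
        Src C g = Rng C h1 \<and> Src C g = Rng C h2 \<and> Comp C g h1 = Comp C g h2 \<longrightarrow>
        (\<exists>k \<in> Arr C. Rng C k = Src C h1 \<and> Rng C k = Src C h2 \<and> Comp C h1 k = Comp C h2 k))"


section \<open>Etale groupoids and their actions\<close>

record 'a groupoid = "'a category" +
  Inv :: "'a \<Rightarrow> 'a"
  Top :: "'a topology"

definition Obj_top :: "'a groupoid \<Rightarrow> 'a topology" where
  "Obj_top G = subtopology (Top G) (Obj G)"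

locale etale_groupoid = small_category G for G :: "'a groupoid" +
  assumes topspace_Top: "topspace (Top G) = Arr G"
    and Inv_Arr: "g \<in> Arr G \<Longrightarrow> Inv G g \<in> Arr G"
    and Rng_Inv: "g \<in> Arr G \<Longrightarrow> Rng G (Inv G g) = Src G g"
    and Src_Inv: "g \<in> Arr G \<Longrightarrow> Src G (Inv G g) = Rng G g"
    and Comp_Inv_right: "g \<in> Arr G \<Longrightarrow> Comp G g (Inv G g) = Rng G g"
    and Comp_Inv_left: "g \<in> Arr G \<Longrightarrow> Comp G (Inv G g) g = Src G g"
    and continuous_Comp:
      "continuous_map (fibre_product (Top G) (Src G) (Top G) (Rng G)) (Top G)
         (\<lambda>(g, h). Comp G g h)"
    and continuous_Inv: "continuous_map (Top G) (Top G) (Inv G)"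
    and Rng_local_homeomorphism: "local_homeomorphism (Top G) (Obj_top G) (Rng G)"
    and Src_local_homeomorphism: "local_homeomorphism (Top G) (Obj_top G) (Src G)"

locale left_space = etale_groupoid H
  for H :: "'a groupoid" and X :: "'x topology" and r :: "'x \<Rightarrow> 'a" and act :: "'a \<Rightarrow> 'x \<Rightarrow> 'x" +
  assumes continuous_anchor: "continuous_map X (Obj_top H) r"
    and continuous_act: "continuous_map (fibre_product (Top H) (Src H) X r) X (\<lambda>(h, x). act h x)"
    and anchor_act: "\<lbrakk>h \<in> Arr H; x \<in> topspace X; Src H h = r x\<rbrakk> \<Longrightarrow> r (act h x) = Rng H h"
    and act_act: "\<lbrakk>h1 \<in> Arr H; h2 \<in> Arr H; x \<in> topspace X; Src H h1 = Rng H h2; Src H h2 = r x\<rbrakk>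
      \<Longrightarrow> act h1 (act h2 x) = act (Comp H h1 h2) x"
    and act_ident: "x \<in> topspace X \<Longrightarrow> act (r x) x = x"

locale right_space = etale_groupoid G
  for G :: "'a groupoid" and X :: "'x topology" and s :: "'x \<Rightarrow> 'a" and act :: "'x \<Rightarrow> 'a \<Rightarrow> 'x" +
  assumes continuous_anchor: "continuous_map X (Obj_top G) s"
    and continuous_act: "continuous_map (fibre_product X s (Top G) (Rng G)) X (\<lambda>(x, g). act x g)"
    and anchor_act: "\<lbrakk>x \<in> topspace X; g \<in> Arr G; s x = Rng G g\<rbrakk> \<Longrightarrow> s (act x g) = Src G g"
    and act_act: "\<lbrakk>x \<in> topspace X; g1 \<in> Arr G; g2 \<in> Arr G; s x = Rng G g1; Src G g1 = Rng G g2\<rbrakk>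
      \<Longrightarrow> act (act x g1) g2 = act x (Comp G g1 g2)"
    and act_ident: "x \<in> topspace X \<Longrightarrow> act x (s x) = x"

locale basic_right_space = right_space +
  assumes basic: "embedding_map (fibre_product X s (Top G) (Rng G)) (prod_topology X X)
      (\<lambda>(x, g). (act x g, x))"


section \<open>Groupoid correspondences\<close>

record ('x, 'a) bispace =
  Space :: "'x topology"
  lanchor :: "'x \<Rightarrow> 'a"
  ranchor :: "'x \<Rightarrow> 'a"
  lact :: "'a \<Rightarrow> 'x \<Rightarrow> 'x"
  ract :: "'x \<Rightarrow> 'a \<Rightarrow> 'x"

locale correspondence =
  left: left_space H "Space X" "lanchor X" "lact X" +
  right: basic_right_space G "Space X" "ranchor X" "ract X"
  for H G :: "'a groupoid" and X :: "('x, 'a) bispace" +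
  assumes ranchor_lact: "\<lbrakk>h \<in> Arr H; x \<in> topspace (Space X); Src H h = lanchor X x\<rbrakk>
      \<Longrightarrow> ranchor X (lact X h x) = ranchor X x"
    and lanchor_ract: "\<lbrakk>x \<in> topspace (Space X); g \<in> Arr G; ranchor X x = Rng G g\<rbrakk>
      \<Longrightarrow> lanchor X (ract X x g) = lanchor X x"
    and ract_lact: "\<lbrakk>h \<in> Arr H; x \<in> topspace (Space X); g \<in> Arr G;
        Src H h = lanchor X x; ranchor X x = Rng G g\<rbrakk>
      \<Longrightarrow> ract X (lact X h x) g = lact X h (ract X x g)"
    and ranchor_local_homeomorphism:
      "local_homeomorphism (Space X) (Obj_top G) (ranchor X)"

definition right_orbit :: "'a groupoid \<Rightarrow> ('x, 'a) bispace \<Rightarrow> 'x \<Rightarrow> 'x set" where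
  "right_orbit G X x = {ract X x g |g. g \<in> Arr G \<and> ranchor X x = Rng G g}"

definition right_orbit_space :: "'a groupoid \<Rightarrow> ('x, 'a) bispace \<Rightarrow> 'x set topology" where
  "right_orbit_space G X = quotient_topology (Space X) (right_orbit G X)"

definition composite_class ::
    "'a groupoid \<Rightarrow> ('x, 'a) bispace \<Rightarrow> ('y, 'a) bispace \<Rightarrow> 'x \<Rightarrow> 'y \<Rightarrow> ('x \<times> 'y) set" where
  "composite_class G X Y x y =
     {(ract X x (Inv G g), lact Y g y) |g. g \<in> Arr G \<and> Src G g = ranchor X x}"

text \<open>The outer anchor maps are constant on the orbits, and the outer actions commute with the
  diagonal action, so they map each orbit onto an orbit.\<close>

definition composite ::
    "'a groupoid \<Rightarrow> ('x, 'a) bispace \<Rightarrow> ('y, 'a) bispace \<Rightarrow> (('x \<times> 'y) set, 'a) bispace" where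
  "composite G X Y =
     \<lparr> Space = quotient_topology (fibre_product (Space X) (ranchor X) (Space Y) (lanchor Y))
         (\<lambda>(x, y). composite_class G X Y x y),
       lanchor = (\<lambda>P. the_elem ((\<lambda>(x, y). lanchor X x) ` P)),
       ranchor = (\<lambda>P. the_elem ((\<lambda>(x, y). ranchor Y y) ` P)),
       lact = (\<lambda>h P. (\<lambda>(x, y). (lact X h x, y)) ` P),
       ract = (\<lambda>P k. (\<lambda>(x, y). (x, ract Y y k)) ` P) \<rparr>"

definition correspondence_iso ::
    "'a groupoid \<Rightarrow> 'a groupoid \<Rightarrow> ('x, 'a) bispace \<Rightarrow> ('y, 'a) bispace \<Rightarrow> ('x \<Rightarrow> 'y) \<Rightarrow> bool" where
  "correspondence_iso H G X Y f \<longleftrightarrow>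
     homeomorphic_map (Space X) (Space Y) f \<and>
     (\<forall>x \<in> topspace (Space X).
        lanchor Y (f x) = lanchor X x \<and> ranchor Y (f x) = ranchor X x \<and>
        (\<forall>h \<in> Arr H. Src H h = lanchor X x \<longrightarrow> f (lact X h x) = lact Y h (f x)) \<and>
        (\<forall>g \<in> Arr G. ranchor X x = Rng G g \<longrightarrow> f (ract X x g) = ract Y (f x) g))"


section \<open>Diagrams of groupoid correspondences\<close>

text \<open>All groupoids and correspondences have their points in one type \<open>'a\<close>, so that the
  requirement that the correspondence of an identity arrow be the groupoid itself is an honest
  equality. The underlying sets for different arrows may overlap.\<close>

record ('c, 'a) diagram_data =
  Gpd :: "'c \<Rightarrow> 'a groupoid"
  Corr :: "'c \<Rightarrow> ('a, 'a) bispace"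
  mu :: "'c \<Rightarrow> 'c \<Rightarrow> ('a \<times> 'a) set \<Rightarrow> 'a"

definition pts :: "('c, 'a) diagram_data \<Rightarrow> 'c \<Rightarrow> 'a set" where
  "pts F g = topspace (Space (Corr F g))"

definition dot ::
    "'c category \<Rightarrow> ('c, 'a) diagram_data \<Rightarrow> 'c \<Rightarrow> 'c \<Rightarrow> 'a \<Rightarrow> 'a \<Rightarrow> 'a" where
  "dot C F g h \<gamma> \<eta> =
     mu F g h (composite_class (Gpd F (Src C g)) (Corr F g) (Corr F h) \<gamma> \<eta>)"

locale groupoid_diagram = small_category C for C :: "'c category" +
  fixes F :: "('c, 'a) diagram_data"
  assumes Gpd: "x \<in> Obj C \<Longrightarrow> etale_groupoid (Gpd F x)"
    and Corr: "g \<in> Arr C \<Longrightarrow>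
      correspondence (Gpd F (Rng C g)) (Gpd F (Src C g)) (Corr F g)"
    and mu: "\<lbrakk>g \<in> Arr C; h \<in> Arr C; Src C g = Rng C h\<rbrakk> \<Longrightarrow>
      correspondence_iso (Gpd F (Rng C g)) (Gpd F (Src C h))
        (composite (Gpd F (Src C g)) (Corr F g) (Corr F h)) (Corr F (Comp C g h)) (mu F g h)"
    and Corr_ident_Space: "x \<in> Obj C \<Longrightarrow> Space (Corr F x) = Top (Gpd F x)"
    and Corr_ident_lanchor: "\<lbrakk>x \<in> Obj C; \<gamma> \<in> Arr (Gpd F x)\<rbrakk> \<Longrightarrow>
      lanchor (Corr F x) \<gamma> = Rng (Gpd F x) \<gamma>"
    and Corr_ident_ranchor: "\<lbrakk>x \<in> Obj C; \<gamma> \<in> Arr (Gpd F x)\<rbrakk> \<Longrightarrow>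
      ranchor (Corr F x) \<gamma> = Src (Gpd F x) \<gamma>"
    and Corr_ident_lact: "\<lbrakk>x \<in> Obj C; \<gamma> \<in> Arr (Gpd F x); \<eta> \<in> Arr (Gpd F x);
        Src (Gpd F x) \<gamma> = Rng (Gpd F x) \<eta>\<rbrakk> \<Longrightarrow>
      lact (Corr F x) \<gamma> \<eta> = Comp (Gpd F x) \<gamma> \<eta>"
    and Corr_ident_ract: "\<lbrakk>x \<in> Obj C; \<gamma> \<in> Arr (Gpd F x); \<eta> \<in> Arr (Gpd F x);
        Src (Gpd F x) \<gamma> = Rng (Gpd F x) \<eta>\<rbrakk> \<Longrightarrow>
      ract (Corr F x) \<gamma> \<eta> = Comp (Gpd F x) \<gamma> \<eta>"
    and dot_ident_left: "\<lbrakk>g \<in> Arr C; \<eta> \<in> Arr (Gpd F (Rng C g)); \<gamma> \<in> pts F g;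
        Src (Gpd F (Rng C g)) \<eta> = lanchor (Corr F g) \<gamma>\<rbrakk> \<Longrightarrow>
      dot C F (Rng C g) g \<eta> \<gamma> = lact (Corr F g) \<eta> \<gamma>"
    and dot_ident_right: "\<lbrakk>g \<in> Arr C; \<gamma> \<in> pts F g; \<eta> \<in> Arr (Gpd F (Src C g));
        ranchor (Corr F g) \<gamma> = Rng (Gpd F (Src C g)) \<eta>\<rbrakk> \<Longrightarrow>
      dot C F g (Src C g) \<gamma> \<eta> = ract (Corr F g) \<gamma> \<eta>"
    and dot_assoc: "\<lbrakk>g1 \<in> Arr C; g2 \<in> Arr C; g3 \<in> Arr C; Src C g1 = Rng C g2; Src C g2 = Rng C g3;
        \<gamma>1 \<in> pts F g1; \<gamma>2 \<in> pts F g2; \<gamma>3 \<in> pts F g3;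
        ranchor (Corr F g1) \<gamma>1 = lanchor (Corr F g2) \<gamma>2;
        ranchor (Corr F g2) \<gamma>2 = lanchor (Corr F g3) \<gamma>3\<rbrakk> \<Longrightarrow>
      dot C F (Comp C g1 g2) g3 (dot C F g1 g2 \<gamma>1 \<gamma>2) \<gamma>3 =
      dot C F g1 (Comp C g2 g3) \<gamma>1 (dot C F g2 g3 \<gamma>2 \<gamma>3)"


section \<open>Actions of diagrams and universality\<close>

text \<open>Since the parts are disjoint, a single function \<open>anchor\<close> encodes the maps
  from all the parts \<open>Part Y x\<close>.\<close>

record ('c, 'a, 'y) action_data =
  Carrier :: "'y topology"
  Part :: "'c \<Rightarrow> 'y set"
  anchor :: "'y \<Rightarrow> 'a"
  act :: "'c \<Rightarrow> 'a \<Rightarrow> 'y \<Rightarrow> 'y"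

definition Part_top :: "('c, 'a, 'y) action_data \<Rightarrow> 'c \<Rightarrow> 'y topology" where
  "Part_top Y x = subtopology (Carrier Y) (Part Y x)"

definition action_domain ::
    "'c category \<Rightarrow> ('c, 'a) diagram_data \<Rightarrow> ('c, 'a, 'y) action_data \<Rightarrow> 'c \<Rightarrow> ('a \<times> 'y) topology"
  where "action_domain C F Y g =
    fibre_product (Space (Corr F g)) (ranchor (Corr F g)) (Part_top Y (Src C g)) (anchor Y)"

locale diagram_action = groupoid_diagram C F
  for C :: "'c category" and F :: "('c, 'a) diagram_data" +
  fixes Y :: "('c, 'a, 'y) action_data"
  assumes Part_disjoint: "disjoint_family_on (Part Y) (Obj C)"
    and Part_Union: "(\<Union>x \<in> Obj C. Part Y x) = topspace (Carrier Y)"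
    and Part_open: "x \<in> Obj C \<Longrightarrow> openin (Carrier Y) (Part Y x)"
    and Part_closed: "x \<in> Obj C \<Longrightarrow> closedin (Carrier Y) (Part Y x)"
    and continuous_anchor: "x \<in> Obj C \<Longrightarrow>
      continuous_map (Part_top Y x) (Obj_top (Gpd F x)) (anchor Y)"
    and act_continuous: "g \<in> Arr C \<Longrightarrow>
      continuous_map (action_domain C F Y g) (Part_top Y (Rng C g)) (\<lambda>(\<gamma>, y). act Y g \<gamma> y)"
    and act_open: "g \<in> Arr C \<Longrightarrow>
      open_map (action_domain C F Y g) (Part_top Y (Rng C g)) (\<lambda>(\<gamma>, y). act Y g \<gamma> y)"
    and act_surj: "g \<in> Arr C \<Longrightarrow>
      (\<lambda>(\<gamma>, y). act Y g \<gamma> y) ` topspace (action_domain C F Y g) = Part Y (Rng C g)"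
    and anchor_act: "\<lbrakk>g \<in> Arr C; \<gamma> \<in> pts F g; y \<in> Part Y (Src C g);
        ranchor (Corr F g) \<gamma> = anchor Y y\<rbrakk> \<Longrightarrow>
      anchor Y (act Y g \<gamma> y) = lanchor (Corr F g) \<gamma>"
    and act_act: "\<lbrakk>g1 \<in> Arr C; g2 \<in> Arr C; Src C g1 = Rng C g2;
        \<gamma>1 \<in> pts F g1; \<gamma>2 \<in> pts F g2; y \<in> Part Y (Src C g2);
        ranchor (Corr F g1) \<gamma>1 = lanchor (Corr F g2) \<gamma>2; ranchor (Corr F g2) \<gamma>2 = anchor Y y\<rbrakk> \<Longrightarrow>
      act Y g1 \<gamma>1 (act Y g2 \<gamma>2 y) = act Y (Comp C g1 g2) (dot C F g1 g2 \<gamma>1 \<gamma>2) y"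
    and act_eq: "\<lbrakk>g \<in> Arr C; \<gamma> \<in> pts F g; \<gamma>' \<in> pts F g; y \<in> Part Y (Src C g); y' \<in> Part Y (Src C g);
        ranchor (Corr F g) \<gamma> = anchor Y y; ranchor (Corr F g) \<gamma>' = anchor Y y';
        act Y g \<gamma> y = act Y g \<gamma>' y'\<rbrakk> \<Longrightarrow>
      \<exists>\<eta> \<in> Arr (Gpd F (Src C g)).
        ranchor (Corr F g) \<gamma> = Rng (Gpd F (Src C g)) \<eta> \<and> Src (Gpd F (Src C g)) \<eta> = anchor Y y' \<and>
        \<gamma>' = ract (Corr F g) \<gamma> \<eta> \<and> y = act Y (Src C g) \<eta> y'"

definition equivariant_map ::
    "'c category \<Rightarrow> ('c, 'a) diagram_data \<Rightarrow> ('c, 'a, 'y) action_data \<Rightarrow> ('c, 'a, 'z) action_data \<Rightarrow>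
     ('y \<Rightarrow> 'z) \<Rightarrow> bool" where
  "equivariant_map C F Y Z \<phi> \<longleftrightarrow>
     continuous_map (Carrier Y) (Carrier Z) \<phi> \<and>
     (\<forall>x \<in> Obj C. \<forall>y \<in> Part Y x. \<phi> y \<in> Part Z x \<and> anchor Z (\<phi> y) = anchor Y y) \<and>
     (\<forall>g \<in> Arr C. \<forall>\<gamma> \<in> pts F g. \<forall>y \<in> Part Y (Src C g).
        ranchor (Corr F g) \<gamma> = anchor Y y \<longrightarrow> \<phi> (act Y g \<gamma> y) = act Z g \<gamma> (\<phi> y))"

text \<open>A definition cannot quantify over types, so the type \<open>'y\<close> of the points of the actions that
  are mapped to \<open>\<Omega>\<close> is a parameter. Restricting to extensional functions makes equality of functions
  the same as equality on the space \<open>Y\<close>.\<close>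

definition universal_action ::
    "'y itself \<Rightarrow> 'c category \<Rightarrow> ('c, 'a) diagram_data \<Rightarrow> ('c, 'a, 'z) action_data \<Rightarrow> bool" where
  "universal_action T C F \<Omega> \<longleftrightarrow>
     diagram_action C F \<Omega> \<and>
     (\<forall>Y :: ('c, 'a, 'y) action_data. diagram_action C F Y \<longrightarrow>
        (\<exists>!\<phi>. \<phi> \<in> extensional (topspace (Carrier Y)) \<and> equivariant_map C F Y \<Omega> \<phi>))"


section \<open>The limit space and its canonical action\<close>

definition cls :: "'c category \<Rightarrow> ('c, 'a) diagram_data \<Rightarrow> 'c \<Rightarrow> 'a \<Rightarrow> 'a set" where
  "cls C F g \<gamma> = right_orbit (Gpd F (Src C g)) (Corr F g) \<gamma>"

definition proj ::
    "'c category \<Rightarrow> ('c, 'a) diagram_data \<Rightarrow> 'c \<Rightarrow> 'c \<Rightarrow> 'a set \<Rightarrow> 'a set" where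
  "proj C F g h P =
     (THE Q. \<exists>\<gamma>1 \<in> pts F g. \<exists>\<gamma>2 \<in> pts F h. ranchor (Corr F g) \<gamma>1 = lanchor (Corr F h) \<gamma>2 \<and>
        P = cls C F (Comp C g h) (dot C F g h \<gamma>1 \<gamma>2) \<and> Q = cls C F g \<gamma>1)"

definition Omega_at :: "'c category \<Rightarrow> ('c, 'a) diagram_data \<Rightarrow> 'c \<Rightarrow> ('c \<Rightarrow> 'a set) topology" where
  "Omega_at C F x =
     subtopology
       (product_topology (\<lambda>g. right_orbit_space (Gpd F (Src C g)) (Corr F g))
          {g \<in> Arr C. Rng C g = x})
       {\<omega>. \<forall>g \<in> Arr C. \<forall>h \<in> Arr C. Rng C g = x \<and> Rng C h = Src C g \<longrightarrow>
          proj C F g h (\<omega> (Comp C g h)) = \<omega> g}"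

text \<open>The identification of \<open>\<X>\<^sub>x / \<G>\<^sub>x\<close> with the unit space of \<open>\<G>\<^sub>x\<close> sends the class of \<open>\<gamma>\<close>
  to the range of \<open>\<gamma>\<close>.\<close>

definition Omega_anchor :: "('c, 'a) diagram_data \<Rightarrow> 'c \<Rightarrow> ('c \<Rightarrow> 'a set) \<Rightarrow> 'a" where
  "Omega_anchor F x \<omega> = the_elem (Rng (Gpd F x) ` \<omega> x)"

definition Omega_act ::
    "'c category \<Rightarrow> ('c, 'a) diagram_data \<Rightarrow> 'c \<Rightarrow> 'a \<Rightarrow> ('c \<Rightarrow> 'a set) \<Rightarrow> 'c \<Rightarrow> 'a set" where
  "Omega_act C F g \<gamma> \<omega> =
     (THE \<omega>'. \<omega>' \<in> topspace (Omega_at C F (Rng C g)) \<and>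
        (\<forall>h \<in> Arr C. Rng C h = Src C g \<longrightarrow>
           (\<forall>\<eta> \<in> \<omega> h. \<omega>' (Comp C g h) = cls C F (Comp C g h) (dot C F g h \<gamma> \<eta>))))"

definition Omega ::
    "'c category \<Rightarrow> ('c, 'a) diagram_data \<Rightarrow> ('c, 'a, 'c \<times> ('c \<Rightarrow> 'a set)) action_data" where
  "Omega C F =
     \<lparr> Carrier = sum_topology (Omega_at C F) (Obj C),
       Part = (\<lambda>x. {x} \<times> topspace (Omega_at C F x)),
       anchor = (\<lambda>(x, \<omega>). Omega_anchor F x \<omega>),
       act = (\<lambda>g \<gamma> (x, \<omega>). (Rng C g, Omega_act C F g \<gamma> \<omega>)) \<rparr>"

end

theory Submission
  imports Defs
begin

text \<open>Let \<open>Y\<close> carry an action of the diagram and let \<open>g\<close> be an arrow with range \<open>x\<close>. A point \<open>y\<close> of the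
  part \<open>Y\<^sub>x\<close> can be written as \<open>\<gamma> \<cdot> y'\<close> with \<open>\<gamma>\<close> in the correspondence of \<open>g\<close>, and the second condition
  on actions says that the class \<open>[\<gamma>]\<close> depends only on \<open>y\<close>. These classes are compatible because the
  action is associative, so they form a point of the limit, and they depend continuously on \<open>y\<close> because
  the action map is an open surjection. In the limit itself the coordinate of \<open>\<gamma> \<cdot> \<omega>\<close> at \<open>g\<close> is \<open>[\<gamma>]\<close>
  (\<open>Omega_act_at\<close>). Therefore the map \<open>y \<mapsto> ([\<gamma>])\<^sub>g\<close> is the only candidate for an equivariant map
  (\<open>equivariant_map_to_Omega_unique\<close>), and it is one (\<open>equivariant_map_to_limit\<close>).

  The larger part of the work is to show that the limit carries an action at all
  (\<open>diagram_action_Omega\<close>). The formula for \<open>\<gamma> \<cdot> \<omega>\<close> prescribes the coordinates at the arrows \<open>g h\<close>. For any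
  other arrow \<open>k\<close> with the same range, the first Ore condition gives a square \<open>k h1 = g h2\<close>, and the
  coordinate at \<open>k\<close> has to be the projection of the one at \<open>g h2\<close>. Both Ore conditions together imply that
  two squares have a common extension, so that the choice does not matter (\<open>Omega_mult_independent\<close>).

  As for the topology, range and source maps of etale groupoids are open, hence so are all orbit maps,
  and open surjections stay quotient maps in fibre products. Thus \<open>(\<gamma>, [\<eta>]) \<mapsto> [\<gamma> \<cdot> \<eta>]\<close> is continuous, and
  the action on the limit is continuous in every coordinate. The division \<open>(\<gamma>, [\<gamma> \<cdot> \<eta>]) \<mapsto> [\<eta>]\<close> is
  continuous because the right actions are basic (\<open>continuous_map_orbit_div\<close>). So \<open>(\<gamma>, \<omega>) \<mapsto> (\<gamma>, \<gamma> \<cdot> \<omega>)\<close>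
  is a homeomorphism onto the space of pairs \<open>(\<gamma>, \<omega>')\<close> such that the coordinate of \<open>\<omega>'\<close> at \<open>g\<close> is
  \<open>[\<gamma>]\<close>, and the projection of this space to \<open>\<omega>'\<close> is a pullback of an orbit map, hence open
  (\<open>open_map_Omega_act\<close>).\<close>

section \<open>Fibre products and open quotient maps\<close>

lemma subtopology_cong_topspace:
  assumes "\<And>x. x \<in> topspace X \<Longrightarrow> x \<in> A \<longleftrightarrow> x \<in> B"
  shows "subtopology X A = subtopology X B"
proof -
  have "topspace X \<inter> A = topspace X \<inter> B" using assms by blast
  then show ?thesis by (metis subtopology_restrict)
qed

lemma topspace_fibre_product:
  "topspace (fibre_product X f Y g) = {(x, y). x \<in> topspace X \<and> y \<in> topspace Y \<and> f x = g y}"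
  by (auto simp: fibre_product_def)

lemma continuous_map_into_fibre_product:
  "continuous_map Z (fibre_product X f Y g) h \<longleftrightarrow>
     continuous_map Z X (fst \<circ> h) \<and> continuous_map Z Y (snd \<circ> h) \<and>
     (\<forall>z \<in> topspace Z. f (fst (h z)) = g (snd (h z)))"
  unfolding fibre_product_def continuous_map_in_subtopology continuous_map_pairwise
  by (auto simp: case_prod_unfold)

lemma continuous_map_fst_fibre_product: "continuous_map (fibre_product X f Y g) X fst"
  and continuous_map_snd_fibre_product: "continuous_map (fibre_product X f Y g) Y snd"
  unfolding fibre_product_def
  by (auto intro: continuous_map_from_subtopology continuous_map_fst continuous_map_snd)

text \<open>Pullbacks of open maps along continuous maps are open. Applied to range and source
  maps, this makes orbit maps open. Applied to orbit maps, it makes the action on the limit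
  open.\<close>

lemma open_map_snd_fibre_product:
  assumes f: "open_map X B f" and g: "continuous_map Y B g"
  shows "open_map (fibre_product X f Y g) Y snd"
  unfolding open_map_def
proof (intro allI impI)
  fix W assume "openin (fibre_product X f Y g) W"
  then obtain T where T: "openin (prod_topology X Y) T" and W: "W = T \<inter> {(x, y). f x = g y}"
    by (auto simp: fibre_product_def openin_subtopology)
  show "openin Y (snd ` W)"
  proof (subst openin_subopen, intro ballI)
    fix y assume "y \<in> snd ` W"
    then obtain x where xy: "(x, y) \<in> T" "f x = g y" using W by auto
    obtain U V where UV: "openin X U" "openin Y V" "x \<in> U" "y \<in> V" "U \<times> V \<subseteq> T"
      using openin_prod_topology_alt[THEN iffD1, rule_format, OF T xy(1)] by (elim exE conjE) rule
    let ?N = "{z \<in> topspace Y. g z \<in> f ` U} \<inter> V"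
    have "openin B (f ` U)" using f UV(1) by (auto simp: open_map_def)
    then have "openin Y ?N"
      using openin_continuous_map_preimage[OF g] UV(2) by (simp only: openin_Int)
    moreover have "y \<in> ?N" using UV xy(2) openin_subset[OF UV(2)] by auto (metis image_eqI)
    moreover have "?N \<subseteq> snd ` W"
    proof
      fix z assume "z \<in> ?N"
      then obtain u where "u \<in> U" "z \<in> V" "f u = g z" by auto
      then have "(u, z) \<in> W" using UV(5) W by auto
      then show "z \<in> snd ` W" by force
    qed
    ultimately show "\<exists>N. openin Y N \<and> y \<in> N \<and> N \<subseteq> snd ` W" by blast
  qed
qed

lemma open_map_id_times:
  assumes "open_map Y Y' q"
  shows "open_map (prod_topology X Y) (prod_topology X Y') (\<lambda>(x, y). (x, q y))"
  unfolding open_map_def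
proof (intro allI impI)
  fix W assume W: "openin (prod_topology X Y) W"
  show "openin (prod_topology X Y') ((\<lambda>(x, y). (x, q y)) ` W)"
    unfolding openin_prod_topology_alt
  proof (intro allI impI)
    fix x y' assume "(x, y') \<in> (\<lambda>(x, y). (x, q y)) ` W"
    then obtain y where y: "(x, y) \<in> W" "y' = q y" by auto
    then obtain U V where UV: "openin X U" "openin Y V" "x \<in> U" "y \<in> V" "U \<times> V \<subseteq> W"
      using openin_prod_topology_alt[THEN iffD1, rule_format, OF W y(1)] by (elim exE conjE) rule
    moreover have "openin Y' (q ` V)" using assms UV(2) by (simp add: open_map_def)
    moreover have "U \<times> q ` V \<subseteq> (\<lambda>(x, y). (x, q y)) ` W" using UV(5) by force
    ultimately show "\<exists>U V. openin X U \<and> openin Y' V \<and> x \<in> U \<and> y' \<in> V \<and>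
        U \<times> V \<subseteq> (\<lambda>(x, y). (x, q y)) ` W" using y(2) by blast
  qed
qed

text \<open>Quotient maps need not remain quotient maps after forming products or restricting to
  subspaces, but open surjections do. This is what allows a continuous map on pairs of
  points to descend to pairs in which one entry is an orbit.\<close>

lemma quotient_map_id_times_restrict:
  assumes q: "continuous_map Y Y' q" "open_map Y Y' q" "q ` topspace Y = topspace Y'"
  shows "quotient_map (subtopology (prod_topology X Y) {(x, y). (x, q y) \<in> S})
           (subtopology (prod_topology X Y') S) (\<lambda>(x, y). (x, q y))"
proof (rule continuous_open_imp_quotient_map)
  let ?f = "\<lambda>(x, y). (x, q y)"
  let ?U = "topspace (prod_topology X Y) \<inter> {(x, y). (x, q y) \<in> S}"
  have U: "subtopology (prod_topology X Y) {(x, y). (x, q y) \<in> S} =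
      subtopology (prod_topology X Y) ?U"
    by (metis subtopology_restrict)
  show "continuous_map (subtopology (prod_topology X Y) {(x, y). (x, q y) \<in> S})
      (subtopology (prod_topology X Y') S) ?f"
    unfolding continuous_map_in_subtopology
  proof
    have "continuous_map (prod_topology X Y) (prod_topology X Y') ?f"
      unfolding case_prod_unfold
      by (intro continuous_intros continuous_map_compose[OF continuous_map_snd q(1), unfolded o_def])
    then show "continuous_map (subtopology (prod_topology X Y) {(x, y). (x, q y) \<in> S})
        (prod_topology X Y') ?f"
      by (rule continuous_map_from_subtopology)
  qed auto
  show "open_map (subtopology (prod_topology X Y) {(x, y). (x, q y) \<in> S})
      (subtopology (prod_topology X Y') S) ?f"
    unfolding U by (rule open_map_restriction[OF open_map_id_times[OF q(2)]]) auto
  show "?f ` topspace (subtopology (prod_topology X Y) {(x, y). (x, q y) \<in> S}) =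
      topspace (subtopology (prod_topology X Y') S)"
  proof (intro equalityI subsetI)
    fix p assume "p \<in> topspace (subtopology (prod_topology X Y') S)"
    then obtain x y' where p: "x \<in> topspace X" "y' \<in> q ` topspace Y" "p = (x, y')" "p \<in> S"
      using q(3) by auto
    then obtain y where "x \<in> topspace X" "y \<in> topspace Y" "p = (x, q y)" "p \<in> S"
      by auto
    then show "p \<in> ?f ` topspace (subtopology (prod_topology X Y) {(x, y). (x, q y) \<in> S})"
      by (intro image_eqI[of _ _ "(x, y)"]) auto
  qed (use q(3) in auto)
qed

text \<open>The saturation of an open set under a groupoid action is the second projection of an open
  subset of a fibre product, hence open.\<close>

lemma open_map_quotient_by_action:
  assumes s: "open_map G B s" and f: "continuous_map X B f"
    and \<alpha>: "continuous_map (fibre_product G s X f) X (\<lambda>(g, x). \<alpha> g x)"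
    and q: "\<And>x x'. \<lbrakk>x \<in> topspace X; x' \<in> topspace X\<rbrakk> \<Longrightarrow>
      q x' = q x \<longleftrightarrow> (\<exists>g \<in> topspace G. s g = f x \<and> x' = \<alpha> g x)"
  shows "open_map X (quotient_topology X q) q"
  unfolding open_map_def
proof (intro allI impI)
  fix U assume U: "openin X U"
  let ?W = "{p \<in> topspace (fibre_product G s X f). (\<lambda>(g, x). \<alpha> g x) p \<in> U}"
  have sub: "U \<subseteq> topspace X" by (rule openin_subset[OF U])
  have "openin (fibre_product G s X f) ?W"
    by (rule openin_continuous_map_preimage[OF \<alpha> U])
  then have "openin X (snd ` ?W)"
    using open_map_snd_fibre_product[OF s f] by (simp add: open_map_def)
  moreover have "{x \<in> topspace X. q x \<in> q ` U} = snd ` ?W"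
  proof (intro set_eqI iffI)
    fix x assume x: "x \<in> {x \<in> topspace X. q x \<in> q ` U}"
    then obtain u where u: "u \<in> U" "q u = q x" by auto
    then obtain g where "g \<in> topspace G" "s g = f x" "u = \<alpha> g x"
      using q[of x u] x sub by auto
    then have "(g, x) \<in> ?W" using x u(1) by (simp add: topspace_fibre_product)
    then show "x \<in> snd ` ?W" by force
  next
    fix x assume "x \<in> snd ` ?W"
    then obtain g where "g \<in> topspace G" "x \<in> topspace X" "s g = f x" "\<alpha> g x \<in> U"
      by (auto simp: topspace_fibre_product)
    then have "q (\<alpha> g x) = q x" using q[of x "\<alpha> g x"] sub by blast
    then show "x \<in> {x \<in> topspace X. q x \<in> q ` U}"
      using \<open>\<alpha> g x \<in> U\<close> \<open>x \<in> topspace X\<close> by (metis (mono_tags, lifting) imageI mem_Collect_eq)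
  qed
  ultimately show "openin (quotient_topology X q) (q ` U)"
    unfolding openin_quotient_topology using sub by auto
qed

lemma open_map_local_homeomorphism:
  assumes "local_homeomorphism X Y f"
  shows "open_map X Y f"
  unfolding open_map_def
proof (intro allI impI)
  fix W assume W: "openin X W"
  show "openin Y (f ` W)"
  proof (subst openin_subopen, intro ballI)
    fix y assume "y \<in> f ` W"
    then obtain x where x: "x \<in> W" "y = f x" by auto
    then have "x \<in> topspace X" using openin_subset[OF W] by auto
    then obtain U where U: "openin X U" "x \<in> U" "openin Y (f ` U)"
      "homeomorphic_map (subtopology X U) (subtopology Y (f ` U)) f"
      using assms unfolding local_homeomorphism_def by blast
    have "openin (subtopology X U) (U \<inter> W)" using W by (simp add: openin_subtopology_Int2)
    then have "openin (subtopology Y (f ` U)) (f ` (U \<inter> W))"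
      using homeomorphic_imp_open_map[OF U(4)] by (simp add: open_map_def)
    then have "openin Y (f ` (U \<inter> W))" using U(3) by (rule openin_trans_full)
    then show "\<exists>T. openin Y T \<and> y \<in> T \<and> T \<subseteq> f ` W" using x U(2) by blast
  qed
qed

section \<open>Orbits of groupoid correspondences\<close>

context etale_groupoid
begin

lemma Obj_Arr: "x \<in> Obj G \<Longrightarrow> x \<in> Arr G"
  using Obj_subset by blast

lemma topspace_Obj_top: "topspace (Obj_top G) = Obj G"
  using Obj_subset by (auto simp: Obj_top_def topspace_Top)

lemmas open_Rng = open_map_local_homeomorphism[OF Rng_local_homeomorphism]
lemmas open_Src = open_map_local_homeomorphism[OF Src_local_homeomorphism]

lemma Inv_unique:
  assumes "a \<in> Arr G" "b \<in> Arr G" "Src G a = Rng G b" "Comp G a b = Rng G a"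
  shows "b = Inv G a"
proof -
  note I = Inv_Arr[OF assms(1)] Rng_Inv[OF assms(1)] Src_Inv[OF assms(1)]
  have "b = Comp G (Comp G (Inv G a) a) b"
    using assms Comp_ident_left[OF assms(2)] by (simp add: Comp_Inv_left)
  also have "\<dots> = Comp G (Inv G a) (Comp G a b)"
    by (rule Comp_assoc) (use assms I in auto)
  also have "\<dots> = Inv G a" using I Comp_ident_right[OF I(1)] assms(4) by simp
  finally show ?thesis .
qed

lemma Inv_Inv: "g \<in> Arr G \<Longrightarrow> Inv G (Inv G g) = g"
  by (rule sym, rule Inv_unique) (auto simp: Inv_Arr Rng_Inv Src_Inv Comp_Inv_left)

lemma Inv_ident: "x \<in> Obj G \<Longrightarrow> Inv G x = x"
  using Comp_ident_left[of x]
  by (intro sym[OF Inv_unique]) (auto simp: Obj_Arr Rng_ident Src_ident)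

text \<open>Both sides are right inverses of \<open>k g\<close>.\<close>

lemma Inv_Comp:
  assumes "k \<in> Arr G" "g \<in> Arr G" "Src G k = Rng G g"
  shows "Inv G (Comp G k g) = Comp G (Inv G g) (Inv G k)"
proof (rule sym, rule Inv_unique)
  note I = Inv_Arr[OF assms(1)] Rng_Inv[OF assms(1)] Src_Inv[OF assms(1)]
    Inv_Arr[OF assms(2)] Rng_Inv[OF assms(2)] Src_Inv[OF assms(2)]
  note IC = Comp_Arr[OF I(4,1)] Rng_Comp[OF I(4,1)] 
  show "Comp G k g \<in> Arr G" "Comp G (Inv G g) (Inv G k) \<in> Arr G"
    "Src G (Comp G k g) = Rng G (Comp G (Inv G g) (Inv G k))"
    using assms I Comp_Arr Rng_Comp Src_Comp by auto
  have "Comp G (Comp G k g) (Comp G (Inv G g) (Inv G k)) =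
      Comp G k (Comp G g (Comp G (Inv G g) (Inv G k)))"
    by (rule Comp_assoc) (use assms I IC in auto)
  also have "Comp G g (Comp G (Inv G g) (Inv G k)) = Comp G (Comp G g (Inv G g)) (Inv G k)"
    by (rule Comp_assoc[symmetric]) (use assms I in auto)
  also have "\<dots> = Inv G k"
    using Comp_ident_left[OF I(1)] assms I by (simp add: Comp_Inv_right)
  finally show "Comp G (Comp G k g) (Comp G (Inv G g) (Inv G k)) = Rng G (Comp G k g)"
    using assms by (simp add: Comp_Inv_right Rng_Comp)
qed

end

context correspondence
begin

lemma ranchor_Obj: "x \<in> topspace (Space X) \<Longrightarrow> ranchor X x \<in> Obj G"
  and lanchor_Obj: "x \<in> topspace (Space X) \<Longrightarrow> lanchor X x \<in> Obj H"
  using right.continuous_anchor left.continuous_anchor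
  by (auto simp: continuous_map_def left.topspace_Obj_top right.topspace_Obj_top)

lemma ract_in:
  assumes "x \<in> topspace (Space X)" "g \<in> Arr G" "ranchor X x = Rng G g"
  shows "ract X x g \<in> topspace (Space X)"
  using continuous_map_image_subset_topspace[OF right.continuous_act] assms
  by (force simp: topspace_fibre_product right.topspace_Top)

lemma lact_in:
  assumes "x \<in> topspace (Space X)" "h \<in> Arr H" "Src H h = lanchor X x"
  shows "lact X h x \<in> topspace (Space X)"
  using continuous_map_image_subset_topspace[OF left.continuous_act] assms
  by (force simp: topspace_fibre_product left.topspace_Top)

lemma ract_ract_Inv:
  assumes "x \<in> topspace (Space X)" "g \<in> Arr G" "ranchor X x = Rng G g"
  shows "ract X (ract X x g) (Inv G g) = x"
  using assms right.act_act[OF assms(1,2) right.Inv_Arr[OF assms(2)] assms(3)]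
    right.act_ident[OF assms(1)]
  by (simp add: right.Rng_Inv right.Comp_Inv_right)

lemma ract_Inv_ract:
  assumes "x \<in> topspace (Space X)" "g \<in> Arr G" "ranchor X x = Src G g"
  shows "ract X (ract X x (Inv G g)) g = x"
  using ract_ract_Inv[OF assms(1) right.Inv_Arr[OF assms(2)]] assms
  by (simp add: right.Rng_Inv right.Inv_Inv)

lemma lact_Inv_lact:
  assumes "x \<in> topspace (Space X)" "h \<in> Arr H" "Src H h = lanchor X x"
  shows "lact X (Inv H h) (lact X h x) = x"
  using assms left.act_act[OF left.Inv_Arr[OF assms(2)] assms(2,1)]
    left.act_ident[OF assms(1)]
  by (simp add: left.Src_Inv left.Comp_Inv_left)

text \<open>The basic map \<open>(x, g) \<mapsto> (xg, x)\<close> is injective, so the right action is free.\<close>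

lemma ract_cancel:
  assumes "x \<in> topspace (Space X)" "g \<in> Arr G" "ranchor X x = Rng G g"
    "g' \<in> Arr G" "ranchor X x = Rng G g'" "ract X x g = ract X x g'"
  shows "g = g'"
proof -
  have "inj_on (\<lambda>(x, g). (ract X x g, x))
      (topspace (fibre_product (Space X) (ranchor X) (Top G) (Rng G)))"
    using right.basic by (simp add: embedding_map_def homeomorphic_map_def)
  then have "(x, g) = (x, g')"
    by (rule inj_onD) (use assms in \<open>auto simp: topspace_fibre_product right.topspace_Top\<close>)
  then show ?thesis by simp
qed

lemma mem_right_orbit_self: "x \<in> topspace (Space X) \<Longrightarrow> x \<in> right_orbit G X x"
  unfolding right_orbit_def
  by (intro CollectI exI[of _ "ranchor X x"])
    (simp add: right.act_ident ranchor_Obj right.Obj_Arr right.Rng_ident)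

lemma right_orbit_subset: "x \<in> topspace (Space X) \<Longrightarrow> right_orbit G X x \<subseteq> topspace (Space X)"
  by (auto simp: right_orbit_def ract_in)

lemma right_orbit_ract:
  assumes "x \<in> topspace (Space X)" "g \<in> Arr G" "ranchor X x = Rng G g"
  shows "right_orbit G X (ract X x g) = right_orbit G X x"
proof -
  have sub: "right_orbit G X (ract X x g) \<subseteq> right_orbit G X x"
    if xg: "x \<in> topspace (Space X)" "g \<in> Arr G" "ranchor X x = Rng G g" for x g
  proof
    fix y assume "y \<in> right_orbit G X (ract X x g)"
    then obtain k where k: "k \<in> Arr G" "Src G g = Rng G k" "y = ract X (ract X x g) k"
      using right.anchor_act[OF xg] by (auto simp: right_orbit_def)
    then have "y = ract X x (Comp G g k)" using right.act_act[of x g k] xg by auto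
    moreover have "Comp G g k \<in> Arr G" "Rng G (Comp G g k) = Rng G g"
      using right.Comp_Arr right.Rng_Comp that k by auto
    ultimately show "y \<in> right_orbit G X x" using xg by (auto simp: right_orbit_def)
  qed
  have "right_orbit G X x \<subseteq> right_orbit G X (ract X x g)"
    using sub[OF ract_in[OF assms] right.Inv_Arr[OF assms(2)]] right.anchor_act[OF assms]
    by (simp add: ract_ract_Inv[OF assms] right.Rng_Inv[OF assms(2)])
  then show ?thesis using sub[OF assms] by blast
qed

lemma right_orbit_eq_iff:
  assumes "x \<in> topspace (Space X)" "y \<in> topspace (Space X)"
  shows "right_orbit G X y = right_orbit G X x \<longleftrightarrow>
    (\<exists>g \<in> Arr G. ranchor X x = Rng G g \<and> y = ract X x g)"
proof
  assume "right_orbit G X y = right_orbit G X x"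
  then have "y \<in> right_orbit G X x" using mem_right_orbit_self[OF assms(2)] by simp
  then show "\<exists>g \<in> Arr G. ranchor X x = Rng G g \<and> y = ract X x g"
    by (auto simp: right_orbit_def)
qed (use right_orbit_ract[OF assms(1)] in auto)

lemma right_orbit_eq_of_mem:
  assumes "x \<in> topspace (Space X)" "y \<in> right_orbit G X x"
  shows "right_orbit G X y = right_orbit G X x"
proof -
  obtain g where "g \<in> Arr G" "ranchor X x = Rng G g" "y = ract X x g"
    using assms(2) by (auto simp: right_orbit_def)
  then show ?thesis using right_orbit_ract[OF assms(1)] by simp
qed

text \<open>The orbit of \<open>x\<close> consists of the \<open>x g\<close> with \<open>Rng G g\<close> the anchor of \<open>x\<close>, and the range
  map of \<open>G\<close> is open.\<close>

lemma open_map_right_orbit: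
  "open_map (Space X) (right_orbit_space G X) (right_orbit G X)"
  unfolding right_orbit_space_def
proof (rule open_map_quotient_by_action[OF right.open_Rng right.continuous_anchor])
  have "continuous_map (fibre_product (Top G) (Rng G) (Space X) (ranchor X))
      (fibre_product (Space X) (ranchor X) (Top G) (Rng G)) (\<lambda>p. (snd p, fst p))"
    unfolding continuous_map_into_fibre_product o_def
    using continuous_map_fst_fibre_product continuous_map_snd_fibre_product
    by (auto simp: topspace_fibre_product)
  from continuous_map_compose[OF this right.continuous_act]
  show "continuous_map (fibre_product (Top G) (Rng G) (Space X) (ranchor X)) (Space X)
      (\<lambda>(g, x). ract X x g)"
    by (simp add: o_def case_prod_unfold)
qed (simp add: right_orbit_eq_iff right.topspace_Top, metis)

lemma quotient_map_right_orbit: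
  "quotient_map (Space X) (right_orbit_space G X) (right_orbit G X)"
  by (simp add: right_orbit_space_def quotient_map_quotient_topology)

definition arrow_between :: "'x \<Rightarrow> 'x \<Rightarrow> 'a" where
  "arrow_between x y = (THE g. g \<in> Arr G \<and> ranchor X x = Rng G g \<and> ract X x g = y)"

lemma arrow_between_ract:
  assumes "x \<in> topspace (Space X)" "g \<in> Arr G" "ranchor X x = Rng G g"
  shows "arrow_between x (ract X x g) = g"
  unfolding arrow_between_def
  by (rule the_equality) (use assms ract_cancel in auto)

text \<open>The basic map \<open>(x, g) \<mapsto> (xg, x)\<close> has a continuous inverse on its image. Hence the
  arrow that carries one point of an orbit to another depends continuously on the two
  points.\<close>

lemma continuous_map_arrow_between:
  assumes a: "continuous_map Z (Space X) a" and b: "continuous_map Z (Space X) b"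
    and ab: "\<And>z. z \<in> topspace Z \<Longrightarrow> right_orbit G X (a z) = right_orbit G X (b z)"
  shows "continuous_map Z (Top G) (\<lambda>z. arrow_between (a z) (b z))"
proof -
  let ?P = "fibre_product (Space X) (ranchor X) (Top G) (Rng G)"
  let ?e = "\<lambda>(x, g). (ract X x g, x)"
  let ?I = "subtopology (prod_topology (Space X) (Space X)) (?e ` topspace ?P)"
  obtain k where k: "homeomorphic_maps ?P ?I ?e k"
    using right.basic unfolding embedding_map_def homeomorphic_map_maps by blast
  have az: "a z \<in> topspace (Space X)" and bz: "b z \<in> topspace (Space X)"
    if "z \<in> topspace Z" for z
    using a b that by (auto simp: continuous_map_def)
  have ex: "(a z, arrow_between (a z) (b z)) \<in> topspace ?P \<and>
      (b z, a z) = ?e (a z, arrow_between (a z) (b z))" if z: "z \<in> topspace Z" for z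
  proof -
    obtain g where g: "g \<in> Arr G" "ranchor X (a z) = Rng G g" "b z = ract X (a z) g"
      using right_orbit_eq_iff[OF az[OF z] bz[OF z]] ab[OF z] by auto
    then have "arrow_between (a z) (b z) = g" using arrow_between_ract az[OF z] by simp
    then show ?thesis
      using g az[OF z] by (simp add: topspace_fibre_product right.topspace_Top)
  qed
  have "continuous_map Z ?I (\<lambda>z. (b z, a z))"
    unfolding continuous_map_in_subtopology
  proof
    show "continuous_map Z (prod_topology (Space X) (Space X)) (\<lambda>z. (b z, a z))"
      by (intro continuous_map_pairedI a b)
    show "(\<lambda>z. (b z, a z)) \<in> topspace Z \<rightarrow> ?e ` topspace ?P"
      using ex by (intro Pi_I) (metis (no_types, lifting) imageI)
  qed
  then have "continuous_map Z ?P (k \<circ> (\<lambda>z. (b z, a z)))"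
    using k continuous_map_compose unfolding homeomorphic_maps_def by blast
  then have "continuous_map Z (Top G) (snd \<circ> (k \<circ> (\<lambda>z. (b z, a z))))"
    by (rule continuous_map_compose[OF _ continuous_map_snd_fibre_product])
  then show ?thesis
  proof (rule continuous_map_eq)
    fix z assume z: "z \<in> topspace Z"
    have "k (?e (a z, arrow_between (a z) (b z))) = (a z, arrow_between (a z) (b z))"
      using k ex[OF z] unfolding homeomorphic_maps_def by blast
    then show "(snd \<circ> (k \<circ> (\<lambda>z. (b z, a z)))) z = arrow_between (a z) (b z)"
      using ex[OF z] by simp
  qed
qed

end

section \<open>Composites of correspondences\<close>

locale composable_correspondences =
  X: correspondence H G X + Y: correspondence G K Y
  for H G K :: "'a groupoid" and X :: "('x, 'a) bispace" and Y :: "('y, 'a) bispace"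
begin

abbreviation pairs :: "('x \<times> 'y) topology" where
  "pairs \<equiv> fibre_product (Space X) (ranchor X) (Space Y) (lanchor Y)"

abbreviation class_of :: "'x \<times> 'y \<Rightarrow> ('x \<times> 'y) set" where
  "class_of \<equiv> \<lambda>(x, y). composite_class G X Y x y"

lemma mem_composite_class_self:
  assumes "(x, y) \<in> topspace pairs"
  shows "(x, y) \<in> composite_class G X Y x y"
proof -
  have x: "x \<in> topspace (Space X)" "y \<in> topspace (Space Y)" "ranchor X x = lanchor Y y"
    using assms by (auto simp: topspace_fibre_product)
  note e = X.ranchor_Obj[OF x(1)]
  show ?thesis unfolding composite_class_def
    using x e X.right.Inv_ident[OF e] X.right.act_ident[OF x(1)] Y.left.act_ident[OF x(2)]
      X.right.Obj_Arr[OF e] X.right.Src_ident[OF e]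
    by (intro CollectI exI[of _ "ranchor X x"]) auto
qed

text \<open>One inclusion between the two classes suffices, because the inverse arrow translates
  the new pair back to \<open>(x, y)\<close>.\<close>

lemma diagonal_translate:
  assumes "(x, y) \<in> topspace pairs" "g \<in> Arr G" "Src G g = ranchor X x"
  shows "(ract X x (Inv G g), lact Y g y) \<in> topspace pairs"
    "ranchor X (ract X x (Inv G g)) = Rng G g"
    "composite_class G X Y (ract X x (Inv G g)) (lact Y g y) = composite_class G X Y x y"
proof -
  have tr: "(ract X x (Inv G g), lact Y g y) \<in> topspace pairs \<and>
      ranchor X (ract X x (Inv G g)) = Rng G g"
    and sub: "composite_class G X Y (ract X x (Inv G g)) (lact Y g y) \<subseteq> composite_class G X Y x y"
    if xy: "(x, y) \<in> topspace pairs" and g: "g \<in> Arr G" "Src G g = ranchor X x" for x y g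
  proof -
    have x: "x \<in> topspace (Space X)" "y \<in> topspace (Space Y)" "ranchor X x = lanchor Y y"
      using xy by (auto simp: topspace_fibre_product)
    note I = X.right.Inv_Arr[OF g(1)] X.right.Rng_Inv[OF g(1)] X.right.Src_Inv[OF g(1)]
    show A: "(ract X x (Inv G g), lact Y g y) \<in> topspace pairs \<and>
      ranchor X (ract X x (Inv G g)) = Rng G g"
      using x g I X.ract_in[OF x(1) I(1)] Y.lact_in[OF x(2) g(1)] X.right.anchor_act[OF x(1) I(1)]
        Y.left.anchor_act[OF g(1) x(2)] by (simp add: topspace_fibre_product)
    show "composite_class G X Y (ract X x (Inv G g)) (lact Y g y) \<subseteq> composite_class G X Y x y"
    proof
      fix p assume "p \<in> composite_class G X Y (ract X x (Inv G g)) (lact Y g y)"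
      then obtain k where k: "k \<in> Arr G" "Src G k = Rng G g"
        "p = (ract X (ract X x (Inv G g)) (Inv G k), lact Y k (lact Y g y))"
        using A by (auto simp: composite_class_def)
      note J = X.right.Inv_Arr[OF k(1)] X.right.Rng_Inv[OF k(1)] X.right.Src_Inv[OF k(1)]
      have "p = (ract X x (Inv G (Comp G k g)), lact Y (Comp G k g) y)"
        using k x g I J X.right.act_act[OF x(1) I(1) J(1)] Y.left.act_act[OF k(1) g(1) x(2)]
        by (simp add: X.right.Inv_Comp)
      then show "p \<in> composite_class G X Y x y"
        using X.right.Comp_Arr[OF k(1) g(1) k(2)] X.right.Src_Comp[OF k(1) g(1) k(2)] g
        by (auto simp: composite_class_def)
    qed
  qed
  have x: "x \<in> topspace (Space X)" "y \<in> topspace (Space Y)" "ranchor X x = lanchor Y y"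
    using assms by (auto simp: topspace_fibre_product)
  note I = X.right.Inv_Arr[OF assms(2)] X.right.Rng_Inv[OF assms(2)] X.right.Src_Inv[OF assms(2)]
  note T = tr[OF assms]
  show "(ract X x (Inv G g), lact Y g y) \<in> topspace pairs"
    "ranchor X (ract X x (Inv G g)) = Rng G g" using T by auto
  have "composite_class G X Y x y \<subseteq> composite_class G X Y (ract X x (Inv G g)) (lact Y g y)"
    using sub[OF conjunct1[OF T] I(1)] T I x assms X.ract_Inv_ract[OF x(1) assms(2)]
      Y.lact_Inv_lact[OF x(2) assms(2)] X.right.Inv_Inv[OF assms(2)]
    by simp
  then show "composite_class G X Y (ract X x (Inv G g)) (lact Y g y) = composite_class G X Y x y"
    using sub[OF assms] by blast
qed

lemma composite_class_eq_iff:
  assumes "(x, y) \<in> topspace pairs" "(x', y') \<in> topspace pairs"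
  shows "composite_class G X Y x' y' = composite_class G X Y x y \<longleftrightarrow>
    (\<exists>g \<in> Arr G. Src G g = ranchor X x \<and> x' = ract X x (Inv G g) \<and> y' = lact Y g y)"
proof
  assume "composite_class G X Y x' y' = composite_class G X Y x y"
  then have "(x', y') \<in> composite_class G X Y x y"
    using mem_composite_class_self[OF assms(2)] by simp
  then show "\<exists>g \<in> Arr G. Src G g = ranchor X x \<and> x' = ract X x (Inv G g) \<and> y' = lact Y g y"
    by (auto simp: composite_class_def)
qed (use diagonal_translate(3)[OF assms(1)] in auto)

lemma lanchor_composite_class:
  assumes "(x, y) \<in> topspace pairs"
  shows "lanchor (composite G X Y) (composite_class G X Y x y) = lanchor X x"
proof -
  have x: "x \<in> topspace (Space X)" "y \<in> topspace (Space Y)" "ranchor X x = lanchor Y y"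
    using assms by (auto simp: topspace_fibre_product)
  have "(\<lambda>(x, y). lanchor X x) ` composite_class G X Y x y = {lanchor X x}"
  proof (intro equalityI subsetI)
    fix p assume "p \<in> (\<lambda>(x, y). lanchor X x) ` composite_class G X Y x y"
    then obtain g where "g \<in> Arr G" "Src G g = ranchor X x" "p = lanchor X (ract X x (Inv G g))"
      by (auto simp: composite_class_def)
    then show "p \<in> {lanchor X x}"
      using X.lanchor_ract[OF x(1), of "Inv G g"] X.right.Inv_Arr X.right.Rng_Inv by simp
  qed (use mem_composite_class_self[OF assms] in force)
  then show ?thesis by (simp add: composite_def)
qed

lemma ranchor_composite_class:
  assumes "(x, y) \<in> topspace pairs"
  shows "ranchor (composite G X Y) (composite_class G X Y x y) = ranchor Y y"
proof -
  have x: "x \<in> topspace (Space X)" "y \<in> topspace (Space Y)" "ranchor X x = lanchor Y y"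
    using assms by (auto simp: topspace_fibre_product)
  have "(\<lambda>(x, y). ranchor Y y) ` composite_class G X Y x y = {ranchor Y y}"
  proof (intro equalityI subsetI)
    fix p assume "p \<in> (\<lambda>(x, y). ranchor Y y) ` composite_class G X Y x y"
    then obtain g where "g \<in> Arr G" "Src G g = ranchor X x" "p = ranchor Y (lact Y g y)"
      by (auto simp: composite_class_def)
    then show "p \<in> {ranchor Y y}" using Y.ranchor_lact[OF _ x(2), of g] x by simp
  qed (use mem_composite_class_self[OF assms] in force)
  then show ?thesis by (simp add: composite_def)
qed

lemma Space_composite: "Space (composite G X Y) = quotient_topology pairs class_of"
  by (simp add: composite_def)

text \<open>Here the arrows \<open>g\<close> that act on \<open>(x, y)\<close> are those with \<open>Src G g\<close> the anchor of \<open>x\<close>,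
  so it is the openness of the source map that matters.\<close>

lemma open_map_composite_class: "open_map pairs (Space (composite G X Y)) class_of"
  unfolding Space_composite
proof (rule open_map_quotient_by_action[OF X.right.open_Src])
  let ?D = "fibre_product (Top G) (Src G) pairs (ranchor X \<circ> fst)"
  show "continuous_map pairs (Obj_top G) (ranchor X \<circ> fst)"
    by (rule continuous_map_compose[OF continuous_map_fst_fibre_product X.right.continuous_anchor])
  have g: "continuous_map ?D (Top G) fst" and p: "continuous_map ?D pairs snd"
    by (rule continuous_map_fst_fibre_product continuous_map_snd_fibre_product)+
  have x: "continuous_map ?D (Space X) (\<lambda>p. fst (snd p))"
    and y: "continuous_map ?D (Space Y) (\<lambda>p. snd (snd p))"
    using continuous_map_compose[OF p continuous_map_fst_fibre_product]
      continuous_map_compose[OF p continuous_map_snd_fibre_product] by (simp_all add: o_def)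
  have gi: "continuous_map ?D (Top G) (\<lambda>p. Inv G (fst p))"
    using continuous_map_compose[OF g X.right.continuous_Inv] by (simp add: o_def)
  have "continuous_map ?D (fibre_product (Space X) (ranchor X) (Top G) (Rng G))
      (\<lambda>p. (fst (snd p), Inv G (fst p)))"
    unfolding continuous_map_into_fibre_product using x gi
    by (auto simp: o_def topspace_fibre_product X.right.topspace_Top X.right.Rng_Inv)
  from continuous_map_compose[OF this X.right.continuous_act]
  have 1: "continuous_map ?D (Space X) (\<lambda>p. ract X (fst (snd p)) (Inv G (fst p)))"
    by (simp add: o_def)
  have "continuous_map ?D (fibre_product (Top G) (Src G) (Space Y) (lanchor Y))
      (\<lambda>p. (fst p, snd (snd p)))"
    unfolding continuous_map_into_fibre_product using y g
    by (auto simp: o_def topspace_fibre_product)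
  from continuous_map_compose[OF this Y.left.continuous_act]
  have 2: "continuous_map ?D (Space Y) (\<lambda>p. lact Y (fst p) (snd (snd p)))"
    by (simp add: o_def)
  have "ranchor X (ract X x (Inv G g)) = lanchor Y (lact Y g y)"
    if "g \<in> Arr G" "(x, y) \<in> topspace pairs" "Src G g = ranchor X x" for g x y
    using diagonal_translate(1)[OF that(2,1,3)] by (auto simp: topspace_fibre_product)
  then show "continuous_map ?D pairs
      (\<lambda>(g, p). (\<lambda>(x, y). (ract X x (Inv G g), lact Y g y)) p)"
    unfolding continuous_map_into_fibre_product using 1 2
    by (auto simp: o_def case_prod_unfold topspace_fibre_product X.right.topspace_Top)
next
  fix p p' assume "p \<in> topspace pairs" "p' \<in> topspace pairs"
  then show "class_of p' = class_of p \<longleftrightarrow>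
      (\<exists>g \<in> topspace (Top G). Src G g = (ranchor X \<circ> fst) p \<and>
        p' = (\<lambda>(x, y). (ract X x (Inv G g), lact Y g y)) p)"
    by (cases p; cases p') (simp add: composite_class_eq_iff X.right.topspace_Top)
qed

lemma continuous_map_composite_class: "continuous_map pairs (Space (composite G X Y)) class_of"
  unfolding Space_composite
  by (rule quotient_imp_continuous_map[OF quotient_map_quotient_topology])

lemma topspace_composite: "topspace (Space (composite G X Y)) = class_of ` topspace pairs"
  unfolding Space_composite by simp

end

section \<open>Composable arrows and unit arrows in a diagram\<close>

context groupoid_diagram
begin

abbreviation composable :: "'c \<Rightarrow> 'c \<Rightarrow> bool" where
  "composable g h \<equiv> g \<in> Arr C \<and> h \<in> Arr C \<and> Src C g = Rng C h"

abbreviation la :: "'c \<Rightarrow> 'a \<Rightarrow> 'a" where "la g \<equiv> lanchor (Corr F g)"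
abbreviation ra :: "'c \<Rightarrow> 'a \<Rightarrow> 'a" where "ra g \<equiv> ranchor (Corr F g)"
abbreviation src_gpd :: "'c \<Rightarrow> 'a groupoid" where "src_gpd g \<equiv> Gpd F (Src C g)"

abbreviation orbit_top :: "'c \<Rightarrow> 'a set topology" where
  "orbit_top g \<equiv> right_orbit_space (src_gpd g) (Corr F g)"

abbreviation dot_pairs :: "'c \<Rightarrow> 'c \<Rightarrow> ('a \<times> 'a) topology" where
  "dot_pairs g h \<equiv> fibre_product (Space (Corr F g)) (ra g) (Space (Corr F h)) (la h)"

lemma Obj_ArrC: "x \<in> Obj C \<Longrightarrow> x \<in> Arr C"
  using Obj_subset by blast

lemma composable_Src: "g \<in> Arr C \<Longrightarrow> composable g (Src C g)"
  using Src_Obj Obj_ArrC Rng_ident by auto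

lemma composable_Rng: "g \<in> Arr C \<Longrightarrow> composable (Rng C g) g"
  using Rng_Obj Obj_ArrC Src_ident by auto

lemma composable_Comp:
  assumes "composable g h" "composable h k"
  shows "composable (Comp C g h) k" "composable g (Comp C h k)"
  using assms Comp_Arr Src_Comp Rng_Comp by auto

lemma pts_ident: "x \<in> Obj C \<Longrightarrow> pts F x = Arr (Gpd F x)"
  by (simp add: pts_def Corr_ident_Space etale_groupoid.topspace_Top[OF Gpd])

lemma composable_correspondences:
  assumes "composable g h"
  shows "composable_correspondences (Gpd F (Rng C g)) (src_gpd g) (src_gpd h) (Corr F g) (Corr F h)"
  using assms Corr[of g] Corr[of h] by (simp add: composable_correspondences_def)

lemma mem_dot_pairs:
  "(\<gamma>, \<eta>) \<in> topspace (dot_pairs g h) \<longleftrightarrow> \<gamma> \<in> pts F g \<and> \<eta> \<in> pts F h \<and> ra g \<gamma> = la h \<eta>"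
  by (auto simp: topspace_fibre_product pts_def)

lemma ra_Obj: "\<lbrakk>g \<in> Arr C; \<gamma> \<in> pts F g\<rbrakk> \<Longrightarrow> ra g \<gamma> \<in> Obj (src_gpd g)"
  using correspondence.ranchor_Obj[OF Corr] by (simp add: pts_def)

lemma gpd_Obj_Arr: "\<lbrakk>x \<in> Obj C; u \<in> Obj (Gpd F x)\<rbrakk> \<Longrightarrow> u \<in> Arr (Gpd F x)"
  using etale_groupoid.Obj_Arr[OF Gpd] .

lemma gpd_ident:
  assumes "x \<in> Obj C" "u \<in> Obj (Gpd F x)"
  shows "Rng (Gpd F x) u = u" "Src (Gpd F x) u = u"
proof -
  interpret G: etale_groupoid "Gpd F x" by (rule Gpd[OF assms(1)])
  show "Rng (Gpd F x) u = u" "Src (Gpd F x) u = u"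
    using G.Rng_ident G.Src_ident assms(2) by auto
qed

lemma pts_ract:
  assumes "g \<in> Arr C" "\<gamma> \<in> pts F g" "a \<in> Arr (src_gpd g)" "ra g \<gamma> = Rng (src_gpd g) a"
  shows "ract (Corr F g) \<gamma> a \<in> pts F g"
    "ra g (ract (Corr F g) \<gamma> a) = Src (src_gpd g) a"
    "la g (ract (Corr F g) \<gamma> a) = la g \<gamma>"
proof -
  interpret correspondence "Gpd F (Rng C g)" "src_gpd g" "Corr F g" by (rule Corr[OF assms(1)])
  show "ract (Corr F g) \<gamma> a \<in> pts F g" "ra g (ract (Corr F g) \<gamma> a) = Src (src_gpd g) a"
    "la g (ract (Corr F g) \<gamma> a) = la g \<gamma>"
    using assms ract_in right.anchor_act lanchor_ract by (auto simp: pts_def)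
qed

lemma pts_lact:
  assumes "g \<in> Arr C" "\<gamma> \<in> pts F g" "a \<in> Arr (Gpd F (Rng C g))"
    "Src (Gpd F (Rng C g)) a = la g \<gamma>"
  shows "lact (Corr F g) a \<gamma> \<in> pts F g"
    "la g (lact (Corr F g) a \<gamma>) = Rng (Gpd F (Rng C g)) a"
    "ra g (lact (Corr F g) a \<gamma>) = ra g \<gamma>"
proof -
  interpret correspondence "Gpd F (Rng C g)" "src_gpd g" "Corr F g" by (rule Corr[OF assms(1)])
  show "lact (Corr F g) a \<gamma> \<in> pts F g" "la g (lact (Corr F g) a \<gamma>) = Rng (Gpd F (Rng C g)) a"
    "ra g (lact (Corr F g) a \<gamma>) = ra g \<gamma>"
    using assms lact_in left.anchor_act ranchor_lact by (auto simp: pts_def)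
qed

lemma ract_ident: "\<lbrakk>g \<in> Arr C; \<gamma> \<in> pts F g\<rbrakk> \<Longrightarrow> ract (Corr F g) \<gamma> (ra g \<gamma>) = \<gamma>"
  using right_space.act_ident[OF basic_right_space.axioms(1)[OF correspondence.axioms(2)[OF Corr]]]
  by (simp add: pts_def)

section \<open>The product of points\<close>

lemma mu_class_of:
  assumes "composable g h"
  shows "homeomorphic_map (Space (composite (src_gpd g) (Corr F g) (Corr F h)))
      (Space (Corr F (Comp C g h))) (mu F g h)"
  using mu[of g h] assms by (simp add: correspondence_iso_def)

lemma dot_mem:
  assumes "composable g h" "\<gamma> \<in> pts F g" "\<eta> \<in> pts F h" "ra g \<gamma> = la h \<eta>"
  shows dot_in_pts: "dot C F g h \<gamma> \<eta> \<in> pts F (Comp C g h)"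
    and la_dot: "la (Comp C g h) (dot C F g h \<gamma> \<eta>) = la g \<gamma>"
    and ra_dot: "ra (Comp C g h) (dot C F g h \<gamma> \<eta>) = ra h \<eta>"
proof -
  interpret composable_correspondences "Gpd F (Rng C g)" "src_gpd g" "src_gpd h" "Corr F g" "Corr F h"
    by (rule composable_correspondences[OF assms(1)])
  let ?P = "composite_class (src_gpd g) (Corr F g) (Corr F h) \<gamma> \<eta>"
  have p: "(\<gamma>, \<eta>) \<in> topspace pairs" using assms by (simp add: mem_dot_pairs)
  then have P: "?P \<in> topspace (Space (composite (src_gpd g) (Corr F g) (Corr F h)))"
    unfolding topspace_composite by force
  have iso: "correspondence_iso (Gpd F (Rng C g)) (src_gpd h)
      (composite (src_gpd g) (Corr F g) (Corr F h)) (Corr F (Comp C g h)) (mu F g h)"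
    using mu[of g h] assms(1) by simp
  have "mu F g h ?P \<in> topspace (Space (Corr F (Comp C g h)))"
    using homeomorphic_imp_continuous_map[OF mu_class_of[OF assms(1)]] P
    by (auto simp: continuous_map_def)
  then show "dot C F g h \<gamma> \<eta> \<in> pts F (Comp C g h)" by (simp add: dot_def pts_def)
  show "la (Comp C g h) (dot C F g h \<gamma> \<eta>) = la g \<gamma>"
    using iso P lanchor_composite_class[OF p] by (simp add: correspondence_iso_def dot_def)
  show "ra (Comp C g h) (dot C F g h \<gamma> \<eta>) = ra h \<eta>"
    using iso P ranchor_composite_class[OF p] by (simp add: correspondence_iso_def dot_def)
qed

text \<open>The product is the class map of the composite followed by the homeomorphism
  \<open>mu F g h\<close>, hence an open surjection.\<close>

lemma dot_topology:
  assumes "composable g h"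
  shows continuous_map_dot: "continuous_map (dot_pairs g h) (Space (Corr F (Comp C g h)))
      (\<lambda>(\<gamma>, \<eta>). dot C F g h \<gamma> \<eta>)" (is ?cont)
    and open_map_dot: "open_map (dot_pairs g h) (Space (Corr F (Comp C g h)))
      (\<lambda>(\<gamma>, \<eta>). dot C F g h \<gamma> \<eta>)" (is ?open)
    and dot_surj: "(\<lambda>(\<gamma>, \<eta>). dot C F g h \<gamma> \<eta>) ` topspace (dot_pairs g h) = pts F (Comp C g h)"
      (is ?surj)
proof -
  interpret composable_correspondences "Gpd F (Rng C g)" "src_gpd g" "src_gpd h" "Corr F g" "Corr F h"
    by (rule composable_correspondences[OF assms(1)])
  note m = mu_class_of[OF assms]
  have eq: "(\<lambda>(\<gamma>, \<eta>). dot C F g h \<gamma> \<eta>) = mu F g h \<circ> class_of"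
    by (auto simp: dot_def)
  show ?cont unfolding eq
    by (rule continuous_map_compose[OF continuous_map_composite_class
          homeomorphic_imp_continuous_map[OF m]])
  show ?open unfolding eq
    by (rule open_map_compose[OF open_map_composite_class homeomorphic_imp_open_map[OF m]])
  have "mu F g h ` (class_of ` topspace pairs) = topspace (Space (Corr F (Comp C g h)))"
    using homeomorphic_imp_surjective_map[OF m] unfolding topspace_composite .
  then show ?surj unfolding eq by (simp only: image_comp pts_def)
qed

lemma dot_cases:
  assumes "composable g h" "\<zeta> \<in> pts F (Comp C g h)"
  obtains \<gamma> \<eta> where "\<gamma> \<in> pts F g" "\<eta> \<in> pts F h" "ra g \<gamma> = la h \<eta>" "\<zeta> = dot C F g h \<gamma> \<eta>"
proof -
  obtain p where "p \<in> topspace (dot_pairs g h)" "\<zeta> = (\<lambda>(\<gamma>, \<eta>). dot C F g h \<gamma> \<eta>) p"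
    using dot_surj[OF assms(1)] assms(2) by blast
  then show thesis using that by (cases p) (auto simp: mem_dot_pairs)
qed

text \<open>The structure isomorphism is injective, so equal products come from pairs in one class
  of the composite. The arrow \<open>a\<close> is directed so that it moves \<open>\<gamma>\<close> to \<open>\<gamma>'\<close>, as in the second
  condition on actions of diagrams.\<close>

lemma dot_eqD:
  assumes gh: "composable g h" and p: "\<gamma> \<in> pts F g" "\<eta> \<in> pts F h" "ra g \<gamma> = la h \<eta>"
    and p': "\<gamma>' \<in> pts F g" "\<eta>' \<in> pts F h" "ra g \<gamma>' = la h \<eta>'"
    and eq: "dot C F g h \<gamma> \<eta> = dot C F g h \<gamma>' \<eta>'"
  obtains a where "a \<in> Arr (src_gpd g)" "ra g \<gamma> = Rng (src_gpd g) a" "Src (src_gpd g) a = la h \<eta>'"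
    "\<gamma>' = ract (Corr F g) \<gamma> a" "\<eta> = lact (Corr F h) a \<eta>'"
proof -
  interpret composable_correspondences "Gpd F (Rng C g)" "src_gpd g" "src_gpd h" "Corr F g" "Corr F h"
    by (rule composable_correspondences[OF gh])
  let ?c = "composite_class (src_gpd g) (Corr F g) (Corr F h)"
  have q: "(\<gamma>, \<eta>) \<in> topspace pairs" "(\<gamma>', \<eta>') \<in> topspace pairs"
    using p p' by (simp_all add: mem_dot_pairs)
  then have "?c \<gamma> \<eta> \<in> topspace (Space (composite (src_gpd g) (Corr F g) (Corr F h)))"
    "?c \<gamma>' \<eta>' \<in> topspace (Space (composite (src_gpd g) (Corr F g) (Corr F h)))"
    unfolding topspace_composite by force+
  then have "?c \<gamma> \<eta> = ?c \<gamma>' \<eta>'"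
    using inj_onD[OF homeomorphic_imp_injective_map[OF mu_class_of[OF gh]]] eq
    by (simp add: dot_def)
  then obtain b where b: "b \<in> Arr (src_gpd g)" "Src (src_gpd g) b = ra g \<gamma>'"
    "\<gamma> = ract (Corr F g) \<gamma>' (Inv (src_gpd g) b)" "\<eta> = lact (Corr F h) b \<eta>'"
    using composite_class_eq_iff[OF q(2,1)] by auto
  have "ra g \<gamma> = Rng (src_gpd g) b"
    using diagonal_translate(2)[OF q(2) b(1,2)] by (simp only: b(3))
  moreover have "Src (src_gpd g) b = la h \<eta>'" using b(2) p'(3) by simp
  moreover have "\<gamma>' = ract (Corr F g) \<gamma> b"
    using X.ract_Inv_ract[of \<gamma>' b] p'(1) b(1,2) by (simp only: b(3) pts_def)
  ultimately show thesis by (rule that[OF b(1) _ _ _ b(4)])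
qed

text \<open>Acting by \<open>a\<close> from the right is multiplication in the correspondence of an identity
  arrow, so this is associativity with the identity arrow in the last place.\<close>

lemma dot_ract:
  assumes gh: "composable g h" and p: "\<gamma> \<in> pts F g" "\<eta> \<in> pts F h" "ra g \<gamma> = la h \<eta>"
    and a: "a \<in> Arr (src_gpd h)" "ra h \<eta> = Rng (src_gpd h) a"
  shows "dot C F g h \<gamma> (ract (Corr F h) \<eta> a) = ract (Corr F (Comp C g h)) (dot C F g h \<gamma> \<eta>) a"
proof -
  have S: "Src C h \<in> Obj C" using gh Src_Obj[of h] by simp
  have gs: "Src C (Comp C g h) = Src C h" using Src_Comp gh by auto
  have gA: "Comp C g h \<in> Arr C" using Comp_Arr gh by auto
  have "dot C F (Comp C g h) (Src C h) (dot C F g h \<gamma> \<eta>) a =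
      dot C F g (Comp C h (Src C h)) \<gamma> (dot C F h (Src C h) \<eta> a)"
    by (rule dot_assoc)
      (use gh S p a Obj_ArrC Rng_ident Corr_ident_lanchor pts_ident in auto)
  moreover have "dot C F h (Src C h) \<eta> a = ract (Corr F h) \<eta> a"
    using dot_ident_right[of h \<eta> a] gh p a by simp
  moreover have "dot C F (Comp C g h) (Src C h) (dot C F g h \<gamma> \<eta>) a =
      ract (Corr F (Comp C g h)) (dot C F g h \<gamma> \<eta>) a"
    using dot_ident_right[OF gA dot_in_pts[OF gh p], of a] a gs ra_dot[OF gh p] by simp
  moreover have "Comp C h (Src C h) = h" using Comp_ident_right gh by auto
  ultimately show ?thesis by simp
qed

text \<open>Associativity with an identity arrow in the middle.\<close>

lemma dot_balanced:
  assumes gh: "composable g h" and p: "\<gamma> \<in> pts F g" "\<eta> \<in> pts F h"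
    and a: "a \<in> Arr (src_gpd g)" "ra g \<gamma> = Rng (src_gpd g) a" "Src (src_gpd g) a = la h \<eta>"
  shows "dot C F g h (ract (Corr F g) \<gamma> a) \<eta> = dot C F g h \<gamma> (lact (Corr F h) a \<eta>)"
proof -
  have S: "Src C g \<in> Obj C" using gh Src_Obj[of g] by simp
  have "dot C F (Comp C g (Src C g)) h (dot C F g (Src C g) \<gamma> a) \<eta> =
      dot C F g (Comp C (Src C g) h) \<gamma> (dot C F (Src C g) h a \<eta>)"
    by (rule dot_assoc)
      (use gh S p a Obj_ArrC Rng_ident Src_ident Corr_ident_lanchor Corr_ident_ranchor pts_ident in auto)
  moreover have "dot C F g (Src C g) \<gamma> a = ract (Corr F g) \<gamma> a"
    using dot_ident_right[of g \<gamma> a] gh p a by simp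
  moreover have "dot C F (Src C g) h a \<eta> = lact (Corr F h) a \<eta>"
    using dot_ident_left[of h a \<eta>] gh p a by auto
  moreover have "Comp C (Src C g) h = h" "Comp C g (Src C g) = g"
    using Comp_ident_left[of h] Comp_ident_right[of g] gh by auto
  ultimately show ?thesis by simp
qed

text \<open>The right action is free, so in \<open>\<gamma> \<cdot> \<eta> = \<gamma> \<cdot> \<eta>'\<close> the arrow relating the two pairs is a unit.\<close>

lemma dot_cancel:
  assumes gh: "composable g h" and p: "\<gamma> \<in> pts F g" "\<eta> \<in> pts F h" "ra g \<gamma> = la h \<eta>"
    and p': "\<eta>' \<in> pts F h" "ra g \<gamma> = la h \<eta>'"
    and eq: "dot C F g h \<gamma> \<eta> = dot C F g h \<gamma> \<eta>'"
  shows "\<eta> = \<eta>'"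
proof -
  interpret composable_correspondences "Gpd F (Rng C g)" "src_gpd g" "src_gpd h" "Corr F g" "Corr F h"
    by (rule composable_correspondences[OF gh])
  obtain a where a: "a \<in> Arr (src_gpd g)" "ra g \<gamma> = Rng (src_gpd g) a"
    "\<gamma> = ract (Corr F g) \<gamma> a" "\<eta> = lact (Corr F h) a \<eta>'"
    by (rule dot_eqD[OF gh p p(1) p' eq]) (use that in blast)
  have A: "g \<in> Arr C" using gh by auto
  note O = ra_Obj[OF A p(1)]
  have "a = ra g \<gamma>"
  proof (rule X.ract_cancel)
    show "\<gamma> \<in> topspace (Space (Corr F g))" using p(1) by (simp add: pts_def)
    show "ract (Corr F g) \<gamma> a = ract (Corr F g) \<gamma> (ra g \<gamma>)"
      by (simp only: ract_ident[OF A p(1)] a(3)[symmetric])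
  qed (use a(1,2) O X.right.Obj_Arr X.right.Rng_ident in auto)
  then have "\<eta> = lact (Corr F h) (la h \<eta>') \<eta>'" using a(4) p'(2) by simp
  then show ?thesis using Y.left.act_ident[of \<eta>'] p'(1) by (simp add: pts_def)
qed

section \<open>Orbits and the projections between orbit spaces\<close>

lemma cls_topology:
  assumes "g \<in> Arr C"
  shows continuous_map_cls: "continuous_map (Space (Corr F g)) (orbit_top g) (cls C F g)"
    and open_map_cls: "open_map (Space (Corr F g)) (orbit_top g) (cls C F g)"
    and quotient_map_cls: "quotient_map (Space (Corr F g)) (orbit_top g) (cls C F g)"
proof -
  interpret correspondence "Gpd F (Rng C g)" "src_gpd g" "Corr F g" by (rule Corr[OF assms(1)])
  have e: "cls C F g = right_orbit (src_gpd g) (Corr F g)" by (rule ext) (simp add: cls_def)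
  show "continuous_map (Space (Corr F g)) (orbit_top g) (cls C F g)"
    "open_map (Space (Corr F g)) (orbit_top g) (cls C F g)"
    "quotient_map (Space (Corr F g)) (orbit_top g) (cls C F g)"
    unfolding e using quotient_map_right_orbit open_map_right_orbit
    by (auto intro: quotient_imp_continuous_map)
qed

lemma topspace_orbit_top: "topspace (orbit_top g) = cls C F g ` pts F g"
  unfolding right_orbit_space_def topspace_quotient_topology pts_def
  by (rule image_cong) (simp_all add: cls_def)

lemma cls_in: "\<gamma> \<in> pts F g \<Longrightarrow> cls C F g \<gamma> \<in> topspace (orbit_top g)"
  by (simp add: topspace_orbit_top)

lemma cls_cases:
  assumes "P \<in> topspace (orbit_top g)"
  obtains \<gamma> where "\<gamma> \<in> pts F g" "P = cls C F g \<gamma>"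
  using assms by (auto simp: topspace_orbit_top)

lemma cls_eq_iff:
  assumes "g \<in> Arr C" "\<gamma> \<in> pts F g" "\<gamma>' \<in> pts F g"
  shows "cls C F g \<gamma>' = cls C F g \<gamma> \<longleftrightarrow>
    (\<exists>a \<in> Arr (src_gpd g). ra g \<gamma> = Rng (src_gpd g) a \<and> \<gamma>' = ract (Corr F g) \<gamma> a)"
  unfolding cls_def using correspondence.right_orbit_eq_iff[OF Corr[OF assms(1)]] assms
  by (simp add: pts_def)

lemma cls_self: "\<lbrakk>g \<in> Arr C; \<gamma> \<in> pts F g\<rbrakk> \<Longrightarrow> \<gamma> \<in> cls C F g \<gamma>"
  unfolding cls_def using correspondence.mem_right_orbit_self[OF Corr] by (simp add: pts_def)

lemma mem_cls:
  assumes "g \<in> Arr C" "\<gamma> \<in> pts F g" "\<gamma>' \<in> cls C F g \<gamma>"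
  shows "\<gamma>' \<in> pts F g" "cls C F g \<gamma>' = cls C F g \<gamma>" "la g \<gamma>' = la g \<gamma>"
proof -
  interpret correspondence "Gpd F (Rng C g)" "src_gpd g" "Corr F g" by (rule Corr[OF assms(1)])
  note c = assms(2)[unfolded pts_def] assms(3)[unfolded cls_def]
  show 1: "\<gamma>' \<in> pts F g" using subsetD[OF right_orbit_subset[OF c(1)] c(2)] by (simp add: pts_def)
  show 2: "cls C F g \<gamma>' = cls C F g \<gamma>" using right_orbit_eq_of_mem[OF c] by (simp add: cls_def)
  obtain a where "a \<in> Arr (src_gpd g)" "ra g \<gamma> = Rng (src_gpd g) a" "\<gamma>' = ract (Corr F g) \<gamma> a"
    using cls_eq_iff[OF assms(1,2) 1] 2 by blast
  then show "la g \<gamma>' = la g \<gamma>" using pts_ract(3)[OF assms(1,2)] by simp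
qed

definition orbit_anchor :: "'c \<Rightarrow> 'a set \<Rightarrow> 'a" where
  "orbit_anchor g P = the_elem (la g ` P)"

lemma orbit_anchor_cls:
  assumes "g \<in> Arr C" "\<gamma> \<in> pts F g"
  shows "orbit_anchor g (cls C F g \<gamma>) = la g \<gamma>"
proof -
  have "la g ` cls C F g \<gamma> = {la g \<gamma>}"
    using mem_cls(3)[OF assms] cls_self[OF assms] by blast
  then show ?thesis by (simp add: orbit_anchor_def)
qed

lemma continuous_map_orbit_anchor:
  assumes "g \<in> Arr C"
  shows "continuous_map (orbit_top g) (Obj_top (Gpd F (Rng C g))) (orbit_anchor g)"
proof (rule continuous_compose_quotient_map[OF quotient_map_cls[OF assms]])
  interpret correspondence "Gpd F (Rng C g)" "src_gpd g" "Corr F g" by (rule Corr[OF assms(1)])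
  show "continuous_map (Space (Corr F g)) (Obj_top (Gpd F (Rng C g))) (orbit_anchor g \<circ> cls C F g)"
    by (rule continuous_map_eq[OF left.continuous_anchor])
      (simp add: orbit_anchor_cls[OF assms] pts_def)
qed

text \<open>Right translates of \<open>\<gamma> \<cdot> \<eta>'\<close> are products of \<open>\<gamma>\<close> with right translates of \<open>\<eta>'\<close>, and
  \<open>\<gamma>\<close> can be cancelled.\<close>

lemma cls_dot_eq_iff:
  assumes gh: "composable g h" and p: "\<gamma> \<in> pts F g" "\<eta> \<in> pts F h" "ra g \<gamma> = la h \<eta>"
    and p': "\<eta>' \<in> pts F h" "ra g \<gamma> = la h \<eta>'"
  shows "cls C F (Comp C g h) (dot C F g h \<gamma> \<eta>) = cls C F (Comp C g h) (dot C F g h \<gamma> \<eta>') \<longleftrightarrow>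
    cls C F h \<eta> = cls C F h \<eta>'"
proof -
  have gA: "Comp C g h \<in> Arr C" and hA: "h \<in> Arr C" and gs: "Src C (Comp C g h) = Src C h"
    using Comp_Arr Src_Comp gh by auto
  note d = dot_in_pts[OF gh p] dot_in_pts[OF gh p(1) p'] 
  have "dot C F g h \<gamma> \<eta> = ract (Corr F (Comp C g h)) (dot C F g h \<gamma> \<eta>') a \<longleftrightarrow>
      \<eta> = ract (Corr F h) \<eta>' a" if a: "a \<in> Arr (src_gpd h)" "ra h \<eta>' = Rng (src_gpd h) a" for a
  proof -
    note r = pts_ract[OF hA p'(1) a]
    have "dot C F g h \<gamma> \<eta> = dot C F g h \<gamma> (ract (Corr F h) \<eta>' a) \<longleftrightarrow> \<eta> = ract (Corr F h) \<eta>' a"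
      using dot_cancel[OF gh p r(1)] r(3) p'(2) by auto
    then show ?thesis using dot_ract[OF gh p(1) p' a] by simp
  qed
  then show ?thesis
    unfolding cls_eq_iff[OF gA d(2,1)] cls_eq_iff[OF hA p'(1) p(2)] gs ra_dot[OF gh p(1) p']
    by blast
qed

text \<open>This says that the description by representatives in the definition of \<^const>\<open>proj\<close> is
  unambiguous. If \<open>\<gamma>1 \<cdot> \<gamma>2\<close> and \<open>\<gamma> \<cdot> \<eta>\<close> lie in one orbit, then \<open>\<gamma>1 \<cdot> \<gamma>2 = \<gamma> \<cdot> (\<eta> a)\<close> for
  some arrow \<open>a\<close>, so that \<open>\<gamma>1\<close> is a right translate of \<open>\<gamma>\<close>.\<close>

lemma proj_cls_dot:
  assumes gh: "composable g h" and p: "\<gamma> \<in> pts F g" "\<eta> \<in> pts F h" "ra g \<gamma> = la h \<eta>"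
  shows "proj C F g h (cls C F (Comp C g h) (dot C F g h \<gamma> \<eta>)) = cls C F g \<gamma>"
  unfolding proj_def
proof (rule the_equality)
  show "\<exists>\<gamma>1\<in>pts F g. \<exists>\<gamma>2\<in>pts F h. ra g \<gamma>1 = la h \<gamma>2 \<and>
      cls C F (Comp C g h) (dot C F g h \<gamma> \<eta>) = cls C F (Comp C g h) (dot C F g h \<gamma>1 \<gamma>2) \<and>
      cls C F g \<gamma> = cls C F g \<gamma>1" using p by blast
next
  fix Q assume "\<exists>\<gamma>1\<in>pts F g. \<exists>\<gamma>2\<in>pts F h. ra g \<gamma>1 = la h \<gamma>2 \<and>
      cls C F (Comp C g h) (dot C F g h \<gamma> \<eta>) = cls C F (Comp C g h) (dot C F g h \<gamma>1 \<gamma>2) \<and>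
      Q = cls C F g \<gamma>1"
  then obtain \<gamma>1 \<gamma>2 where q: "\<gamma>1 \<in> pts F g" "\<gamma>2 \<in> pts F h" "ra g \<gamma>1 = la h \<gamma>2"
    and eq: "cls C F (Comp C g h) (dot C F g h \<gamma>1 \<gamma>2) = cls C F (Comp C g h) (dot C F g h \<gamma> \<eta>)"
    and Q: "Q = cls C F g \<gamma>1" by metis
  have gA: "Comp C g h \<in> Arr C" "g \<in> Arr C" "h \<in> Arr C" and gs: "Src C (Comp C g h) = Src C h"
    using Comp_Arr Src_Comp gh by auto
  obtain a where a: "a \<in> Arr (src_gpd h)" "ra h \<eta> = Rng (src_gpd h) a"
    "dot C F g h \<gamma>1 \<gamma>2 = ract (Corr F (Comp C g h)) (dot C F g h \<gamma> \<eta>) a"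
    using eq unfolding cls_eq_iff[OF gA(1) dot_in_pts[OF gh p] dot_in_pts[OF gh q]] gs
      ra_dot[OF gh p] by blast
  note r = pts_ract[OF gA(3) p(2) a(1,2)]
  have "dot C F g h \<gamma> (ract (Corr F h) \<eta> a) = dot C F g h \<gamma>1 \<gamma>2"
    using a dot_ract[OF gh p a(1,2)] by simp
  then obtain b where "b \<in> Arr (src_gpd g)" "ra g \<gamma> = Rng (src_gpd g) b"
    "\<gamma>1 = ract (Corr F g) \<gamma> b"
    using dot_eqD[OF gh p(1) r(1) _ q] r(3) p(3) by metis
  then show "Q = cls C F g \<gamma>" unfolding Q cls_eq_iff[OF gA(2) p(1) q(1)] by blast
qed

lemma orbit_dot_cases:
  assumes gh: "composable g h" and P: "P \<in> topspace (orbit_top (Comp C g h))"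
  obtains \<gamma> \<eta> where "\<gamma> \<in> pts F g" "\<eta> \<in> pts F h" "ra g \<gamma> = la h \<eta>"
    "P = cls C F (Comp C g h) (dot C F g h \<gamma> \<eta>)"
proof -
  obtain \<zeta> where \<zeta>: "\<zeta> \<in> pts F (Comp C g h)" "P = cls C F (Comp C g h) \<zeta>"
    using P by (rule cls_cases)
  show thesis by (rule dot_cases[OF gh \<zeta>(1)]) (use that \<zeta>(2) in blast)
qed

text \<open>The combination of the product with the orbit map is an open surjection. So every
  continuous map on pairs that factors through it is continuous on the orbit space.\<close>

lemma orbit_dot_topology:
  assumes gh: "composable g h"
  defines "q \<equiv> \<lambda>p. cls C F (Comp C g h) (dot C F g h (fst p) (snd p))"
  shows continuous_map_cls_dot: "continuous_map (dot_pairs g h) (orbit_top (Comp C g h)) q"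
    and open_map_cls_dot: "open_map (dot_pairs g h) (orbit_top (Comp C g h)) q"
    and cls_dot_surj: "q ` topspace (dot_pairs g h) = topspace (orbit_top (Comp C g h))"
proof -
  have gA: "Comp C g h \<in> Arr C" using Comp_Arr gh by auto
  have q: "q = cls C F (Comp C g h) \<circ> (\<lambda>(\<gamma>, \<eta>). dot C F g h \<gamma> \<eta>)"
    by (auto simp: q_def)
  show "continuous_map (dot_pairs g h) (orbit_top (Comp C g h)) q"
    unfolding q by (rule continuous_map_compose[OF continuous_map_dot[OF gh] continuous_map_cls[OF gA]])
  show "open_map (dot_pairs g h) (orbit_top (Comp C g h)) q"
    unfolding q by (rule open_map_compose[OF open_map_dot[OF gh] open_map_cls[OF gA]])
  show "q ` topspace (dot_pairs g h) = topspace (orbit_top (Comp C g h))"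
    unfolding q image_comp[symmetric] dot_surj[OF gh] topspace_orbit_top ..
qed

lemma proj_in:
  assumes gh: "composable g h" and P: "P \<in> topspace (orbit_top (Comp C g h))"
  shows "proj C F g h P \<in> topspace (orbit_top g)"
  by (rule orbit_dot_cases[OF assms]) (simp add: proj_cls_dot[OF gh] cls_in)

lemma continuous_map_proj:
  assumes gh: "composable g h"
  shows "continuous_map (orbit_top (Comp C g h)) (orbit_top g) (proj C F g h)"
proof (rule continuous_compose_quotient_map)
  show "quotient_map (dot_pairs g h) (orbit_top (Comp C g h))
      (\<lambda>p. cls C F (Comp C g h) (dot C F g h (fst p) (snd p)))"
    by (rule continuous_open_imp_quotient_map[OF orbit_dot_topology[OF gh]])
  have "continuous_map (dot_pairs g h) (orbit_top g) (cls C F g \<circ> fst)"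
    using gh by (intro continuous_map_compose[OF continuous_map_fst_fibre_product continuous_map_cls]) auto
  then show "continuous_map (dot_pairs g h) (orbit_top g)
      (proj C F g h \<circ> (\<lambda>p. cls C F (Comp C g h) (dot C F g h (fst p) (snd p))))"
    by (rule continuous_map_eq) (auto simp: mem_dot_pairs proj_cls_dot[OF gh])
qed

text \<open>Write \<open>P = [\<gamma> \<cdot> \<eta> \<cdot> \<kappa>]\<close>. Both sides are the class of \<open>\<gamma>\<close>.\<close>

lemma proj_proj:
  assumes gh: "composable g h" and hk: "composable h k"
    and P: "P \<in> topspace (orbit_top (Comp C g (Comp C h k)))"
  shows "proj C F g h (proj C F (Comp C g h) k P) = proj C F g (Comp C h k) P"
proof -
  note c = composable_Comp[OF gh hk]
  have as: "Comp C (Comp C g h) k = Comp C g (Comp C h k)" using Comp_assoc gh hk by auto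
  obtain \<gamma> \<theta> where 1: "\<gamma> \<in> pts F g" "\<theta> \<in> pts F (Comp C h k)" "ra g \<gamma> = la (Comp C h k) \<theta>"
    "P = cls C F (Comp C g (Comp C h k)) (dot C F g (Comp C h k) \<gamma> \<theta>)"
    by (rule orbit_dot_cases[OF c(2) P])
  obtain \<eta> \<kappa> where 2: "\<eta> \<in> pts F h" "\<kappa> \<in> pts F k" "ra h \<eta> = la k \<kappa>" "\<theta> = dot C F h k \<eta> \<kappa>"
    by (rule dot_cases[OF hk 1(2)])
  have 3: "ra g \<gamma> = la h \<eta>" using 1(3) la_dot[OF hk 2(1-3)] 2(4) by simp
  have "P = cls C F (Comp C (Comp C g h) k) (dot C F (Comp C g h) k (dot C F g h \<gamma> \<eta>) \<kappa>)"
    using 1(4) 2 3 dot_assoc[of g h k \<gamma> \<eta> \<kappa>] gh hk 1(1) as by simp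
  then have "proj C F (Comp C g h) k P = cls C F (Comp C g h) (dot C F g h \<gamma> \<eta>)"
    using proj_cls_dot[OF c(1) dot_in_pts[OF gh 1(1) 2(1) 3] 2(2)] 2(3) ra_dot[OF gh 1(1) 2(1) 3]
    by simp
  then show ?thesis
    using proj_cls_dot[OF gh 1(1) 2(1) 3] proj_cls_dot[OF c(2) 1(1-3)] 1(4) by simp
qed

text \<open>The unit arrow at the anchor of \<open>\<gamma>\<close> is a point of the correspondence of the identity
  arrow \<open>Src C g\<close>.\<close>

lemma dot_unit_right:
  assumes "g \<in> Arr C" "\<gamma> \<in> pts F g"
  shows "ra g \<gamma> \<in> pts F (Src C g)" "la (Src C g) (ra g \<gamma>) = ra g \<gamma>"
    "dot C F g (Src C g) \<gamma> (ra g \<gamma>) = \<gamma>"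
proof -
  have S: "Src C g \<in> Obj C" using Src_Obj assms by auto
  note u = ra_Obj[OF assms] gpd_Obj_Arr[OF S ra_Obj[OF assms]] gpd_ident[OF S ra_Obj[OF assms]]
  show "ra g \<gamma> \<in> pts F (Src C g)" using pts_ident[OF S] u by simp
  show "la (Src C g) (ra g \<gamma>) = ra g \<gamma>" using Corr_ident_lanchor[OF S u(2)] u by simp
  show "dot C F g (Src C g) \<gamma> (ra g \<gamma>) = \<gamma>"
    using dot_ident_right[OF assms u(2)] u ract_ident[OF assms] by simp
qed

lemma proj_ident:
  assumes "g \<in> Arr C" "P \<in> topspace (orbit_top g)"
  shows "proj C F g (Src C g) P = P"
proof -
  obtain \<gamma> where \<gamma>: "\<gamma> \<in> pts F g" "P = cls C F g \<gamma>" using assms(2) by (rule cls_cases)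
  note u = dot_unit_right[OF assms(1) \<gamma>(1)]
  show ?thesis
    using proj_cls_dot[OF composable_Src[OF assms(1)] \<gamma>(1) u(1) u(2)[symmetric]] u(3)
      Comp_ident_right[OF assms(1)] \<gamma>(2) by simp
qed

lemma orbit_anchor_proj:
  assumes gh: "composable g h" and P: "P \<in> topspace (orbit_top (Comp C g h))"
  shows "orbit_anchor g (proj C F g h P) = orbit_anchor (Comp C g h) P"
proof (rule orbit_dot_cases[OF assms])
  fix \<gamma> \<eta> assume p: "\<gamma> \<in> pts F g" "\<eta> \<in> pts F h" "ra g \<gamma> = la h \<eta>"
    and P: "P = cls C F (Comp C g h) (dot C F g h \<gamma> \<eta>)"
  have A: "g \<in> Arr C" "Comp C g h \<in> Arr C" using gh Comp_Arr by auto
  show ?thesis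
    unfolding P proj_cls_dot[OF gh p] orbit_anchor_cls[OF A(1) p(1)]
      orbit_anchor_cls[OF A(2) dot_in_pts[OF gh p]] la_dot[OF gh p] ..
qed

section \<open>Multiplying and dividing orbits\<close>

text \<open>The map \<open>(\<gamma>, [\<eta>]) \<mapsto> [\<gamma> \<cdot> \<eta>]\<close>. Any element of \<open>P\<close> may serve as the representative \<open>\<eta>\<close>.\<close>

definition orbit_mult :: "'c \<Rightarrow> 'c \<Rightarrow> 'a \<Rightarrow> 'a set \<Rightarrow> 'a set" where
  "orbit_mult g h \<gamma> P = cls C F (Comp C g h) (dot C F g h \<gamma> (SOME \<eta>. \<eta> \<in> P))"

lemma orbit_mult_cls:
  assumes gh: "composable g h" and p: "\<gamma> \<in> pts F g" "\<eta> \<in> pts F h" "ra g \<gamma> = la h \<eta>"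
  shows "orbit_mult g h \<gamma> (cls C F h \<eta>) = cls C F (Comp C g h) (dot C F g h \<gamma> \<eta>)"
proof -
  have hA: "h \<in> Arr C" using gh by auto
  have "(SOME \<eta>'. \<eta>' \<in> cls C F h \<eta>) \<in> cls C F h \<eta>" using cls_self[OF hA p(2)] by (rule someI)
  note m = mem_cls[OF hA p(2) this]
  show ?thesis unfolding orbit_mult_def
    using cls_dot_eq_iff[OF gh p(1) m(1) _ p(2,3)] m p(3) by simp
qed

text \<open>Write \<open>P = [\<eta> \<cdot> \<kappa>]\<close>. Both sides are the class of \<open>\<gamma> \<cdot> \<eta>\<close>.\<close>

lemma orbit_mult_proj:
  assumes gh: "composable g h" and hk: "composable h k" and \<gamma>: "\<gamma> \<in> pts F g"
    and P: "P \<in> topspace (orbit_top (Comp C h k))" "ra g \<gamma> = orbit_anchor (Comp C h k) P"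
  shows "orbit_mult g h \<gamma> (proj C F h k P) =
    proj C F (Comp C g h) k (orbit_mult g (Comp C h k) \<gamma> P)"
proof (rule orbit_dot_cases[OF hk P(1)])
  note c = composable_Comp[OF gh hk]
  have as: "Comp C (Comp C g h) k = Comp C g (Comp C h k)" using Comp_assoc gh hk by auto
  fix \<eta> \<kappa> assume 2: "\<eta> \<in> pts F h" "\<kappa> \<in> pts F k" "ra h \<eta> = la k \<kappa>"
    and P': "P = cls C F (Comp C h k) (dot C F h k \<eta> \<kappa>)"
  note d = dot_mem[OF hk 2]
  have 3: "ra g \<gamma> = la (Comp C h k) (dot C F h k \<eta> \<kappa>)"
    using P(2) orbit_anchor_cls[OF _ d(1)] c P' by simp
  then have 4: "ra g \<gamma> = la h \<eta>" using d by simp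
  have "orbit_mult g (Comp C h k) \<gamma> P =
      cls C F (Comp C (Comp C g h) k) (dot C F (Comp C g h) k (dot C F g h \<gamma> \<eta>) \<kappa>)"
    unfolding P' orbit_mult_cls[OF c(2) \<gamma> d(1) 3]
    using dot_assoc[of g h k \<gamma> \<eta> \<kappa>] gh hk \<gamma> 2 4 as by simp
  then have "proj C F (Comp C g h) k (orbit_mult g (Comp C h k) \<gamma> P) =
      cls C F (Comp C g h) (dot C F g h \<gamma> \<eta>)"
    using proj_cls_dot[OF c(1) dot_in_pts[OF gh \<gamma> 2(1) 4] 2(2)] 2(3) ra_dot[OF gh \<gamma> 2(1) 4]
    by simp
  then show ?thesis
    unfolding P' proj_cls_dot[OF hk 2] orbit_mult_cls[OF gh \<gamma> 2(1) 4] by simp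
qed

text \<open>Descends from the map \<open>(\<gamma>, \<eta>) \<mapsto> [\<gamma> \<cdot> \<eta>]\<close> along the open surjection \<open>\<eta> \<mapsto> [\<eta>]\<close> in the
  second entry.\<close>

lemma continuous_map_orbit_mult:
  assumes gh: "composable g h"
  shows "continuous_map
    (fibre_product (Space (Corr F g)) (ra g) (orbit_top h) (orbit_anchor h))
    (orbit_top (Comp C g h)) (\<lambda>(\<gamma>, P). orbit_mult g h \<gamma> P)"
proof -
  let ?S = "{(\<gamma>, P). ra g \<gamma> = orbit_anchor h P}"
  have hA: "h \<in> Arr C" using gh by auto
  have "quotient_map
      (subtopology (prod_topology (Space (Corr F g)) (Space (Corr F h))) {(x, y). (x, cls C F h y) \<in> ?S})
      (subtopology (prod_topology (Space (Corr F g)) (orbit_top h)) ?S) (\<lambda>(x, y). (x, cls C F h y))"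
    by (rule quotient_map_id_times_restrict[OF continuous_map_cls[OF hA] open_map_cls[OF hA]])
      (simp add: topspace_orbit_top pts_def)
  moreover have "subtopology (prod_topology (Space (Corr F g)) (Space (Corr F h)))
      {(x, y). (x, cls C F h y) \<in> ?S} = dot_pairs g h"
    unfolding fibre_product_def
    by (rule subtopology_cong_topspace) (auto simp: orbit_anchor_cls[OF hA] pts_def)
  ultimately have q: "quotient_map (dot_pairs g h)
      (fibre_product (Space (Corr F g)) (ra g) (orbit_top h) (orbit_anchor h))
      (\<lambda>(x, y). (x, cls C F h y))"
    by (simp add: fibre_product_def)
  show ?thesis
  proof (rule continuous_compose_quotient_map[OF q])
    show "continuous_map (dot_pairs g h) (orbit_top (Comp C g h))
      ((\<lambda>(\<gamma>, P). orbit_mult g h \<gamma> P) \<circ> (\<lambda>(x, y). (x, cls C F h y)))"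
      by (rule continuous_map_eq[OF continuous_map_cls_dot[OF gh]])
        (auto simp: mem_dot_pairs orbit_mult_cls[OF gh])
  qed
qed

text \<open>The inverse operation \<open>(\<gamma>, [\<gamma> \<cdot> \<eta>]) \<mapsto> [\<eta>]\<close>. It is meaningful if \<open>proj C F g h P\<close> is
  the class of \<open>\<gamma>\<close>.\<close>

definition orbit_div :: "'c \<Rightarrow> 'c \<Rightarrow> 'a \<Rightarrow> 'a set \<Rightarrow> 'a set" where
  "orbit_div g h \<gamma> P = (THE Q. \<exists>\<eta> \<in> pts F h. ra g \<gamma> = la h \<eta> \<and>
     P = cls C F (Comp C g h) (dot C F g h \<gamma> \<eta>) \<and> Q = cls C F h \<eta>)"

lemma orbit_div_cls_dot:
  assumes gh: "composable g h" and p: "\<gamma> \<in> pts F g" "\<eta> \<in> pts F h" "ra g \<gamma> = la h \<eta>"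
  shows "orbit_div g h \<gamma> (cls C F (Comp C g h) (dot C F g h \<gamma> \<eta>)) = cls C F h \<eta>"
  unfolding orbit_div_def
proof (rule the_equality)
  show "\<exists>\<eta>'\<in>pts F h. ra g \<gamma> = la h \<eta>' \<and>
      cls C F (Comp C g h) (dot C F g h \<gamma> \<eta>) = cls C F (Comp C g h) (dot C F g h \<gamma> \<eta>') \<and>
      cls C F h \<eta> = cls C F h \<eta>'" using p by blast
next
  fix Q assume "\<exists>\<eta>'\<in>pts F h. ra g \<gamma> = la h \<eta>' \<and>
      cls C F (Comp C g h) (dot C F g h \<gamma> \<eta>) = cls C F (Comp C g h) (dot C F g h \<gamma> \<eta>') \<and>
      Q = cls C F h \<eta>'"
  then obtain \<eta>' where "\<eta>' \<in> pts F h" "ra g \<gamma> = la h \<eta>'" "Q = cls C F h \<eta>'"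
    "cls C F (Comp C g h) (dot C F g h \<gamma> \<eta>) = cls C F (Comp C g h) (dot C F g h \<gamma> \<eta>')" by blast
  then show "Q = cls C F h \<eta>" using cls_dot_eq_iff[OF gh p] by simp
qed

text \<open>If \<open>P = [\<gamma>' \<cdot> \<eta>']\<close> and \<open>\<gamma>' = \<gamma> a\<close>, then \<open>\<gamma>' \<cdot> \<eta>' = \<gamma> \<cdot> (a \<eta>')\<close>.\<close>

lemma orbit_div_representative:
  assumes gh: "composable g h" and \<gamma>: "\<gamma> \<in> pts F g"
    and P: "P \<in> topspace (orbit_top (Comp C g h))" "proj C F g h P = cls C F g \<gamma>"
  obtains \<eta> where "\<eta> \<in> pts F h" "ra g \<gamma> = la h \<eta>"
    "P = cls C F (Comp C g h) (dot C F g h \<gamma> \<eta>)" "orbit_div g h \<gamma> P = cls C F h \<eta>"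
proof (rule orbit_dot_cases[OF gh P(1)])
  fix \<gamma>' \<eta>' assume p: "\<gamma>' \<in> pts F g" "\<eta>' \<in> pts F h" "ra g \<gamma>' = la h \<eta>'"
    and P': "P = cls C F (Comp C g h) (dot C F g h \<gamma>' \<eta>')"
  have A: "g \<in> Arr C" "h \<in> Arr C" "Rng C h = Src C g" using gh by auto
  have "cls C F g \<gamma>' = cls C F g \<gamma>" using P(2) proj_cls_dot[OF gh p] P' by simp
  then obtain a where a: "a \<in> Arr (src_gpd g)" "ra g \<gamma> = Rng (src_gpd g) a"
    "\<gamma>' = ract (Corr F g) \<gamma> a" using cls_eq_iff[OF A(1) \<gamma> p(1)] by auto
  have s: "Src (src_gpd g) a = la h \<eta>'" using pts_ract(2)[OF A(1) \<gamma> a(1,2)] a(3) p(3) by simp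
  note l = pts_lact[OF A(2) p(2), unfolded A(3), OF a(1) s]
  have e: "P = cls C F (Comp C g h) (dot C F g h \<gamma> (lact (Corr F h) a \<eta>'))"
    using P' a(3) dot_balanced[OF gh \<gamma> p(2) a(1,2) s] by simp
  have "ra g \<gamma> = la h (lact (Corr F h) a \<eta>')" using l(2) a(2) by simp
  then show thesis using that[OF l(1) _ e] orbit_div_cls_dot[OF gh \<gamma> l(1)] e by simp
qed

text \<open>Write \<open>P = [\<gamma>' \<cdot> \<eta>']\<close>. If \<open>\<gamma>' = \<gamma> a\<close>, then the quotient of \<open>P\<close> by \<open>\<gamma>\<close> is \<open>[a \<eta>']\<close>, and \<open>a\<close>
  depends continuously on \<open>\<gamma>\<close> and \<open>\<gamma>'\<close> because the right action is basic.\<close>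

lemma continuous_map_orbit_div:
  assumes gh: "composable g h"
  shows "continuous_map
    (fibre_product (Space (Corr F g)) (cls C F g) (orbit_top (Comp C g h)) (proj C F g h))
    (orbit_top h) (\<lambda>(\<gamma>, P). orbit_div g h \<gamma> P)"
proof -
  interpret composable_correspondences "Gpd F (Rng C g)" "src_gpd g" "src_gpd h" "Corr F g" "Corr F h"
    by (rule composable_correspondences[OF gh])
  let ?S = "{(\<gamma>, P). cls C F g \<gamma> = proj C F g h P}"
  let ?q = "\<lambda>p. cls C F (Comp C g h) (dot C F g h (fst p) (snd p))"
  \<comment> \<open>The triples \<open>(\<gamma>, \<gamma>', \<eta>')\<close> with \<open>[\<gamma>] = [\<gamma>']\<close>, written as a preimage.\<close>
  let ?Z = "subtopology (prod_topology (Space (Corr F g)) (dot_pairs g h)) {(x, p). (x, ?q p) \<in> ?S}"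
  let ?a = "\<lambda>z. X.arrow_between (fst z) (fst (snd z))"
  have A: "g \<in> Arr C" "h \<in> Arr C" "Rng C h = Src C g" using gh by auto
  have q: "quotient_map ?Z (fibre_product (Space (Corr F g)) (cls C F g) (orbit_top (Comp C g h))
      (proj C F g h)) (\<lambda>(x, p). (x, ?q p))"
    unfolding fibre_product_def[of _ "cls C F g"]
    by (rule quotient_map_id_times_restrict[OF orbit_dot_topology[OF gh]])
  have Z: "\<gamma> \<in> pts F g" "\<gamma>' \<in> pts F g" "\<eta>' \<in> pts F h" "ra g \<gamma>' = la h \<eta>'" "cls C F g \<gamma> = cls C F g \<gamma>'"
    if "(\<gamma>, \<gamma>', \<eta>') \<in> topspace ?Z" for \<gamma> \<gamma>' \<eta>'
    using that proj_cls_dot[OF gh, of \<gamma>' \<eta>'] mem_dot_pairs[of \<gamma>' \<eta>' g h] by (auto simp: pts_def)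
  have a: "?a (\<gamma>, \<gamma>', \<eta>') \<in> Arr (src_gpd g) \<and> ra g \<gamma> = Rng (src_gpd g) (?a (\<gamma>, \<gamma>', \<eta>')) \<and>
      ract (Corr F g) \<gamma> (?a (\<gamma>, \<gamma>', \<eta>')) = \<gamma>' \<and> Src (src_gpd g) (?a (\<gamma>, \<gamma>', \<eta>')) = la h \<eta>'"
    if z: "(\<gamma>, \<gamma>', \<eta>') \<in> topspace ?Z" for \<gamma> \<gamma>' \<eta>'
  proof -
    obtain b where b: "b \<in> Arr (src_gpd g)" "ra g \<gamma> = Rng (src_gpd g) b" "\<gamma>' = ract (Corr F g) \<gamma> b"
      using cls_eq_iff[OF A(1) Z(1,2)[OF z]] Z(5)[OF z] by auto
    have "?a (\<gamma>, \<gamma>', \<eta>') = b"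
      using X.arrow_between_ract[of \<gamma> b] b Z(1)[OF z] by (simp add: pts_def)
    then show ?thesis using b pts_ract(2)[OF A(1) Z(1)[OF z] b(1,2)] Z(4)[OF z] by simp
  qed
  have c1: "continuous_map ?Z (Space (Corr F g)) fst" and cp: "continuous_map ?Z (dot_pairs g h) snd"
    by (auto intro: continuous_map_from_subtopology continuous_map_fst continuous_map_snd)
  have c2: "continuous_map ?Z (Space (Corr F g)) (\<lambda>z. fst (snd z))"
    and c3: "continuous_map ?Z (Space (Corr F h)) (\<lambda>z. snd (snd z))"
    using continuous_map_compose[OF cp continuous_map_fst_fibre_product]
      continuous_map_compose[OF cp continuous_map_snd_fibre_product] by (simp_all add: o_def)
  have ca: "continuous_map ?Z (Top (src_gpd g)) ?a"
  proof (rule X.continuous_map_arrow_between[OF c1 c2])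
    fix z assume "z \<in> topspace ?Z"
    then show "right_orbit (src_gpd g) (Corr F g) (fst z) =
        right_orbit (src_gpd g) (Corr F g) (fst (snd z))"
      using Z(5)[of "fst z" "fst (snd z)" "snd (snd z)"] by (simp add: cls_def)
  qed
  have "continuous_map ?Z (fibre_product (Top (src_gpd g)) (Src (src_gpd g)) (Space (Corr F h)) (la h))
      (\<lambda>z. (?a z, snd (snd z)))"
    unfolding continuous_map_into_fibre_product
  proof (intro conjI ballI)
    fix z assume "z \<in> topspace ?Z"
    then show "Src (src_gpd g) (fst (?a z, snd (snd z))) = la h (snd (?a z, snd (snd z)))"
      using a[of "fst z" "fst (snd z)" "snd (snd z)"] by simp
  qed (use ca c3 in \<open>simp_all add: o_def\<close>)
  from continuous_map_compose[OF continuous_map_compose[OF this Y.left.continuous_act]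
      continuous_map_cls[OF A(2)]]
  have l: "continuous_map ?Z (orbit_top h) (\<lambda>z. cls C F h (lact (Corr F h) (?a z) (snd (snd z))))"
    by (simp add: o_def)
  show ?thesis
  proof (rule continuous_compose_quotient_map[OF q], rule continuous_map_eq[OF l])
    fix z assume z: "z \<in> topspace ?Z"
    obtain \<gamma> \<gamma>' \<eta>' where z': "z = (\<gamma>, \<gamma>', \<eta>')" by (cases z) auto
    note Zz = Z[OF z[unfolded z']]
    define b where "b = ?a z"
    have b: "b \<in> Arr (src_gpd g)" "ra g \<gamma> = Rng (src_gpd g) b" "ract (Corr F g) \<gamma> b = \<gamma>'"
      "Src (src_gpd g) b = la h \<eta>'"
      using a[OF z[unfolded z']] by (simp_all add: b_def z')
    note l = pts_lact[OF A(2) Zz(3), unfolded A(3), OF b(1,4)]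
    have "orbit_div g h \<gamma> (cls C F (Comp C g h) (dot C F g h \<gamma>' \<eta>')) =
        cls C F h (lact (Corr F h) b \<eta>')"
      using dot_balanced[OF gh Zz(1,3) b(1,2,4)] b(2,3) l
        orbit_div_cls_dot[OF gh Zz(1) l(1)] by simp
    then show "cls C F h (lact (Corr F h) (?a z) (snd (snd z))) =
        ((\<lambda>(\<gamma>, P). orbit_div g h \<gamma> P) \<circ> (\<lambda>(x, p). (x, ?q p))) z"
      unfolding b_def[symmetric] by (simp add: z')
  qed
qed

end

section \<open>The limit space\<close>

context groupoid_diagram
begin

abbreviation Om :: "'c \<Rightarrow> ('c \<Rightarrow> 'a set) topology" where
  "Om x \<equiv> Omega_at C F x"

abbreviation acts :: "'c \<Rightarrow> 'a \<Rightarrow> ('c \<Rightarrow> 'a set) \<Rightarrow> bool" where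
  "acts g \<gamma> \<omega> \<equiv> g \<in> Arr C \<and> \<gamma> \<in> pts F g \<and> \<omega> \<in> topspace (Om (Src C g)) \<and>
     ra g \<gamma> = Omega_anchor F (Src C g) \<omega>"

lemma mem_Omega_iff:
  "\<omega> \<in> topspace (Om x) \<longleftrightarrow> \<omega> \<in> extensional {g \<in> Arr C. Rng C g = x} \<and>
     (\<forall>g \<in> Arr C. Rng C g = x \<longrightarrow> \<omega> g \<in> topspace (orbit_top g)) \<and>
     (\<forall>g h. composable g h \<and> Rng C g = x \<longrightarrow> proj C F g h (\<omega> (Comp C g h)) = \<omega> g)"
proof -
  have "\<omega> \<in> topspace (Om x) \<longleftrightarrow>
     \<omega> \<in> PiE {g \<in> Arr C. Rng C g = x} (\<lambda>g. topspace (orbit_top g)) \<and>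
     (\<forall>g \<in> Arr C. \<forall>h \<in> Arr C. Rng C g = x \<and> Rng C h = Src C g \<longrightarrow>
          proj C F g h (\<omega> (Comp C g h)) = \<omega> g)"
    unfolding Omega_at_def topspace_subtopology topspace_product_topology o_def by simp
  moreover have "(\<forall>g \<in> Arr C. \<forall>h \<in> Arr C. Rng C g = x \<and> Rng C h = Src C g \<longrightarrow> Q g h) \<longleftrightarrow>
      (\<forall>g h. composable g h \<and> Rng C g = x \<longrightarrow> Q g h)" for Q
    using eq_commute[where 'a = 'c] by blast
  ultimately show ?thesis unfolding PiE_iff by auto
qed

lemma Omega_coord:
  "\<lbrakk>\<omega> \<in> topspace (Om x); g \<in> Arr C; Rng C g = x\<rbrakk> \<Longrightarrow> \<omega> g \<in> topspace (orbit_top g)"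
  by (simp add: mem_Omega_iff)

lemma Omega_compat:
  "\<lbrakk>\<omega> \<in> topspace (Om x); composable g h; Rng C g = x\<rbrakk> \<Longrightarrow>
    proj C F g h (\<omega> (Comp C g h)) = \<omega> g"
  by (simp add: mem_Omega_iff)

lemma Omega_eqI:
  assumes "\<omega> \<in> topspace (Om x)" "\<omega>' \<in> topspace (Om x)"
    "\<And>g. \<lbrakk>g \<in> Arr C; Rng C g = x\<rbrakk> \<Longrightarrow> \<omega> g = \<omega>' g"
  shows "\<omega> = \<omega>'"
  by (rule extensionalityI[of _ "{g \<in> Arr C. Rng C g = x}"])
    (use assms in \<open>auto simp: mem_Omega_iff\<close>)

lemma Omega_anchor_ident:
  assumes "x \<in> Obj C" "\<omega> \<in> topspace (Om x)"
  shows "Omega_anchor F x \<omega> = orbit_anchor x (\<omega> x)"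
proof -
  have x: "x \<in> Arr C" "Rng C x = x" using assms(1) Obj_ArrC Rng_ident by auto
  obtain \<gamma> where \<gamma>: "\<gamma> \<in> pts F x" "\<omega> x = cls C F x \<gamma>"
    using Omega_coord[OF assms(2) x] by (rule cls_cases)
  have "Rng (Gpd F x) ` \<omega> x = la x ` \<omega> x"
  proof (rule image_cong)
    fix \<eta> assume "\<eta> \<in> \<omega> x"
    then have "\<eta> \<in> Arr (Gpd F x)" using mem_cls(1)[OF x(1) \<gamma>(1)] \<gamma>(2) pts_ident[OF assms(1)] by simp
    then show "Rng (Gpd F x) \<eta> = la x \<eta>" using Corr_ident_lanchor[OF assms(1)] by simp
  qed simp
  then show ?thesis by (simp add: Omega_anchor_def orbit_anchor_def)
qed

text \<open>The anchor of \<open>\<omega>\<close> is read off from the coordinate at the identity arrow, but all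
  coordinates have the same anchor because the projections preserve it.\<close>

lemma orbit_anchor_Omega:
  assumes "\<omega> \<in> topspace (Om x)" "h \<in> Arr C" "Rng C h = x"
  shows "orbit_anchor h (\<omega> h) = Omega_anchor F x \<omega>"
proof -
  have x: "x \<in> Obj C" "x \<in> Arr C" "Rng C x = x" "composable x h" "Comp C x h = h"
    using assms Rng_Obj[of h] Obj_ArrC[of x] Rng_ident[of x] composable_Rng[of h]
      Comp_ident_left[of h] by auto
  have "\<omega> h \<in> topspace (orbit_top (Comp C x h))" using Omega_coord[OF assms] x(5) by simp
  from orbit_anchor_proj[OF x(4) this] show ?thesis
    using Omega_compat[OF assms(1) x(4) x(3)] x(5) Omega_anchor_ident[OF x(1) assms(1)] by simp
qed

lemma continuous_map_Omega_coord:
  assumes "g \<in> Arr C" "Rng C g = x"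
  shows "continuous_map (Om x) (orbit_top g) (\<lambda>\<omega>. \<omega> g)"
  unfolding Omega_at_def
  by (rule continuous_map_from_subtopology, rule continuous_map_product_projection)
    (use assms in simp)

lemma continuous_map_Omega_anchor:
  assumes "x \<in> Obj C"
  shows "continuous_map (Om x) (Obj_top (Gpd F x)) (Omega_anchor F x)"
proof -
  have x: "x \<in> Arr C" "Rng C x = x" using assms(1) Obj_ArrC Rng_ident by auto
  have "continuous_map (Om x) (Obj_top (Gpd F x)) (orbit_anchor x \<circ> (\<lambda>\<omega>. \<omega> x))"
    using continuous_map_compose[OF continuous_map_Omega_coord[OF x]
        continuous_map_orbit_anchor[OF x(1)]] x(2) by simp
  then show ?thesis
    by (rule continuous_map_eq) (simp add: Omega_anchor_ident[OF assms])
qed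

lemma continuous_map_into_OmegaI:
  assumes f: "f \<in> topspace Z \<rightarrow> topspace (Om x)"
    and c: "\<And>g. \<lbrakk>g \<in> Arr C; Rng C g = x\<rbrakk> \<Longrightarrow> continuous_map Z (orbit_top g) (\<lambda>z. f z g)"
  shows "continuous_map Z (Om x) f"
proof -
  have "f ` topspace Z \<subseteq> extensional {g \<in> Arr C. Rng C g = x}"
  proof (rule image_subsetI)
    fix z assume "z \<in> topspace Z"
    from Pi_mem[OF f this] show "f z \<in> extensional {g \<in> Arr C. Rng C g = x}"
      unfolding mem_Omega_iff by (rule conjunct1)
  qed
  then have "continuous_map Z (product_topology (\<lambda>g. orbit_top g) {g \<in> Arr C. Rng C g = x}) f"
    unfolding continuous_map_componentwise using c by simp
  then show ?thesis
    using f unfolding Omega_at_def continuous_map_in_subtopology topspace_subtopology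
    by (simp only: Pi_iff Int_iff ball_conj_distrib simp_thms) (elim conjE, assumption)
qed

lemma Omega_orbit_anchor:
  assumes "acts g \<gamma> \<omega>" "composable g h"
  shows "ra g \<gamma> = orbit_anchor h (\<omega> h)" "\<omega> h \<in> topspace (orbit_top h)"
proof -
  have h: "h \<in> Arr C" "Rng C h = Src C g" and \<omega>: "\<omega> \<in> topspace (Om (Src C g))"
    and e: "ra g \<gamma> = Omega_anchor F (Src C g) \<omega>"
    using assms by (elim conjE, simp)+
  show "ra g \<gamma> = orbit_anchor h (\<omega> h)" using orbit_anchor_Omega[OF \<omega> h] e by (simp only:)
  show "\<omega> h \<in> topspace (orbit_top h)" by (rule Omega_coord[OF \<omega> h])
qed

lemma orbit_mult_in:
  assumes gh: "composable g h" and \<gamma>: "\<gamma> \<in> pts F g"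
    and P: "P \<in> topspace (orbit_top h)" "ra g \<gamma> = orbit_anchor h P"
  shows "orbit_mult g h \<gamma> P \<in> topspace (orbit_top (Comp C g h))"
proof -
  have hA: "h \<in> Arr C" using gh by auto
  obtain \<eta> where \<eta>: "\<eta> \<in> pts F h" "P = cls C F h \<eta>" using P(1) by (rule cls_cases)
  then have e: "ra g \<gamma> = la h \<eta>" using P(2) orbit_anchor_cls[OF hA] by simp
  show ?thesis
    unfolding \<eta>(2) orbit_mult_cls[OF gh \<gamma> \<eta>(1) e] by (rule cls_in[OF dot_in_pts[OF gh \<gamma> \<eta>(1) e]])
qed

text \<open>Every square \<open>k h1 = g h2\<close> proposes the value \<open>\<pi> [\<gamma> \<cdot> \<omega> h2]\<close> for the coordinate of
  \<open>\<gamma> \<cdot> \<omega>\<close> at \<open>k\<close>. The value does not change if the square is extended by an arrow \<open>l\<close>.\<close>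

lemma Omega_mult_refine:
  assumes act: "acts g \<gamma> \<omega>" and kh: "composable k h1" and gh: "composable g h2"
    and eq: "Comp C k h1 = Comp C g h2" and hl: "composable h2 l"
  shows "proj C F k h1 (orbit_mult g h2 \<gamma> (\<omega> h2)) =
    proj C F k (Comp C h1 l) (orbit_mult g (Comp C h2 l) \<gamma> (\<omega> (Comp C h2 l)))"
proof -
  have "Src C h1 = Src C h2" using eq Src_Comp[of k h1] Src_Comp[of g h2] kh gh by simp
  then have hl1: "composable h1 l" using hl kh by simp
  note c = composable_Comp[OF gh hl]
  have as: "Comp C (Comp C g h2) l = Comp C g (Comp C h2 l)" "Comp C (Comp C k h1) l = Comp C k (Comp C h1 l)"
    using Comp_assoc[of g h2 l] Comp_assoc[of k h1 l] gh hl hl1 kh by auto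
  let ?P = "\<omega> (Comp C h2 l)"
  note P = Omega_orbit_anchor[OF act c(2)]
  have \<gamma>: "\<gamma> \<in> pts F g" using act by simp
  have h2: "Rng C h2 = Src C g" and \<omega>: "\<omega> \<in> topspace (Om (Src C g))" using gh act by (elim conjE, simp)+
  have "\<omega> h2 = proj C F h2 l ?P" by (rule sym, rule Omega_compat[OF \<omega> hl h2])
  then have "orbit_mult g h2 \<gamma> (\<omega> h2) = proj C F (Comp C k h1) l (orbit_mult g (Comp C h2 l) \<gamma> ?P)"
    by (simp only: orbit_mult_proj[OF gh hl \<gamma> P(2,1)] eq)
  moreover have "orbit_mult g (Comp C h2 l) \<gamma> ?P \<in> topspace (orbit_top (Comp C k (Comp C h1 l)))"
    using orbit_mult_in[OF c(2) \<gamma> P(2,1)] as eq by simp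
  ultimately show ?thesis using proj_proj[OF kh hl1] by simp
qed

end

section \<open>The action on the limit space\<close>

locale ore_diagram = groupoid_diagram C F
  for C :: "'c category" and F :: "('c, 'a) diagram_data" +
  assumes ore: "right_Ore C"
begin

lemma ore_square:
  assumes "g1 \<in> Arr C" "g2 \<in> Arr C" "Rng C g1 = Rng C g2"
  obtains h1 h2 where "composable g1 h1" "composable g2 h2" "Comp C g1 h1 = Comp C g2 h2"
  using ore assms unfolding right_Ore_def by blast

lemma ore_equalize:
  assumes "composable g h1" "composable g h2" "Comp C g h1 = Comp C g h2"
  obtains k where "composable h1 k" "composable h2 k" "Comp C h1 k = Comp C h2 k"
proof -
  have "\<forall>g \<in> Arr C. \<forall>h1 \<in> Arr C. \<forall>h2 \<in> Arr C.
       Src C g = Rng C h1 \<and> Src C g = Rng C h2 \<and> Comp C g h1 = Comp C g h2 \<longrightarrow>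
        (\<exists>k \<in> Arr C. Rng C k = Src C h1 \<and> Rng C k = Src C h2 \<and> Comp C h1 k = Comp C h2 k)"
    using ore unfolding right_Ore_def by (rule conjunct2)
  then obtain k where k: "k \<in> Arr C" "Rng C k = Src C h1" "Rng C k = Src C h2"
    "Comp C h1 k = Comp C h2 k"
    using assms by blast
  show thesis by (rule that[OF _ _ k(4)]) (use k(1) k(2,3)[symmetric] assms in simp_all)
qed

text \<open>Two squares over \<open>k\<close> and \<open>g\<close> have a common extension. The first Ore condition yields
  \<open>a\<close> and \<open>b\<close> with \<open>h1 a = h1' b\<close>. Then \<open>h2 a\<close> and \<open>h2' b\<close> become equal after composition
  with \<open>g\<close>, so the second Ore condition yields an arrow \<open>c\<close> with \<open>h2 a c = h2' b c\<close>.\<close>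

lemma Omega_mult_independent:
  assumes act: "acts g \<gamma> \<omega>"
    and kh: "composable k h1" and gh: "composable g h2" and eq: "Comp C k h1 = Comp C g h2"
    and kh': "composable k h1'" and gh': "composable g h2'" and eq': "Comp C k h1' = Comp C g h2'"
  shows "proj C F k h1 (orbit_mult g h2 \<gamma> (\<omega> h2)) = proj C F k h1' (orbit_mult g h2' \<gamma> (\<omega> h2'))"
proof -
  have A: "h1 \<in> Arr C" "h1' \<in> Arr C" "Rng C h1 = Rng C h1'" using kh kh' by auto
  obtain a b where ab: "composable h1 a" "composable h1' b" "Comp C h1 a = Comp C h1' b"
    by (rule ore_square[OF A])
  have "Src C h1 = Src C h2" using eq Src_Comp[of k h1] Src_Comp[of g h2] kh gh by simp
  then have a2: "composable h2 a" using ab gh by simp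
  have "Src C h1' = Src C h2'" using eq' Src_Comp[of k h1'] Src_Comp[of g h2'] kh' gh' by simp
  then have b2: "composable h2' b" using ab gh' by simp
  have "Comp C g (Comp C h2 a) = Comp C (Comp C g h2) a" using Comp_assoc[of g h2 a] gh a2 by simp
  also have "\<dots> = Comp C k (Comp C h1 a)" using Comp_assoc[of k h1 a] kh ab(1) eq by simp
  also have "\<dots> = Comp C (Comp C k h1') b" using Comp_assoc[of k h1' b] kh' ab(2,3) by simp
  also have "\<dots> = Comp C g (Comp C h2' b)" using Comp_assoc[of g h2' b] gh' b2 eq' by simp
  finally have "Comp C g (Comp C h2 a) = Comp C g (Comp C h2' b)" .
  then obtain c where c: "composable (Comp C h2 a) c" "composable (Comp C h2' b) c"
    "Comp C (Comp C h2 a) c = Comp C (Comp C h2' b) c"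
    using ore_equalize[OF composable_Comp(2)[OF gh a2] composable_Comp(2)[OF gh' b2]] by blast
  have ac: "composable a c" "composable b c"
    using c(1,2) Src_Comp[of h2 a] Src_Comp[of h2' b] a2 b2 by auto
  note l = composable_Comp(2)[OF a2 ac(1)] composable_Comp(2)[OF b2 ac(2)]
  have "Comp C h1 (Comp C a c) = Comp C (Comp C h1 a) c"
    using Comp_assoc[of h1 a c] ab ac by simp
  also have "\<dots> = Comp C h1' (Comp C b c)" using Comp_assoc[of h1' b c] ab ac by simp
  finally have e1: "Comp C h1 (Comp C a c) = Comp C h1' (Comp C b c)" .
  have e2: "Comp C h2 (Comp C a c) = Comp C h2' (Comp C b c)"
    using c(3) Comp_assoc[of h2 a c] Comp_assoc[of h2' b c] a2 b2 ac by simp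
  show ?thesis
    using Omega_mult_refine[OF act kh gh eq l(1)] Omega_mult_refine[OF act kh' gh' eq' l(2)] e1 e2
    by simp
qed

text \<open>By the first Ore condition, every arrow \<open>k\<close> with the range of \<open>g\<close> has an extension
  \<open>k h1\<close> of the form \<open>g h2\<close>, and the coordinate at \<open>k h1\<close> determines the one at \<open>k\<close>.\<close>

lemma Omega_ext:
  assumes g: "g \<in> Arr C" and \<omega>: "\<omega> \<in> topspace (Om (Rng C g))" "\<omega>' \<in> topspace (Om (Rng C g))"
    and eq: "\<And>h. composable g h \<Longrightarrow> \<omega> (Comp C g h) = \<omega>' (Comp C g h)"
  shows "\<omega> = \<omega>'"
proof (rule Omega_eqI[OF \<omega>])
  fix k assume k: "k \<in> Arr C" "Rng C k = Rng C g"
  obtain h1 h2 where h: "composable k h1" "composable g h2" "Comp C k h1 = Comp C g h2"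
    by (rule ore_square[OF k(1) g k(2)])
  show "\<omega> k = \<omega>' k"
    using Omega_compat[OF \<omega>(1) h(1) k(2)] Omega_compat[OF \<omega>(2) h(1) k(2)] h(3) eq[OF h(2)] by simp
qed

text \<open>Each coordinate is defined by one chosen square. Independence of the square makes the
  family compatible: a square for \<open>k l\<close> also gives a square for \<open>k\<close>, and for \<open>k = g h\<close> there
  is the trivial square.\<close>

lemma Omega_act_exists:
  assumes act: "acts g \<gamma> \<omega>"
  obtains \<omega>' where "\<omega>' \<in> topspace (Om (Rng C g))"
    "\<And>h. composable g h \<Longrightarrow> \<omega>' (Comp C g h) = orbit_mult g h \<gamma> (\<omega> h)"
proof -
  have g: "g \<in> Arr C" and \<gamma>: "\<gamma> \<in> pts F g" using act by auto
  let ?K = "{k \<in> Arr C. Rng C k = Rng C g}"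
  let ?sq = "\<lambda>k h1 h2. composable k h1 \<and> composable g h2 \<and> Comp C k h1 = Comp C g h2"
  have "\<forall>k \<in> ?K. \<exists>p. ?sq k (fst p) (snd p)"
  proof
    fix k assume "k \<in> ?K"
    then have k: "k \<in> Arr C" "Rng C k = Rng C g" by auto
    obtain h1 h2 where "composable k h1" "composable g h2" "Comp C k h1 = Comp C g h2"
      by (rule ore_square[OF k(1) g k(2)])
    then show "\<exists>p. ?sq k (fst p) (snd p)" by (intro exI[of _ "(h1, h2)"]) simp
  qed
  from bchoice[OF this] obtain p where "\<forall>k \<in> ?K. ?sq k (fst (p k)) (snd (p k))" ..
  note p = bspec[OF this]
  define \<omega>' where "\<omega>' = restrict (\<lambda>k. proj C F k (fst (p k))
    (orbit_mult g (snd (p k)) \<gamma> (\<omega> (snd (p k))))) ?K"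
  have \<omega>': "\<omega>' k = proj C F k h1 (orbit_mult g h2 \<gamma> (\<omega> h2))"
    if sq: "?sq k h1 h2" for k h1 h2
  proof -
    have "Rng C k = Rng C g" using Rng_Comp[of k h1] Rng_Comp[of g h2] sq by simp
    then have k: "k \<in> ?K" using sq by simp
    note s = p[OF k]
    show ?thesis unfolding \<omega>'_def restrict_apply'[OF k]
      by (rule Omega_mult_independent[OF act conjunct1[OF s] conjunct1[OF conjunct2[OF s]]
            conjunct2[OF conjunct2[OF s]] conjunct1[OF sq] conjunct1[OF conjunct2[OF sq]]
            conjunct2[OF conjunct2[OF sq]]])
  qed
  have mult_in: "orbit_mult g h \<gamma> (\<omega> h) \<in> topspace (orbit_top (Comp C g h))"
    if "composable g h" for h
    using orbit_mult_in[OF that \<gamma>] Omega_orbit_anchor[OF act that] by simp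
  show thesis
  proof (rule that)
    show "\<omega>' \<in> topspace (Om (Rng C g))"
      unfolding mem_Omega_iff
    proof (intro conjI ballI allI impI)
      show "\<omega>' \<in> extensional ?K" by (simp add: \<omega>'_def)
      fix k assume "k \<in> Arr C" "Rng C k = Rng C g"
      then have "k \<in> ?K" by simp
      note sq = p[OF this]
      show "\<omega>' k \<in> topspace (orbit_top k)"
        using proj_in[of k "fst (p k)"] mult_in[of "snd (p k)"] sq \<omega>'[OF sq] by simp
    next
      fix k l assume kl: "composable k l \<and> Rng C k = Rng C g"
      then have k: "composable k l" by simp
      have "Comp C k l \<in> ?K" using kl Comp_Arr Rng_Comp by simp
      then obtain h1 h2 where sq: "?sq (Comp C k l) h1 h2" by (rule that[OF p])
      have lh: "composable l h1" using sq k Src_Comp[of k l] by simp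
      have as: "Comp C (Comp C k l) h1 = Comp C k (Comp C l h1)" using Comp_assoc[of k l h1] k lh by simp
      have sq': "?sq k (Comp C l h1) h2" using sq as composable_Comp(2)[OF k lh] by simp
      have "orbit_mult g h2 \<gamma> (\<omega> h2) \<in> topspace (orbit_top (Comp C k (Comp C l h1)))"
        using mult_in[of h2] sq as by simp
      from proj_proj[OF k lh this]
      show "proj C F k l (\<omega>' (Comp C k l)) = \<omega>' k"
        unfolding \<omega>'[OF sq] \<omega>'[OF sq'] .
    qed
  next
    fix h assume gh: "composable g h"
    have c: "Comp C g h \<in> Arr C" "Src C (Comp C g h) = Src C h" using gh Comp_Arr Src_Comp by auto
    have h: "h \<in> Arr C" using gh by simp
    have sh: "composable h (Src C h)" using composable_Src[OF h] .
    \<comment> \<open>The trivial square, with an identity arrow on one side.\<close>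
    have sq: "?sq (Comp C g h) (Src C h) h"
      using composable_Src[OF c(1)] c gh Comp_ident_right[OF c(1)] by simp
    show "\<omega>' (Comp C g h) = orbit_mult g h \<gamma> (\<omega> h)"
      using \<omega>'[OF sq] proj_ident[OF c(1) mult_in[OF gh]] c(2) by simp
  qed
qed

lemma Omega_act_eqI:
  assumes act: "acts g \<gamma> \<omega>" and \<omega>': "\<omega>' \<in> topspace (Om (Rng C g))"
    "\<And>h. composable g h \<Longrightarrow> \<omega>' (Comp C g h) = orbit_mult g h \<gamma> (\<omega> h)"
  shows "Omega_act C F g \<gamma> \<omega> = \<omega>'"
  unfolding Omega_act_def
proof (rule the_equality)
  have g: "g \<in> Arr C" and \<gamma>: "\<gamma> \<in> pts F g" using act by auto
  have mult: "cls C F (Comp C g h) (dot C F g h \<gamma> \<eta>) = orbit_mult g h \<gamma> (\<omega> h)"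
    if h: "composable g h" and \<eta>: "\<eta> \<in> \<omega> h" for h \<eta>
  proof -
    have hA: "h \<in> Arr C" using h by simp
    note P = Omega_orbit_anchor[OF act h]
    obtain \<eta>0 where 0: "\<eta>0 \<in> pts F h" "\<omega> h = cls C F h \<eta>0" using P(2) by (rule cls_cases)
    note m = mem_cls[OF hA 0(1) \<eta>[unfolded 0(2)]]
    have "ra g \<gamma> = la h \<eta>" using P(1) orbit_anchor_cls[OF hA 0(1)] m(3) 0(2) by simp
    from orbit_mult_cls[OF h \<gamma> m(1) this] show ?thesis using m(2) 0(2) by simp
  qed
  show "\<omega>' \<in> topspace (Om (Rng C g)) \<and> (\<forall>h\<in>Arr C. Rng C h = Src C g \<longrightarrow>
      (\<forall>\<eta>\<in>\<omega> h. \<omega>' (Comp C g h) = cls C F (Comp C g h) (dot C F g h \<gamma> \<eta>)))"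
    using \<omega>' mult g by simp
  fix \<omega>2 assume 2: "\<omega>2 \<in> topspace (Om (Rng C g)) \<and> (\<forall>h\<in>Arr C. Rng C h = Src C g \<longrightarrow>
      (\<forall>\<eta>\<in>\<omega> h. \<omega>2 (Comp C g h) = cls C F (Comp C g h) (dot C F g h \<gamma> \<eta>)))"
  show "\<omega>2 = \<omega>'"
  proof (rule Omega_ext[OF g _ \<omega>'(1)])
    fix h assume h: "composable g h"
    then have hA: "h \<in> Arr C" "Rng C h = Src C g" by auto
    obtain \<eta> where "\<eta> \<in> pts F h" "\<omega> h = cls C F h \<eta>"
      using Omega_orbit_anchor(2)[OF act h] by (rule cls_cases)
    then have \<eta>: "\<eta> \<in> \<omega> h" using cls_self[OF hA(1)] by simp
    then have "\<omega>2 (Comp C g h) = cls C F (Comp C g h) (dot C F g h \<gamma> \<eta>)" using 2 hA by blast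
    then show "\<omega>2 (Comp C g h) = \<omega>' (Comp C g h)" using mult[OF h \<eta>] \<omega>'(2)[OF h] by simp
  qed (use 2 in simp)
qed

lemma Omega_act:
  assumes act: "acts g \<gamma> \<omega>"
  shows Omega_act_in: "Omega_act C F g \<gamma> \<omega> \<in> topspace (Om (Rng C g))"
    and Omega_act_Comp: "composable g h \<Longrightarrow>
      Omega_act C F g \<gamma> \<omega> (Comp C g h) = orbit_mult g h \<gamma> (\<omega> h)"
proof -
  obtain \<omega>' where \<omega>': "\<omega>' \<in> topspace (Om (Rng C g))"
    "\<And>h. composable g h \<Longrightarrow> \<omega>' (Comp C g h) = orbit_mult g h \<gamma> (\<omega> h)"
    by (rule Omega_act_exists[OF act]) blast
  have e: "Omega_act C F g \<gamma> \<omega> = \<omega>'" by (rule Omega_act_eqI[OF act \<omega>'])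
  show "Omega_act C F g \<gamma> \<omega> \<in> topspace (Om (Rng C g))"
    "composable g h \<Longrightarrow> Omega_act C F g \<gamma> \<omega> (Comp C g h) = orbit_mult g h \<gamma> (\<omega> h)"
    unfolding e by (rule \<omega>'; assumption)+
qed

lemma Omega_act_coord:
  assumes act: "acts g \<gamma> \<omega>" and kh: "composable k h1" and gh: "composable g h2"
    and eq: "Comp C k h1 = Comp C g h2"
  shows "Omega_act C F g \<gamma> \<omega> k = proj C F k h1 (orbit_mult g h2 \<gamma> (\<omega> h2))"
proof -
  have "Rng C k = Rng C g" using eq Rng_Comp[of k h1] Rng_Comp[of g h2] kh gh by simp
  then show ?thesis
    using Omega_compat[OF Omega_act_in[OF act] kh] Omega_act_Comp[OF act gh] eq by simp
qed

text \<open>For the identity arrow \<open>h = Src C g\<close> the defining formula multiplies \<open>\<gamma>\<close> from the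
  right by an arrow of a groupoid, which does not change its class. This identity is the
  source of the uniqueness of equivariant maps and of the second condition on actions.\<close>

lemma Omega_act_at:
  assumes act: "acts g \<gamma> \<omega>"
  shows "Omega_act C F g \<gamma> \<omega> g = cls C F g \<gamma>"
proof -
  have g: "g \<in> Arr C" and \<gamma>: "\<gamma> \<in> pts F g" using act by auto
  note gs = composable_Src[OF g]
  note P = Omega_orbit_anchor[OF act gs]
  have sA: "Src C g \<in> Arr C" using gs by simp
  obtain \<eta> where \<eta>: "\<eta> \<in> pts F (Src C g)" "\<omega> (Src C g) = cls C F (Src C g) \<eta>"
    using P(2) by (rule cls_cases)
  have e: "ra g \<gamma> = la (Src C g) \<eta>" using P(1) \<eta> orbit_anchor_cls[OF sA] by simp
  have S: "Src C g \<in> Obj C" using Src_Obj[OF g] .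
  have \<eta>A: "\<eta> \<in> Arr (src_gpd g)" using \<eta>(1) pts_ident[OF S] by simp
  have r: "ra g \<gamma> = Rng (src_gpd g) \<eta>" using e Corr_ident_lanchor[OF S \<eta>A] by simp
  have "Omega_act C F g \<gamma> \<omega> g = cls C F g (ract (Corr F g) \<gamma> \<eta>)"
    using Omega_act_Comp[OF act gs] orbit_mult_cls[OF gs \<gamma> \<eta>(1) e] \<eta>(2) Comp_ident_right[OF g]
      dot_ident_right[OF g \<gamma> \<eta>A r] by simp
  also have "\<dots> = cls C F g \<gamma>"
    using cls_eq_iff[OF g \<gamma> pts_ract(1)[OF g \<gamma> \<eta>A r]] \<eta>A r by blast
  finally show ?thesis .
qed

lemma Omega_anchor_act:
  assumes act: "acts g \<gamma> \<omega>"
  shows "Omega_anchor F (Rng C g) (Omega_act C F g \<gamma> \<omega>) = la g \<gamma>"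
proof -
  have g: "g \<in> Arr C" and \<gamma>: "\<gamma> \<in> pts F g" using act by auto
  show ?thesis
    using orbit_anchor_Omega[OF Omega_act_in[OF act] g refl] Omega_act_at[OF act]
      orbit_anchor_cls[OF g \<gamma>] by simp
qed

lemma Omega_act_act:
  assumes gh: "composable g h" and \<omega>: "acts h \<eta> \<omega>" and \<gamma>: "\<gamma> \<in> pts F g" "ra g \<gamma> = la h \<eta>"
  shows "Omega_act C F g \<gamma> (Omega_act C F h \<eta> \<omega>) = Omega_act C F (Comp C g h) (dot C F g h \<gamma> \<eta>) \<omega>"
proof -
  have g: "g \<in> Arr C" "h \<in> Arr C" "Rng C h = Src C g" and \<eta>: "\<eta> \<in> pts F h" using gh \<omega> by auto
  have act: "acts g \<gamma> (Omega_act C F h \<eta> \<omega>)"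
    using g \<gamma> Omega_act_in[OF \<omega>] Omega_anchor_act[OF \<omega>] by simp
  have c: "Comp C g h \<in> Arr C" "Src C (Comp C g h) = Src C h" "Rng C (Comp C g h) = Rng C g"
    using gh Comp_Arr Src_Comp Rng_Comp by auto
  have act': "acts (Comp C g h) (dot C F g h \<gamma> \<eta>) \<omega>"
    using c \<omega> dot_mem[OF gh \<gamma>(1) \<eta> \<gamma>(2)] by simp
  show ?thesis
  proof (rule sym, rule Omega_act_eqI[OF act'])
    show "Omega_act C F g \<gamma> (Omega_act C F h \<eta> \<omega>) \<in> topspace (Om (Rng C (Comp C g h)))"
      using Omega_act_in[OF act] c(3) by simp
    fix k assume "composable (Comp C g h) k"
    then have hk: "composable h k" using c g by simp
    note cc = composable_Comp[OF gh hk]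
    have kA: "k \<in> Arr C" using hk by simp
    have as: "Comp C (Comp C g h) k = Comp C g (Comp C h k)" using Comp_assoc[of g h k] gh hk by simp
    note P = Omega_orbit_anchor[OF \<omega> hk]
    obtain \<kappa> where \<kappa>: "\<kappa> \<in> pts F k" "\<omega> k = cls C F k \<kappa>" using P(2) by (rule cls_cases)
    have e: "ra h \<eta> = la k \<kappa>" using P(1) \<kappa> orbit_anchor_cls[OF kA] by simp
    note d = dot_mem[OF hk \<eta> \<kappa>(1) e] 
    note d' = dot_mem[OF gh \<gamma>(1) \<eta> \<gamma>(2)]
    have "Omega_act C F g \<gamma> (Omega_act C F h \<eta> \<omega>) (Comp C g (Comp C h k)) =
        cls C F (Comp C g (Comp C h k)) (dot C F g (Comp C h k) \<gamma> (dot C F h k \<eta> \<kappa>))"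
      using Omega_act_Comp[OF act cc(2)] Omega_act_Comp[OF \<omega> hk] orbit_mult_cls[OF hk \<eta> \<kappa>(1) e]
        orbit_mult_cls[OF cc(2) \<gamma>(1) d(1)] d(2) \<gamma>(2) \<kappa>(2) by simp
    moreover have "orbit_mult (Comp C g h) k (dot C F g h \<gamma> \<eta>) (\<omega> k) =
        cls C F (Comp C (Comp C g h) k) (dot C F (Comp C g h) k (dot C F g h \<gamma> \<eta>) \<kappa>)"
      using orbit_mult_cls[OF cc(1) d'(1) \<kappa>(1)] d'(3) e \<kappa>(2) by simp
    moreover have "dot C F (Comp C g h) k (dot C F g h \<gamma> \<eta>) \<kappa> =
        dot C F g (Comp C h k) \<gamma> (dot C F h k \<eta> \<kappa>)"
      by (rule dot_assoc) (use gh hk \<gamma> \<eta> \<kappa>(1) e in simp_all)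
    ultimately show "Omega_act C F g \<gamma> (Omega_act C F h \<eta> \<omega>) (Comp C (Comp C g h) k) =
        orbit_mult (Comp C g h) k (dot C F g h \<gamma> \<eta>) (\<omega> k)" using as by simp
  qed
qed

lemma Omega_act_inj:
  assumes "acts g \<gamma> \<omega>" "acts g \<gamma> \<omega>'" "Omega_act C F g \<gamma> \<omega> = Omega_act C F g \<gamma> \<omega>'"
  shows "\<omega> = \<omega>'"
proof (rule Omega_eqI)
  show "\<omega> \<in> topspace (Om (Src C g))" "\<omega>' \<in> topspace (Om (Src C g))" using assms by auto
  fix h assume h: "h \<in> Arr C" "Rng C h = Src C g"
  have gh: "composable g h" and \<gamma>: "\<gamma> \<in> pts F g" using assms h by auto
  note P = Omega_orbit_anchor[OF assms(1) gh] and P' = Omega_orbit_anchor[OF assms(2) gh]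
  obtain \<eta> where \<eta>: "\<eta> \<in> pts F h" "\<omega> h = cls C F h \<eta>" using P(2) by (rule cls_cases)
  obtain \<eta>' where \<eta>': "\<eta>' \<in> pts F h" "\<omega>' h = cls C F h \<eta>'" using P'(2) by (rule cls_cases)
  have e: "ra g \<gamma> = la h \<eta>" using P(1) \<eta> orbit_anchor_cls[OF h(1)] by simp
  have e': "ra g \<gamma> = la h \<eta>'" using P'(1) \<eta>' orbit_anchor_cls[OF h(1)] by simp
  have "orbit_mult g h \<gamma> (\<omega> h) = orbit_mult g h \<gamma> (\<omega>' h)"
    using Omega_act_Comp[OF assms(1) gh] Omega_act_Comp[OF assms(2) gh] assms(3) by simp
  then show "\<omega> h = \<omega>' h"
    unfolding \<eta>(2) \<eta>'(2) orbit_mult_cls[OF gh \<gamma> \<eta>(1) e] orbit_mult_cls[OF gh \<gamma> \<eta>'(1) e']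
    using cls_dot_eq_iff[OF gh \<gamma> \<eta>(1) e \<eta>'(1) e'] by blast
qed

text \<open>Comparing the coordinates at \<open>g\<close> gives an arrow \<open>a\<close> with \<open>\<gamma>' = \<gamma> a\<close>. Then
  \<open>\<gamma> \<cdot> \<omega> = \<gamma>' \<cdot> \<omega>' = \<gamma> \<cdot> (a \<omega>')\<close>, and \<open>\<gamma>\<close> can be cancelled.\<close>

lemma Omega_act_eqD:
  assumes act: "acts g \<gamma> \<omega>" and act': "acts g \<gamma>' \<omega>'"
    and eq: "Omega_act C F g \<gamma> \<omega> = Omega_act C F g \<gamma>' \<omega>'"
  obtains a where "a \<in> Arr (src_gpd g)" "ra g \<gamma> = Rng (src_gpd g) a"
    "Src (src_gpd g) a = Omega_anchor F (Src C g) \<omega>'" "\<gamma>' = ract (Corr F g) \<gamma> a"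
    "\<omega> = Omega_act C F (Src C g) a \<omega>'"
proof -
  have g: "g \<in> Arr C" and \<gamma>: "\<gamma> \<in> pts F g" and \<gamma>': "\<gamma>' \<in> pts F g" using act act' by auto
  have S: "Src C g \<in> Obj C" using Src_Obj[OF g] .
  have "cls C F g \<gamma>' = cls C F g \<gamma>" using Omega_act_at[OF act] Omega_act_at[OF act'] eq by simp
  then obtain a where a: "a \<in> Arr (src_gpd g)" "ra g \<gamma> = Rng (src_gpd g) a"
    "\<gamma>' = ract (Corr F g) \<gamma> a" using cls_eq_iff[OF g \<gamma> \<gamma>'] by auto
  have s: "Src (src_gpd g) a = Omega_anchor F (Src C g) \<omega>'"
    using pts_ract(2)[OF g \<gamma> a(1,2)] a(3) act' by simp
  note gs = composable_Src[OF g]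
  have sr: "Rng C (Src C g) = Src C g" "Src C (Src C g) = Src C g" "Src C g \<in> Arr C"
    using Rng_ident[OF S] Src_ident[OF S] Obj_ArrC[OF S] by auto
  have ap: "a \<in> pts F (Src C g)" "ra (Src C g) a = Src (src_gpd g) a"
    "la (Src C g) a = Rng (src_gpd g) a"
    using a(1) pts_ident[OF S] Corr_ident_lanchor[OF S] Corr_ident_ranchor[OF S] by auto
  have acta: "acts (Src C g) a \<omega>'" using sr ap s act' by simp
  have la: "ra g \<gamma> = la (Src C g) a" using ap(3) a(2) by simp
  have "Omega_act C F g \<gamma> (Omega_act C F (Src C g) a \<omega>') = Omega_act C F g \<gamma>' \<omega>'"
    using Omega_act_act[OF gs acta \<gamma> la] Comp_ident_right[OF g] dot_ident_right[OF g \<gamma> a(1,2)] a(3)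
    by simp
  then have "Omega_act C F g \<gamma> \<omega> = Omega_act C F g \<gamma> (Omega_act C F (Src C g) a \<omega>')"
    using eq by simp
  moreover have "acts g \<gamma> (Omega_act C F (Src C g) a \<omega>')"
    using g \<gamma> Omega_act_in[OF acta] Omega_anchor_act[OF acta] sr la by simp
  ultimately have "\<omega> = Omega_act C F (Src C g) a \<omega>'" using Omega_act_inj[OF act] by blast
  then show thesis using that a s by blast
qed

definition Omega_div :: "'c \<Rightarrow> 'a \<Rightarrow> ('c \<Rightarrow> 'a set) \<Rightarrow> 'c \<Rightarrow> 'a set" where
  "Omega_div g \<gamma> \<omega> =
     restrict (\<lambda>h. orbit_div g h \<gamma> (\<omega> (Comp C g h))) {h \<in> Arr C. Rng C h = Src C g}"

text \<open>If the coordinate of \<open>\<omega>\<close> at \<open>g\<close> is the class of \<open>\<gamma>\<close>, then \<open>\<gamma>\<close> divides every coordinate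
  at an arrow \<open>g h\<close>, and the quotients form a compatible family. This yields both the
  surjectivity of the action and the inverse of \<open>(\<gamma>, \<omega>) \<mapsto> (\<gamma>, \<gamma> \<cdot> \<omega>)\<close> that shows its
  openness.\<close>

lemma Omega_div:
  assumes g: "g \<in> Arr C" and \<gamma>: "\<gamma> \<in> pts F g" and \<omega>: "\<omega> \<in> topspace (Om (Rng C g))"
    and at: "\<omega> g = cls C F g \<gamma>"
  shows acts_Omega_div: "acts g \<gamma> (Omega_div g \<gamma> \<omega>)"
    and Omega_act_div: "Omega_act C F g \<gamma> (Omega_div g \<gamma> \<omega>) = \<omega>"
proof -
  let ?D = "Omega_div g \<gamma> \<omega>"
  have rep: "\<exists>\<eta> \<in> pts F h. ra g \<gamma> = la h \<eta> \<and>
      \<omega> (Comp C g h) = cls C F (Comp C g h) (dot C F g h \<gamma> \<eta>) \<and> ?D h = cls C F h \<eta>"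
    if gh: "composable g h" for h
  proof -
    have c: "Comp C g h \<in> Arr C" "Rng C (Comp C g h) = Rng C g" using gh Comp_Arr Rng_Comp by auto
    \<comment> \<open>This is the condition under which the coordinate at \<open>g h\<close> can be divided by \<open>\<gamma>\<close>.\<close>
    have "proj C F g h (\<omega> (Comp C g h)) = cls C F g \<gamma>" using Omega_compat[OF \<omega> gh] at by simp
    then obtain \<eta> where "\<eta> \<in> pts F h" "ra g \<gamma> = la h \<eta>"
      "\<omega> (Comp C g h) = cls C F (Comp C g h) (dot C F g h \<gamma> \<eta>)"
      "orbit_div g h \<gamma> (\<omega> (Comp C g h)) = cls C F h \<eta>"
      by (rule orbit_div_representative[OF gh \<gamma> Omega_coord[OF \<omega> c]])
    then show ?thesis using gh by (auto simp: Omega_div_def)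
  qed
  have D: "?D \<in> topspace (Om (Src C g))"
    unfolding mem_Omega_iff
  proof (intro conjI ballI allI impI)
    show "?D \<in> extensional {h \<in> Arr C. Rng C h = Src C g}" by (simp add: Omega_div_def)
    fix h assume "h \<in> Arr C" "Rng C h = Src C g"
    then show "?D h \<in> topspace (orbit_top h)" using rep[of h] g cls_in by force
  next
    fix h k assume hk': "composable h k \<and> Rng C h = Src C g"
    then have hk: "composable h k" and gh: "composable g h" using g by auto
    note cc = composable_Comp[OF gh hk]
    have as: "Comp C (Comp C g h) k = Comp C g (Comp C h k)" using Comp_assoc[of g h k] gh hk by simp
    obtain \<theta> where \<theta>: "\<theta> \<in> pts F (Comp C h k)" "ra g \<gamma> = la (Comp C h k) \<theta>"
      "\<omega> (Comp C g (Comp C h k)) = cls C F (Comp C g (Comp C h k)) (dot C F g (Comp C h k) \<gamma> \<theta>)"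
      "?D (Comp C h k) = cls C F (Comp C h k) \<theta>" using rep[OF cc(2)] by blast
    obtain \<eta> \<kappa> where p: "\<eta> \<in> pts F h" "\<kappa> \<in> pts F k" "ra h \<eta> = la k \<kappa>" "\<theta> = dot C F h k \<eta> \<kappa>"
      by (rule dot_cases[OF hk \<theta>(1)])
    have e: "ra g \<gamma> = la h \<eta>" using \<theta>(2) la_dot[OF hk p(1-3)] p(4) by simp
    have "dot C F g (Comp C h k) \<gamma> \<theta> = dot C F (Comp C g h) k (dot C F g h \<gamma> \<eta>) \<kappa>"
      unfolding p(4) by (rule dot_assoc[symmetric]) (use gh hk \<gamma> p e in simp_all)
    then have "\<omega> (Comp C (Comp C g h) k) =
        cls C F (Comp C (Comp C g h) k) (dot C F (Comp C g h) k (dot C F g h \<gamma> \<eta>) \<kappa>)"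
      using \<theta>(3) as by simp
    then have "\<omega> (Comp C g h) = cls C F (Comp C g h) (dot C F g h \<gamma> \<eta>)"
      using Omega_compat[OF \<omega> cc(1)] Rng_Comp[of g h] gh ra_dot[OF gh \<gamma> p(1) e] p(3)
        proj_cls_dot[OF cc(1) dot_in_pts[OF gh \<gamma> p(1) e] p(2)] by simp
    then have "?D h = cls C F h \<eta>"
      using orbit_div_cls_dot[OF gh \<gamma> p(1) e] gh by (simp add: Omega_div_def)
    then show "proj C F h k (?D (Comp C h k)) = ?D h"
      using proj_cls_dot[OF hk p(1-3)] \<theta>(4) p(4) by simp
  qed
  note gs = composable_Src[OF g]
  obtain \<eta> where \<eta>: "\<eta> \<in> pts F (Src C g)" "ra g \<gamma> = la (Src C g) \<eta>" "?D (Src C g) = cls C F (Src C g) \<eta>"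
    using rep[OF gs] by blast
  have sA: "Src C g \<in> Arr C" "Rng C (Src C g) = Src C g" using gs by simp_all
  show act: "acts g \<gamma> ?D"
    using g \<gamma> D orbit_anchor_Omega[OF D sA] \<eta> orbit_anchor_cls[OF sA(1) \<eta>(1)] by simp
  show "Omega_act C F g \<gamma> ?D = \<omega>"
  proof (rule Omega_act_eqI[OF act \<omega>])
    fix h assume gh: "composable g h"
    then obtain \<eta> where "\<eta> \<in> pts F h" "ra g \<gamma> = la h \<eta>" "?D h = cls C F h \<eta>"
      "\<omega> (Comp C g h) = cls C F (Comp C g h) (dot C F g h \<gamma> \<eta>)" using rep by blast
    then show "\<omega> (Comp C g h) = orbit_mult g h \<gamma> (?D h)" using orbit_mult_cls[OF gh \<gamma>] by simp
  qed
qed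

lemma Omega_div_act:
  assumes "acts g \<gamma> \<omega>"
  shows "Omega_div g \<gamma> (Omega_act C F g \<gamma> \<omega>) = \<omega>"
proof -
  have g: "g \<in> Arr C" and \<gamma>: "\<gamma> \<in> pts F g" using assms by auto
  note d = Omega_div[OF g \<gamma> Omega_act_in[OF assms] Omega_act_at[OF assms]]
  show ?thesis by (rule Omega_act_inj[OF d(1) assms d(2)])
qed

section \<open>Continuity and openness of the action on the limit\<close>

abbreviation act_pairs :: "'c \<Rightarrow> ('a \<times> ('c \<Rightarrow> 'a set)) topology" where
  "act_pairs g \<equiv>
     fibre_product (Space (Corr F g)) (ra g) (Om (Src C g)) (Omega_anchor F (Src C g))"

lemma mem_act_pairs: "g \<in> Arr C \<Longrightarrow> (\<gamma>, \<omega>) \<in> topspace (act_pairs g) \<longleftrightarrow> acts g \<gamma> \<omega>"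
  by (simp add: topspace_fibre_product pts_def)

text \<open>The coordinate at \<open>k\<close> depends only on \<open>\<gamma>\<close> and on a single coordinate \<open>\<omega> h2\<close>, through
  the continuous multiplication of orbits followed by a projection.\<close>

lemma continuous_map_Omega_act:
  assumes g: "g \<in> Arr C"
  shows "continuous_map (act_pairs g) (Om (Rng C g)) (\<lambda>(\<gamma>, \<omega>). Omega_act C F g \<gamma> \<omega>)"
proof (rule continuous_map_into_OmegaI)
  show "(\<lambda>(\<gamma>, \<omega>). Omega_act C F g \<gamma> \<omega>) \<in> topspace (act_pairs g) \<rightarrow> topspace (Om (Rng C g))"
    using Omega_act_in mem_act_pairs[OF g] by (intro Pi_I) force
  fix k assume k: "k \<in> Arr C" "Rng C k = Rng C g"
  obtain h1 h2 where h: "composable k h1" "composable g h2" "Comp C k h1 = Comp C g h2"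
    by (rule ore_square[OF k(1) g k(2)])
  have h2: "h2 \<in> Arr C" "Rng C h2 = Src C g" using h by auto
  have "continuous_map (act_pairs g) (orbit_top h2) ((\<lambda>\<omega>. \<omega> h2) \<circ> snd)"
    by (rule continuous_map_compose[OF continuous_map_snd_fibre_product
          continuous_map_Omega_coord[OF h2]])
  then have "continuous_map (act_pairs g)
      (fibre_product (Space (Corr F g)) (ra g) (orbit_top h2) (orbit_anchor h2))
      (\<lambda>p. (fst p, snd p h2))"
    unfolding continuous_map_into_fibre_product
    using continuous_map_fst_fibre_product Omega_orbit_anchor(1)[OF _ h(2)]
    by (auto simp: o_def mem_act_pairs[OF g])
  from continuous_map_compose[OF continuous_map_compose[OF this continuous_map_orbit_mult[OF h(2)]]
      continuous_map_proj[OF h(1), unfolded h(3)]]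
  show "continuous_map (act_pairs g) (orbit_top k) (\<lambda>z. (\<lambda>(\<gamma>, \<omega>). Omega_act C F g \<gamma> \<omega>) z k)"
  proof (rule continuous_map_eq)
    fix p assume "p \<in> topspace (act_pairs g)"
    then have "acts g (fst p) (snd p)" using mem_act_pairs[OF g, of "fst p" "snd p"] by simp
    from Omega_act_coord[OF this h]
    show "(proj C F k h1 \<circ> ((\<lambda>(\<gamma>, P). orbit_mult g h2 \<gamma> P) \<circ> (\<lambda>p. (fst p, snd p h2)))) p =
        (\<lambda>(\<gamma>, \<omega>). Omega_act C F g \<gamma> \<omega>) p k"
      by (simp add: case_prod_unfold)
  qed
qed

abbreviation div_pairs :: "'c \<Rightarrow> ('a \<times> ('c \<Rightarrow> 'a set)) topology" where
  "div_pairs g \<equiv> fibre_product (Space (Corr F g)) (cls C F g) (Om (Rng C g)) (\<lambda>\<omega>. \<omega> g)"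

lemma mem_div_pairs: "(\<gamma>, \<omega>) \<in> topspace (div_pairs g) \<longleftrightarrow>
    \<gamma> \<in> pts F g \<and> \<omega> \<in> topspace (Om (Rng C g)) \<and> \<omega> g = cls C F g \<gamma>"
  by (auto simp: topspace_fibre_product pts_def)

lemma continuous_map_Omega_div:
  assumes g: "g \<in> Arr C"
  shows "continuous_map (div_pairs g) (act_pairs g) (\<lambda>p. (fst p, Omega_div g (fst p) (snd p)))"
proof -
  have acts: "acts g (fst p) (Omega_div g (fst p) (snd p))" if "p \<in> topspace (div_pairs g)" for p
    using acts_Omega_div[OF g, of "fst p" "snd p"] that mem_div_pairs[of "fst p" "snd p" g] by simp
  have "continuous_map (div_pairs g) (Om (Src C g)) (\<lambda>p. Omega_div g (fst p) (snd p))"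
  proof (rule continuous_map_into_OmegaI)
    show "(\<lambda>p. Omega_div g (fst p) (snd p)) \<in> topspace (div_pairs g) \<rightarrow> topspace (Om (Src C g))"
      using acts by (intro Pi_I) simp
    fix h assume h: "h \<in> Arr C" "Rng C h = Src C g"
    then have gh: "composable g h" using g by simp
    have c: "Comp C g h \<in> Arr C" "Rng C (Comp C g h) = Rng C g" using gh Comp_Arr Rng_Comp by auto
    have 1: "continuous_map (div_pairs g) (orbit_top (Comp C g h)) ((\<lambda>\<omega>. \<omega> (Comp C g h)) \<circ> snd)"
      by (rule continuous_map_compose[OF continuous_map_snd_fibre_product
            continuous_map_Omega_coord[OF c]])
    have "continuous_map (div_pairs g)
        (fibre_product (Space (Corr F g)) (cls C F g) (orbit_top (Comp C g h)) (proj C F g h))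
        (\<lambda>p. (fst p, snd p (Comp C g h)))"
      unfolding continuous_map_into_fibre_product
    proof (intro conjI ballI)
      fix p assume "p \<in> topspace (div_pairs g)"
      then show "cls C F g (fst (fst p, snd p (Comp C g h))) =
          proj C F g h (snd (fst p, snd p (Comp C g h)))"
        using mem_div_pairs[of "fst p" "snd p" g] Omega_compat[of "snd p" "Rng C g" g h] gh by simp
    qed (use 1 continuous_map_fst_fibre_product in \<open>simp_all add: o_def\<close>)
    from continuous_map_compose[OF this continuous_map_orbit_div[OF gh]]
    show "continuous_map (div_pairs g) (orbit_top h) (\<lambda>p. Omega_div g (fst p) (snd p) h)"
      using h by (simp add: o_def Omega_div_def)
  qed
  then show ?thesis
    unfolding continuous_map_into_fibre_product
    using acts continuous_map_fst_fibre_product by (simp add: o_def)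
qed

text \<open>The map \<open>(\<gamma>, \<omega>) \<mapsto> (\<gamma>, \<gamma> \<cdot> \<omega>)\<close> is a homeomorphism onto the pullback of the open orbit map
  along a coordinate projection. So the action is a homeomorphism followed by a pullback of an
  open map.\<close>

lemma open_map_Omega_act:
  assumes g: "g \<in> Arr C"
  shows "open_map (act_pairs g) (Om (Rng C g)) (\<lambda>(\<gamma>, \<omega>). Omega_act C F g \<gamma> \<omega>)"
  unfolding open_map_def
proof (intro allI impI)
  fix W assume W: "openin (act_pairs g) W"
  let ?d = "\<lambda>p. (fst p, Omega_div g (fst p) (snd p))"
  let ?V = "{p \<in> topspace (div_pairs g). ?d p \<in> W}"
  have "openin (div_pairs g) ?V"
    by (rule openin_continuous_map_preimage[OF continuous_map_Omega_div[OF g] W])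
  then have "openin (Om (Rng C g)) (snd ` ?V)"
    using open_map_snd_fibre_product[OF open_map_cls[OF g] continuous_map_Omega_coord[OF g refl]]
    by (simp add: open_map_def)
  moreover have "(\<lambda>(\<gamma>, \<omega>). Omega_act C F g \<gamma> \<omega>) ` W = snd ` ?V"
  proof (intro equalityI subsetI)
    fix \<omega>' assume "\<omega>' \<in> (\<lambda>(\<gamma>, \<omega>). Omega_act C F g \<gamma> \<omega>) ` W"
    then obtain \<gamma> \<omega> where w: "(\<gamma>, \<omega>) \<in> W" "\<omega>' = Omega_act C F g \<gamma> \<omega>" by auto
    then have act: "acts g \<gamma> \<omega>" using openin_subset[OF W] mem_act_pairs[OF g] by blast
    have "(\<gamma>, \<omega>') \<in> ?V"
      using w act mem_div_pairs[of \<gamma> \<omega>' g] Omega_act_in[OF act] Omega_act_at[OF act]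
        Omega_div_act[OF act] by simp
    then show "\<omega>' \<in> snd ` ?V" by force
  next
    fix \<omega>' assume "\<omega>' \<in> snd ` ?V"
    then obtain \<gamma> where v: "(\<gamma>, \<omega>') \<in> topspace (div_pairs g)" "(\<gamma>, Omega_div g \<gamma> \<omega>') \<in> W" by auto
    then have "Omega_act C F g \<gamma> (Omega_div g \<gamma> \<omega>') = \<omega>'"
      using mem_div_pairs Omega_act_div[OF g] by simp
    then show "\<omega>' \<in> (\<lambda>(\<gamma>, \<omega>). Omega_act C F g \<gamma> \<omega>) ` W"
      by (intro image_eqI[OF _ v(2)]) simp
  qed
  ultimately show "openin (Om (Rng C g)) ((\<lambda>(\<gamma>, \<omega>). Omega_act C F g \<gamma> \<omega>) ` W)" by simp
qed

lemma Omega_act_surj: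
  assumes g: "g \<in> Arr C" and \<omega>: "\<omega> \<in> topspace (Om (Rng C g))"
  obtains \<gamma> \<omega>' where "acts g \<gamma> \<omega>'" "\<omega> = Omega_act C F g \<gamma> \<omega>'"
proof -
  obtain \<gamma> where \<gamma>: "\<gamma> \<in> pts F g" "\<omega> g = cls C F g \<gamma>"
    using Omega_coord[OF \<omega> g refl] by (rule cls_cases)
  note d = Omega_div[OF g \<gamma>(1) \<omega> \<gamma>(2)]
  show thesis by (rule that[OF d(1) d(2)[symmetric]])
qed

end

section \<open>The limit as an action of the diagram\<close>

context ore_diagram
begin

lemma Part_Omega: "Part (Omega C F) x = {x} \<times> topspace (Om x)"
  by (simp add: Omega_def)

lemma anchor_Omega: "anchor (Omega C F) (x, \<omega>) = Omega_anchor F x \<omega>"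
  by (simp add: Omega_def)

lemma act_Omega: "act (Omega C F) g \<gamma> (x, \<omega>) = (Rng C g, Omega_act C F g \<gamma> \<omega>)"
  by (simp add: Omega_def)

lemma Carrier_Omega: "Carrier (Omega C F) = sum_topology Om (Obj C)"
  by (simp add: Omega_def)

lemma topspace_Part_top_Omega:
  "x \<in> Obj C \<Longrightarrow> topspace (Part_top (Omega C F) x) = {x} \<times> topspace (Om x)"
  by (auto simp: Part_top_def Carrier_Omega Part_Omega)

text \<open>A part of the disjoint union is homeomorphic to the limit space that it comes from,
  which transports the topological statements above to the action.\<close>

lemma Part_top_Omega:
  assumes "x \<in> Obj C"
  shows continuous_map_Pair_Omega: "continuous_map (Om x) (Part_top (Omega C F) x) (Pair x)"
    and open_map_Pair_Omega: "open_map (Om x) (Part_top (Omega C F) x) (Pair x)"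
    and continuous_map_snd_Omega: "continuous_map (Part_top (Omega C F) x) (Om x) snd"
proof -
  show "continuous_map (Om x) (Part_top (Omega C F) x) (Pair x)"
    unfolding Part_top_def Carrier_Omega Part_Omega continuous_map_in_subtopology
    using continuous_map_component_injection[OF assms] by auto
  have o: "open_map (Om x) (Carrier (Omega C F)) (Pair x)"
    unfolding Carrier_Omega by (rule open_map_component_injection[OF assms])
  then show "open_map (Om x) (Part_top (Omega C F) x) (Pair x)"
    unfolding Part_top_def Part_Omega by (rule open_map_into_subtopology) auto
  show "continuous_map (Part_top (Omega C F) x) (Om x) snd"
    unfolding continuous_map_def
  proof (intro conjI allI impI)
    show "snd \<in> topspace (Part_top (Omega C F) x) \<rightarrow> topspace (Om x)"
      unfolding topspace_Part_top_Omega[OF assms] by auto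
    fix U assume U: "openin (Om x) U"
    have "{p \<in> topspace (Part_top (Omega C F) x). snd p \<in> U} = Pair x ` U"
      unfolding topspace_Part_top_Omega[OF assms] using openin_subset[OF U] by auto
    then show "openin (Part_top (Omega C F) x) {p \<in> topspace (Part_top (Omega C F) x). snd p \<in> U}"
      using \<open>open_map (Om x) (Part_top (Omega C F) x) (Pair x)\<close> U by (simp add: open_map_def)
  qed
qed

lemma continuous_map_action_domain_Omega:
  assumes g: "g \<in> Arr C"
  shows "continuous_map (action_domain C F (Omega C F) g) (act_pairs g) (\<lambda>p. (fst p, snd (snd p)))"
    "continuous_map (act_pairs g) (action_domain C F (Omega C F) g) (\<lambda>p. (fst p, (Src C g, snd p)))"
proof -
  note S = Src_Obj[OF g]
  have "continuous_map (action_domain C F (Omega C F) g) (Om (Src C g)) (\<lambda>p. snd (snd p))"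
    using continuous_map_compose[OF continuous_map_snd_fibre_product continuous_map_snd_Omega[OF S]]
    by (simp add: o_def action_domain_def)
  moreover have "ra g (fst p) = Omega_anchor F (Src C g) (snd (snd p))"
    if "p \<in> topspace (action_domain C F (Omega C F) g)" for p
    using that by (auto simp: action_domain_def topspace_fibre_product topspace_Part_top_Omega[OF S]
        anchor_Omega)
  ultimately show "continuous_map (action_domain C F (Omega C F) g) (act_pairs g)
      (\<lambda>p. (fst p, snd (snd p)))"
    unfolding continuous_map_into_fibre_product
    by (simp add: o_def) (simp add: action_domain_def continuous_map_fst_fibre_product)
  have "continuous_map (act_pairs g) (Part_top (Omega C F) (Src C g)) (\<lambda>p. (Src C g, snd p))"
    using continuous_map_compose[OF continuous_map_snd_fibre_product continuous_map_Pair_Omega[OF S]]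
    by (simp add: o_def)
  then show "continuous_map (act_pairs g) (action_domain C F (Omega C F) g)
      (\<lambda>p. (fst p, (Src C g, snd p)))"
    unfolding action_domain_def continuous_map_into_fibre_product
    by (auto simp: o_def continuous_map_fst_fibre_product topspace_fibre_product anchor_Omega)
qed

lemma mem_action_domain_Omega:
  assumes g: "g \<in> Arr C"
  shows "(\<gamma>, (x, \<omega>)) \<in> topspace (action_domain C F (Omega C F) g) \<longleftrightarrow> x = Src C g \<and> acts g \<gamma> \<omega>"
  using g by (auto simp: action_domain_def topspace_fibre_product
      topspace_Part_top_Omega[OF Src_Obj[OF g]] anchor_Omega pts_def)

lemma diagram_action_Omega: "diagram_action C F (Omega C F)"
proof
  let ?\<Omega> = "Omega C F"
  show "disjoint_family_on (Part ?\<Omega>) (Obj C)"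
    by (auto simp: disjoint_family_on_def Part_Omega)
  show "(\<Union>x\<in>Obj C. Part ?\<Omega> x) = topspace (Carrier ?\<Omega>)"
    by (auto simp: Part_Omega Carrier_Omega)
  fix x assume x: "x \<in> Obj C"
  have P: "Part ?\<Omega> x = Pair x ` topspace (Om x)" by (auto simp: Part_Omega)
  show "openin (Carrier ?\<Omega>) (Part ?\<Omega> x)"
    using open_map_component_injection[OF x, of Om] unfolding P Carrier_Omega
    by (simp add: open_map_def)
  show "closedin (Carrier ?\<Omega>) (Part ?\<Omega> x)"
    using closed_map_component_injection[OF x, of Om] unfolding P Carrier_Omega
    by (simp add: closed_map_def)
  show "continuous_map (Part_top ?\<Omega> x) (Obj_top (Gpd F x)) (anchor ?\<Omega>)"
    by (rule continuous_map_eq[OF continuous_map_compose[OF continuous_map_snd_Omega[OF x]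
            continuous_map_Omega_anchor[OF x]]])
      (auto simp: topspace_Part_top_Omega[OF x] anchor_Omega)
next
  let ?\<Omega> = "Omega C F"
  fix g assume g: "g \<in> Arr C"
  note S = Src_Obj[OF g] and R = Rng_Obj[OF g]
  let ?act = "\<lambda>(\<gamma>, y). act ?\<Omega> g \<gamma> y" and ?oact = "\<lambda>(\<gamma>, \<omega>). Omega_act C F g \<gamma> \<omega>"
  let ?to = "\<lambda>p. (fst p, snd (snd p))" and ?from = "\<lambda>p. (fst p, (Src C g, snd p))"
  have eq: "?act p = (Pair (Rng C g) \<circ> (?oact \<circ> ?to)) p" for p
    by (cases p) (auto simp: act_Omega split: prod.split)
  show "continuous_map (action_domain C F ?\<Omega> g) (Part_top ?\<Omega> (Rng C g)) ?act"
    using continuous_map_compose[OF continuous_map_compose[OF continuous_map_action_domain_Omega(1)[OF g]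
          continuous_map_Omega_act[OF g]] continuous_map_Pair_Omega[OF R]]
    by (rule continuous_map_eq) (simp only: eq)
  show "open_map (action_domain C F ?\<Omega> g) (Part_top ?\<Omega> (Rng C g)) ?act"
    unfolding open_map_def
  proof (intro allI impI)
    fix W assume W: "openin (action_domain C F ?\<Omega> g) W"
    let ?V = "{p \<in> topspace (act_pairs g). ?from p \<in> W}"
    have "openin (act_pairs g) ?V"
      by (rule openin_continuous_map_preimage[OF continuous_map_action_domain_Omega(2)[OF g] W])
    then have "openin (Part_top ?\<Omega> (Rng C g)) (Pair (Rng C g) ` ?oact ` ?V)"
      using open_map_Omega_act[OF g] open_map_Pair_Omega[OF R] by (simp add: open_map_def)
    moreover have "?V = ?to ` W"
    proof (intro equalityI subsetI)
      fix p assume "p \<in> ?V"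
      then show "p \<in> ?to ` W" by (intro image_eqI[of _ _ "?from p"]) auto
    next
      fix p assume "p \<in> ?to ` W"
      then obtain \<gamma> x \<omega> where w: "(\<gamma>, (x, \<omega>)) \<in> W" "p = (\<gamma>, \<omega>)" by auto
      then have "x = Src C g \<and> acts g \<gamma> \<omega>"
        using openin_subset[OF W] mem_action_domain_Omega[OF g] by blast
      then show "p \<in> ?V" using w mem_act_pairs[OF g] by simp
    qed
    ultimately show "openin (Part_top ?\<Omega> (Rng C g)) (?act ` W)"
      by (simp only: eq image_comp[symmetric] cong: image_cong)
  qed
  show "?act ` topspace (action_domain C F ?\<Omega> g) = Part ?\<Omega> (Rng C g)"
  proof (intro equalityI subsetI)
    fix p assume "p \<in> ?act ` topspace (action_domain C F ?\<Omega> g)"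
    then obtain \<gamma> x \<omega> where "(\<gamma>, (x, \<omega>)) \<in> topspace (action_domain C F ?\<Omega> g)"
      "p = act ?\<Omega> g \<gamma> (x, \<omega>)" by auto
    then show "p \<in> Part ?\<Omega> (Rng C g)"
      using mem_action_domain_Omega[OF g] Omega_act_in by (simp add: act_Omega Part_Omega)
  next
    fix p assume "p \<in> Part ?\<Omega> (Rng C g)"
    then obtain \<omega> where \<omega>: "p = (Rng C g, \<omega>)" "\<omega> \<in> topspace (Om (Rng C g))" by (auto simp: Part_Omega)
    obtain \<gamma> \<omega>' where a: "acts g \<gamma> \<omega>'" "\<omega> = Omega_act C F g \<gamma> \<omega>'" by (rule Omega_act_surj[OF g \<omega>(2)])
    have "p = ?act (\<gamma>, (Src C g, \<omega>'))" using \<omega>(1) a(2) by (simp add: act_Omega)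
    moreover have "(\<gamma>, (Src C g, \<omega>')) \<in> topspace (action_domain C F ?\<Omega> g)"
      using mem_action_domain_Omega[OF g] a(1) by simp
    ultimately show "p \<in> ?act ` topspace (action_domain C F ?\<Omega> g)" by (rule image_eqI)
  qed
next
  let ?\<Omega> = "Omega C F"
  fix g \<gamma> y assume g: "g \<in> Arr C" "\<gamma> \<in> pts F g" "y \<in> Part ?\<Omega> (Src C g)" "ra g \<gamma> = anchor ?\<Omega> y"
  obtain \<omega> where y: "y = (Src C g, \<omega>)" using g(3) by (auto simp: Part_Omega)
  have "acts g \<gamma> \<omega>" using g y by (simp add: Part_Omega anchor_Omega)
  from Omega_anchor_act[OF this] show "anchor ?\<Omega> (act ?\<Omega> g \<gamma> y) = la g \<gamma>"
    by (simp add: y act_Omega anchor_Omega)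
next
  let ?\<Omega> = "Omega C F"
  fix g1 g2 \<gamma>1 \<gamma>2 y
  assume g: "g1 \<in> Arr C" "g2 \<in> Arr C" "Src C g1 = Rng C g2" and p: "\<gamma>1 \<in> pts F g1" "\<gamma>2 \<in> pts F g2"
    and y: "y \<in> Part ?\<Omega> (Src C g2)" and e: "ra g1 \<gamma>1 = la g2 \<gamma>2" "ra g2 \<gamma>2 = anchor ?\<Omega> y"
  have gh: "composable g1 g2" using g by simp
  obtain \<omega> where \<omega>: "y = (Src C g2, \<omega>)" using y by (auto simp: Part_Omega)
  have "acts g2 \<gamma>2 \<omega>" using g(2) p(2) y e(2) \<omega> by (simp add: Part_Omega anchor_Omega)
  from Omega_act_act[OF gh this p(1) e(1)]
  show "act ?\<Omega> g1 \<gamma>1 (act ?\<Omega> g2 \<gamma>2 y) = act ?\<Omega> (Comp C g1 g2) (dot C F g1 g2 \<gamma>1 \<gamma>2) y"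
    using Rng_Comp[OF g] by (simp add: \<omega> act_Omega)
next
  let ?\<Omega> = "Omega C F"
  fix g \<gamma> \<gamma>' y y'
  assume g: "g \<in> Arr C" and p: "\<gamma> \<in> pts F g" "\<gamma>' \<in> pts F g"
    and y: "y \<in> Part ?\<Omega> (Src C g)" "y' \<in> Part ?\<Omega> (Src C g)"
    and e: "ra g \<gamma> = anchor ?\<Omega> y" "ra g \<gamma>' = anchor ?\<Omega> y'"
    and eq: "act ?\<Omega> g \<gamma> y = act ?\<Omega> g \<gamma>' y'"
  obtain \<omega> \<omega>' where \<omega>: "y = (Src C g, \<omega>)" "y' = (Src C g, \<omega>')" using y by (auto simp: Part_Omega)
  have "acts g \<gamma> \<omega>" "acts g \<gamma>' \<omega>'" "Omega_act C F g \<gamma> \<omega> = Omega_act C F g \<gamma>' \<omega>'"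
    using g p y e eq \<omega> by (simp_all add: Part_Omega anchor_Omega act_Omega)
  then obtain a where "a \<in> Arr (src_gpd g)" "ra g \<gamma> = Rng (src_gpd g) a"
    "Src (src_gpd g) a = Omega_anchor F (Src C g) \<omega>'" "\<gamma>' = ract (Corr F g) \<gamma> a"
    "\<omega> = Omega_act C F (Src C g) a \<omega>'" by (rule Omega_act_eqD)
  then show "\<exists>\<eta>\<in>Arr (src_gpd g). ra g \<gamma> = Rng (src_gpd g) \<eta> \<and> Src (src_gpd g) \<eta> = anchor ?\<Omega> y' \<and>
      \<gamma>' = ract (Corr F g) \<gamma> \<eta> \<and> y = act ?\<Omega> (Src C g) \<eta> y'"
    using Rng_ident[OF Src_Obj[OF g]] by (intro bexI[of _ a]) (simp_all add: \<omega> anchor_Omega act_Omega)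
qed

end

section \<open>Universality\<close>

context diagram_action
begin

abbreviation act_on :: "'c \<Rightarrow> 'a \<Rightarrow> 'y \<Rightarrow> bool" where
  "act_on g \<gamma> y \<equiv> g \<in> Arr C \<and> \<gamma> \<in> pts F g \<and> y \<in> Part Y (Src C g) \<and> ra g \<gamma> = anchor Y y"

lemma Part_subset: "x \<in> Obj C \<Longrightarrow> Part Y x \<subseteq> topspace (Carrier Y)"
  by (rule openin_subset[OF Part_open])

lemma topspace_Part_top: "x \<in> Obj C \<Longrightarrow> topspace (Part_top Y x) = Part Y x"
  using Part_subset by (auto simp: Part_top_def)

lemma mem_action_domain:
  "g \<in> Arr C \<Longrightarrow> (\<gamma>, y) \<in> topspace (action_domain C F Y g) \<longleftrightarrow> act_on g \<gamma> y"
  by (simp add: action_domain_def topspace_fibre_product topspace_Part_top[OF Src_Obj] pts_def)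

lemma act_in_Part:
  assumes "act_on g \<gamma> y"
  shows "act Y g \<gamma> y \<in> Part Y (Rng C g)"
proof -
  have "(\<gamma>, y) \<in> topspace (action_domain C F Y g)" using assms mem_action_domain by blast
  then have "(\<lambda>(\<gamma>, y). act Y g \<gamma> y) (\<gamma>, y) \<in> (\<lambda>(\<gamma>, y). act Y g \<gamma> y) ` topspace (action_domain C F Y g)"
    by (rule imageI)
  then show ?thesis using act_surj[of g] assms by simp
qed

lemma act_cases:
  assumes "g \<in> Arr C" "y \<in> Part Y (Rng C g)"
  obtains \<gamma> y' where "act_on g \<gamma> y'" "y = act Y g \<gamma> y'"
proof -
  obtain p where "p \<in> topspace (action_domain C F Y g)" "y = (\<lambda>(\<gamma>, y). act Y g \<gamma> y) p"
    using act_surj[OF assms(1)] assms(2) by blast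
  then show thesis using that[of "fst p" "snd p"] mem_action_domain[OF assms(1), of "fst p" "snd p"]
    by (simp add: case_prod_unfold)
qed

text \<open>If \<open>y = \<gamma> \<cdot> y'\<close>, then the class of \<open>\<gamma>\<close> depends only on \<open>y\<close>. These classes are the coordinates
  of the canonical map into the limit.\<close>

definition orbit_of :: "'c \<Rightarrow> 'y \<Rightarrow> 'a set" where
  "orbit_of g y = (THE P. \<exists>\<gamma> y'. act_on g \<gamma> y' \<and> y = act Y g \<gamma> y' \<and> P = cls C F g \<gamma>)"

lemma orbit_of_act:
  assumes a: "act_on g \<gamma> y"
  shows "orbit_of g (act Y g \<gamma> y) = cls C F g \<gamma>"
  unfolding orbit_of_def
proof (rule the_equality)
  show "\<exists>\<gamma>' y'. act_on g \<gamma>' y' \<and> act Y g \<gamma> y = act Y g \<gamma>' y' \<and> cls C F g \<gamma> = cls C F g \<gamma>'"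
    using a by blast
  fix P assume "\<exists>\<gamma>' y'. act_on g \<gamma>' y' \<and> act Y g \<gamma> y = act Y g \<gamma>' y' \<and> P = cls C F g \<gamma>'"
  then obtain \<gamma>' y' where a': "act_on g \<gamma>' y'" "act Y g \<gamma> y = act Y g \<gamma>' y'" "P = cls C F g \<gamma>'"
    by blast
  have g: "g \<in> Arr C" and p: "\<gamma> \<in> pts F g" "\<gamma>' \<in> pts F g" using a a'(1) by simp_all
  have "\<exists>\<eta>\<in>Arr (src_gpd g). ra g \<gamma> = Rng (src_gpd g) \<eta> \<and> Src (src_gpd g) \<eta> = anchor Y y' \<and>
      \<gamma>' = ract (Corr F g) \<gamma> \<eta> \<and> y = act Y (Src C g) \<eta> y'"
    by (rule act_eq) (use a a' in simp_all)
  then show "P = cls C F g \<gamma>" unfolding a'(3) cls_eq_iff[OF g p] by blast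
qed

lemma orbit_of_in:
  assumes "g \<in> Arr C" "y \<in> Part Y (Rng C g)"
  shows "orbit_of g y \<in> topspace (orbit_top g)"
proof (rule act_cases[OF assms])
  fix \<gamma> y' assume a: "act_on g \<gamma> y'" "y = act Y g \<gamma> y'"
  then show ?thesis using orbit_of_act[OF a(1)] cls_in[of \<gamma> g] by simp
qed

text \<open>The action map is a continuous open surjection, hence a quotient map, and
  \<open>(\<gamma>, y) \<mapsto> [\<gamma>]\<close> is continuous on its domain.\<close>

lemma continuous_map_orbit_of:
  assumes g: "g \<in> Arr C"
  shows "continuous_map (Part_top Y (Rng C g)) (orbit_top g) (orbit_of g)"
proof (rule continuous_compose_quotient_map)
  show "quotient_map (action_domain C F Y g) (Part_top Y (Rng C g)) (\<lambda>(\<gamma>, y). act Y g \<gamma> y)"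
    using act_surj[OF g] topspace_Part_top[OF Rng_Obj[OF g]]
    by (intro continuous_open_imp_quotient_map act_continuous[OF g] act_open[OF g]) simp
  have "continuous_map (action_domain C F Y g) (orbit_top g) (cls C F g \<circ> fst)"
    unfolding action_domain_def
    by (rule continuous_map_compose[OF continuous_map_fst_fibre_product continuous_map_cls[OF g]])
  then show "continuous_map (action_domain C F Y g) (orbit_top g)
      (orbit_of g \<circ> (\<lambda>(\<gamma>, y). act Y g \<gamma> y))"
  proof (rule continuous_map_eq)
    fix p assume p: "p \<in> topspace (action_domain C F Y g)"
    obtain \<gamma> y where e: "p = (\<gamma>, y)" by (cases p)
    have "act_on g \<gamma> y" using p mem_action_domain[OF g] unfolding e by blast
    from orbit_of_act[OF this]
    show "(cls C F g \<circ> fst) p = (orbit_of g \<circ> (\<lambda>(\<gamma>, y). act Y g \<gamma> y)) p" by (simp add: e)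
  qed
qed

text \<open>If \<open>y = \<eta> \<cdot> z\<close>, then \<open>\<gamma> \<cdot> y = (\<gamma> \<cdot> \<eta>) \<cdot> z\<close>. This is both the equivariance of the
  canonical map and, by way of projections, the compatibility of its coordinates.\<close>

lemma orbit_of_Comp_act:
  assumes gh: "composable g h" and a: "act_on g \<gamma> y"
  shows "orbit_of (Comp C g h) (act Y g \<gamma> y) = orbit_mult g h \<gamma> (orbit_of h y)"
    and "anchor Y y = orbit_anchor h (orbit_of h y)"
proof -
  have h: "h \<in> Arr C" "y \<in> Part Y (Rng C h)" using gh a by simp_all
  obtain \<eta> z where b: "act_on h \<eta> z" "y = act Y h \<eta> z" by (rule act_cases[OF h])
  have \<gamma>: "\<gamma> \<in> pts F g" and \<eta>: "\<eta> \<in> pts F h" using a b by simp_all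
  have y: "anchor Y y = la h \<eta>" using anchor_act[of h \<eta> z] b by simp
  then have e: "ra g \<gamma> = la h \<eta>" using a by simp
  have c: "Comp C g h \<in> Arr C" "Src C (Comp C g h) = Src C h" using gh Comp_Arr Src_Comp by auto
  have "act Y g \<gamma> y = act Y (Comp C g h) (dot C F g h \<gamma> \<eta>) z"
    unfolding b(2) by (rule act_act) (use gh \<gamma> \<eta> b(1) e in simp_all)
  moreover have "act_on (Comp C g h) (dot C F g h \<gamma> \<eta>) z"
    using c b(1) dot_mem[OF gh \<gamma> \<eta> e] by simp
  ultimately show "orbit_of (Comp C g h) (act Y g \<gamma> y) = orbit_mult g h \<gamma> (orbit_of h y)"
    using orbit_of_act[of "Comp C g h"] orbit_of_act[OF b(1)] b(2) orbit_mult_cls[OF gh \<gamma> \<eta> e] by simp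
  show "anchor Y y = orbit_anchor h (orbit_of h y)"
    using orbit_of_act[OF b(1)] b(2) orbit_anchor_cls[OF h(1) \<eta>] y by simp
qed

lemma proj_orbit_of:
  assumes gh: "composable g h" and y: "y \<in> Part Y (Rng C g)"
  shows "proj C F g h (orbit_of (Comp C g h) y) = orbit_of g y"
proof -
  have g: "g \<in> Arr C" using gh by simp
  obtain \<gamma> z where a: "act_on g \<gamma> z" "y = act Y g \<gamma> z" by (rule act_cases[OF g y])
  have h: "h \<in> Arr C" "z \<in> Part Y (Rng C h)" using gh a by simp_all
  obtain \<eta> where \<eta>: "\<eta> \<in> pts F h" "orbit_of h z = cls C F h \<eta>"
    using orbit_of_in[OF h] by (rule cls_cases)
  have \<gamma>: "\<gamma> \<in> pts F g" using a by simp
  have e: "ra g \<gamma> = la h \<eta>"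
    using orbit_of_Comp_act(2)[OF gh a(1)] a(1) \<eta>(2) orbit_anchor_cls[OF h(1) \<eta>(1)] by simp
  show ?thesis
    using orbit_of_Comp_act(1)[OF gh a(1)] orbit_of_act[OF a(1)] a(2) \<eta>(2)
      orbit_mult_cls[OF gh \<gamma> \<eta>(1) e] proj_cls_dot[OF gh \<gamma> \<eta>(1) e] by simp
qed

definition orbit_family :: "'c \<Rightarrow> 'y \<Rightarrow> 'c \<Rightarrow> 'a set" where
  "orbit_family x y = restrict (\<lambda>g. orbit_of g y) {g \<in> Arr C. Rng C g = x}"

lemma orbit_family_in:
  assumes "y \<in> Part Y x"
  shows "orbit_family x y \<in> topspace (Om x)"
  unfolding mem_Omega_iff
proof (intro conjI ballI allI impI)
  show "orbit_family x y \<in> extensional {g \<in> Arr C. Rng C g = x}" by (simp add: orbit_family_def)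
  fix g assume "g \<in> Arr C" "Rng C g = x"
  then show "orbit_family x y g \<in> topspace (orbit_top g)"
    using orbit_of_in[of g y] assms by (simp add: orbit_family_def)
next
  fix g h assume "composable g h \<and> Rng C g = x"
  then have gh: "composable g h" and x: "Rng C g = x" by simp_all
  have "Comp C g h \<in> Arr C" "Rng C (Comp C g h) = x" using gh x Comp_Arr Rng_Comp by auto
  then show "proj C F g h (orbit_family x y (Comp C g h)) = orbit_family x y g"
    using proj_orbit_of[OF gh, of y] assms x gh by (simp add: orbit_family_def)
qed

lemma continuous_map_orbit_family:
  "x \<in> Obj C \<Longrightarrow> continuous_map (Part_top Y x) (Om x) (orbit_family x)"
proof (rule continuous_map_into_OmegaI)
  assume x: "x \<in> Obj C"
  show "orbit_family x \<in> topspace (Part_top Y x) \<rightarrow> topspace (Om x)"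
    unfolding topspace_Part_top[OF x] by (intro Pi_I orbit_family_in)
  fix g assume g: "g \<in> Arr C" "Rng C g = x"
  then show "continuous_map (Part_top Y x) (orbit_top g) (\<lambda>y. orbit_family x y g)"
    using continuous_map_orbit_of[OF g(1)] by (simp add: orbit_family_def eta_contract_eq)
qed

lemma Omega_anchor_orbit_family:
  assumes x: "x \<in> Obj C" and y: "y \<in> Part Y x"
  shows "Omega_anchor F x (orbit_family x y) = anchor Y y"
proof -
  have xA: "x \<in> Arr C" "Rng C x = x" using Obj_ArrC[OF x] Rng_ident[OF x] by simp_all
  have y': "y \<in> Part Y (Rng C x)" using y xA(2) by simp
  obtain \<gamma> z where a: "act_on x \<gamma> z" "y = act Y x \<gamma> z" by (rule act_cases[OF xA(1) y'])
  have "orbit_family x y x = cls C F x \<gamma>" using xA orbit_of_act[OF a(1)] a(2) by (simp add: orbit_family_def)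
  then show ?thesis
    using Omega_anchor_ident[OF x orbit_family_in[OF y]] orbit_anchor_cls[OF xA(1), of \<gamma>] a
      anchor_act[of x \<gamma> z] by simp
qed

text \<open>A point of an action does not carry the index of its part, but the points of the limit
  do.\<close>

definition part_index :: "'y \<Rightarrow> 'c" where
  "part_index y = (THE x. x \<in> Obj C \<and> y \<in> Part Y x)"

lemma part_index: "\<lbrakk>x \<in> Obj C; y \<in> Part Y x\<rbrakk> \<Longrightarrow> part_index y = x"
  unfolding part_index_def
  by (rule the_equality) (use Part_disjoint in \<open>auto simp: disjoint_family_on_def\<close>)

text \<open>The restriction to the carrier singles out one representative among the functions that
  agree on the space.\<close>

definition to_limit :: "'y \<Rightarrow> 'c \<times> ('c \<Rightarrow> 'a set)" where
  "to_limit = restrict (\<lambda>y. (part_index y, orbit_family (part_index y) y)) (topspace (Carrier Y))"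

lemma to_limit_Part:
  assumes "x \<in> Obj C" "y \<in> Part Y x"
  shows "to_limit y = (x, orbit_family x y)"
  using part_index[OF assms] Part_subset[OF assms(1)] assms(2) by (auto simp: to_limit_def)

end

context ore_diagram
begin

lemma equivariant_map_to_limit:
  assumes "diagram_action C F Y"
  shows "equivariant_map C F Y (Omega C F) (diagram_action.to_limit C F Y)"
proof -
  interpret Y: diagram_action C F Y by fact
  show ?thesis
    unfolding equivariant_map_def
  proof (intro conjI ballI impI)
    show "continuous_map (Carrier Y) (Carrier (Omega C F)) Y.to_limit"
    proof (rule pasting_lemma[where I = "Obj C" and T = "Part Y" and f = "\<lambda>x y. (x, Y.orbit_family x y)"])
      fix x assume x: "x \<in> Obj C"
      show "openin (Carrier Y) (Part Y x)" by (rule Y.Part_open[OF x])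
      have "continuous_map (Part_top Y x) (Carrier (Omega C F)) (Pair x \<circ> Y.orbit_family x)"
        unfolding Carrier_Omega
        by (rule continuous_map_compose[OF Y.continuous_map_orbit_family[OF x]
              continuous_map_component_injection[where X = Om, OF x]])
      then show "continuous_map (subtopology (Carrier Y) (Part Y x)) (Carrier (Omega C F))
          (\<lambda>y. (x, Y.orbit_family x y))" by (simp add: o_def Part_top_def)
    next
      fix x x' y assume "x \<in> Obj C" "x' \<in> Obj C" "y \<in> topspace (Carrier Y) \<inter> Part Y x \<inter> Part Y x'"
      then show "(x, Y.orbit_family x y) = (x', Y.orbit_family x' y)"
        using Y.part_index[of x y] Y.part_index[of x' y] by simp
    next
      fix y assume "y \<in> topspace (Carrier Y)"
      then obtain x where "x \<in> Obj C" "y \<in> Part Y x" using Y.Part_Union by blast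
      then show "\<exists>x. x \<in> Obj C \<and> y \<in> Part Y x \<and> Y.to_limit y = (x, Y.orbit_family x y)"
        using Y.to_limit_Part by blast
    qed
  next
    fix x y assume x: "x \<in> Obj C" "y \<in> Part Y x"
    show "Y.to_limit y \<in> Part (Omega C F) x"
      using Y.to_limit_Part[OF x] Y.orbit_family_in[OF x(2)] by (simp add: Part_Omega)
    show "anchor (Omega C F) (Y.to_limit y) = anchor Y y"
      using Y.to_limit_Part[OF x] Y.Omega_anchor_orbit_family[OF x] by (simp add: anchor_Omega)
  next
    fix g \<gamma> y assume g: "g \<in> Arr C" and \<gamma>: "\<gamma> \<in> pts F g" and y: "y \<in> Part Y (Src C g)"
      and e: "ra g \<gamma> = anchor Y y"
    note S = Src_Obj[OF g] and R = Rng_Obj[OF g]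
    have a: "Y.act_on g \<gamma> y" using g \<gamma> y e by simp
    have act: "acts g \<gamma> (Y.orbit_family (Src C g) y)"
      using g \<gamma> Y.orbit_family_in[OF y] e Y.Omega_anchor_orbit_family[OF S y] by simp
    have "Omega_act C F g \<gamma> (Y.orbit_family (Src C g) y) = Y.orbit_family (Rng C g) (act Y g \<gamma> y)"
    proof (rule Omega_act_eqI[OF act Y.orbit_family_in[OF Y.act_in_Part[OF a]]])
      fix h assume gh: "composable g h"
      have "Comp C g h \<in> Arr C" "Rng C (Comp C g h) = Rng C g" using gh Comp_Arr Rng_Comp by auto
      then show "Y.orbit_family (Rng C g) (act Y g \<gamma> y) (Comp C g h) =
          orbit_mult g h \<gamma> (Y.orbit_family (Src C g) y h)"
        using Y.orbit_of_Comp_act(1)[OF gh a] gh by (simp add: Y.orbit_family_def)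
    qed
    then show "Y.to_limit (act Y g \<gamma> y) = act (Omega C F) g \<gamma> (Y.to_limit y)"
      using Y.to_limit_Part[OF S y] Y.to_limit_Part[OF R Y.act_in_Part[OF a]] by (simp add: act_Omega)
  qed
qed

text \<open>For an arrow \<open>g\<close>, write \<open>y = \<gamma> \<cdot> z\<close>. Equivariance gives \<open>\<phi> y = \<gamma> \<cdot> \<phi> z\<close>, whose
  coordinate at \<open>g\<close> is the class of \<open>\<gamma>\<close>, whatever \<open>\<phi> z\<close> is.\<close>

lemma equivariant_map_to_Omega_unique:
  assumes "diagram_action C F Y" and \<phi>: "equivariant_map C F Y (Omega C F) \<phi>"
    and x: "x \<in> Obj C" "y \<in> Part Y x"
  shows "\<phi> y = (x, diagram_action.orbit_family C F Y x y)"
proof -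
  interpret Y: diagram_action C F Y by fact
  have part: "\<phi> y \<in> Part (Omega C F) x" "anchor (Omega C F) (\<phi> y) = anchor Y y"
    if "x \<in> Obj C" "y \<in> Part Y x" for x y
    using \<phi> that unfolding equivariant_map_def by blast+
  obtain \<omega> where \<omega>: "\<phi> y = (x, \<omega>)" "\<omega> \<in> topspace (Om x)" using part(1)[OF x] by (auto simp: Part_Omega)
  have "\<omega> = Y.orbit_family x y"
  proof (rule Omega_eqI[OF \<omega>(2) Y.orbit_family_in[OF x(2)]])
    fix g assume g: "g \<in> Arr C" "Rng C g = x"
    have y: "y \<in> Part Y (Rng C g)" using g x by simp
    obtain \<gamma> z where a: "Y.act_on g \<gamma> z" "y = act Y g \<gamma> z" by (rule Y.act_cases[OF g(1) y])
    note S = Src_Obj[OF g(1)]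
    have z: "z \<in> Part Y (Src C g)" using a by simp
    obtain \<zeta> where \<zeta>: "\<phi> z = (Src C g, \<zeta>)" "\<zeta> \<in> topspace (Om (Src C g))"
      using part(1)[OF S z] by (auto simp: Part_Omega)
    have "acts g \<gamma> \<zeta>" using a(1) \<zeta> part(2)[OF S z] by (simp add: anchor_Omega)
    from Omega_act_at[OF this] have "Omega_act C F g \<gamma> \<zeta> g = cls C F g \<gamma>" .
    moreover have "\<phi> y = act (Omega C F) g \<gamma> (\<phi> z)"
      using \<phi> a unfolding equivariant_map_def by blast
    ultimately have "\<omega> g = cls C F g \<gamma>" using \<omega>(1) \<zeta>(1) by (simp add: act_Omega)
    then show "\<omega> g = Y.orbit_family x y g"
      using Y.orbit_of_act[OF a(1)] a(2) g by (simp add: Y.orbit_family_def)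
  qed
  then show ?thesis using \<omega>(1) by simp
qed

end

theorem theorem8p7:
  fixes C :: "'c category" and F :: "('c, 'a) diagram_data"
  assumes "small_category C"
    and "right_Ore C"
    and "groupoid_diagram C F"
  shows "universal_action TYPE('y) C F (Omega C F)"
proof -
  interpret ore_diagram C F
    using assms(2,3) by (simp add: ore_diagram_def ore_diagram_axioms_def)
  show ?thesis
    unfolding universal_action_def
  proof (intro conjI allI impI diagram_action_Omega)
    fix Y :: "('c, 'a, 'y) action_data" assume Y: "diagram_action C F Y"
    interpret Y: diagram_action C F Y by fact
    show "\<exists>!\<phi>. \<phi> \<in> extensional (topspace (Carrier Y)) \<and> equivariant_map C F Y (Omega C F) \<phi>"
    proof (rule ex1I)
      show "Y.to_limit \<in> extensional (topspace (Carrier Y)) \<and>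
          equivariant_map C F Y (Omega C F) Y.to_limit"
        using equivariant_map_to_limit[OF Y] by (simp add: Y.to_limit_def)
      fix \<phi> assume \<phi>: "\<phi> \<in> extensional (topspace (Carrier Y)) \<and> equivariant_map C F Y (Omega C F) \<phi>"
      show "\<phi> = Y.to_limit"
      proof (rule extensionalityI)
        show "\<phi> \<in> extensional (topspace (Carrier Y))" using \<phi> by simp
        show "Y.to_limit \<in> extensional (topspace (Carrier Y))" by (simp add: Y.to_limit_def)
        fix y assume "y \<in> topspace (Carrier Y)"
        then obtain x where "x \<in> Obj C" "y \<in> Part Y x" using Y.Part_Union by blast
        then show "\<phi> y = Y.to_limit y"
          using equivariant_map_to_Omega_unique[OF Y] \<phi> Y.to_limit_Part by simp
      qed
    qed
  qed
qed

end
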